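(* Let $p$ be a prime and let $G$ be a finite $p$-group. Then the graded ring $R^*_{\mathbb Q}(G)$ is concentrated in degrees that are multiples of $p-1$, i.e. $R^n_{\mathbb Q}(G)=0$ whenever $p-1$ does not divide $n$. In particular, for any prime $p$ and $C_p$ the cyclic group of order $p$, there is an isomorphism of graded rings $$R^*_{\mathbb Q}(C_p)\cong\frac{\mathbb Z[x]}{(px)},\qquad |x|=p-1.$$
   Context: Let $G$ be a finite group. $R_{\mathbb Q}(G)$ is the ring of virtual characters of $G$ over $\mathbb Q$ (the free abelian group on the characters of irreducible $\mathbb Q$-representations, with product induced by tensor product; equivalently the Grothendieck ring of finitely generated $\mathbb Q G$-modules), with augmentation $\epsilon:R_{\mathbb Q}(G)\to\mathbb Z$ the degree map and $I=\ker\epsilon$. Exterior powers of representations give maps $\lambda^n$ on characters, extended to $R_{\mathbb Q}(G)$ by requiring $\lambda^0=1$ and $\lambda^n(x+y)=\sum_{i+j=n}\lambda^i(x)\lambda^j(y)$. Put $\gamma^n(x)=\lambda^n(x+n-1)$. Let $\Gamma^n\subseteq R_{\mathbb Q}(G)$ be the additive subgroup generated by all products $\gamma^{i_1}(x_1)\cdots\gamma^{i_r}(x_r)$ with $x_j\in I$ and $\sum_j i_j\ge n$; then $\Gamma^0=R_{\mathbb Q}(G)$, $\Gamma^1=I$, $\Gamma^m\Gamma^n\subseteq\Gamma^{m+n}$. The graded character ring is $R^*_{\mathbb Q}(G)=\bigoplus_{n\ge0}R^n_{\mathbb Q}(G)$ with $R^n_{\mathbb Q}(G)=\Gamma^n/\Gamma^{n+1}$.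 $|x|$ denotes the degree of a homogeneous element $x$. *)

theory Defs
  imports
    "Jordan_Normal_Form.Determinant"
    "Jordan_Normal_Form.VS_Connect"
    "HOL-Algebra.Algebra"
begin

section \<open>Rational representations and their exterior powers\<close>

text \<open>Finitely generated modules over the rational group algebra of \<open>G\<close> are given by matrix
  representations, i.e. homomorphisms into the unit group of the ring of \<open>n \<times> n\<close> matrices.\<close>

definition rat_rep :: "('g, 'm) monoid_scheme \<Rightarrow> nat \<Rightarrow> ('g \<Rightarrow> rat mat) \<Rightarrow> bool" where
  "rat_rep G n \<rho> \<longleftrightarrow> \<rho> \<in> hom G (units_of (ring_mat TYPE(rat) n ()))"

definition irreducible_rat_rep :: "('g, 'm) monoid_scheme \<Rightarrow> nat \<Rightarrow> ('g \<Rightarrow> rat mat) \<Rightarrow> bool" where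
  "irreducible_rat_rep G n \<rho> \<longleftrightarrow>
     rat_rep G n \<rho> \<and> n > 0 \<and>
     (\<forall>W. VectorSpace.subspace class_ring W (module_vec TYPE(rat) n) \<and>
          (\<forall>g\<in>carrier G. \<forall>w\<in>W. \<rho> g *\<^sub>v w \<in> W)
        \<longrightarrow> W = {0\<^sub>v n} \<or> W = carrier_vec n)"

definition mat_trace :: "rat mat \<Rightarrow> rat" where
  "mat_trace A = (\<Sum>i<dim_row A. A $$ (i, i))"

definition rep_char :: "('g, 'm) monoid_scheme \<Rightarrow> ('g \<Rightarrow> rat mat) \<Rightarrow> 'g \<Rightarrow> rat" where
  "rep_char G \<rho> = (\<lambda>g\<in>carrier G. mat_trace (\<rho> g))"

text \<open>The \<open>k\<close>-element subsets of \<open>{0..<n}\<close>, each as a strictly increasing list; they index the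
  standard basis \<open>e\<^sub>S = e\<^bsub>S ! 0\<^esub> \<and> \<dots> \<and> e\<^bsub>S ! (k - 1)\<^esub>\<close> of the \<open>k\<close>-th exterior power of an
  \<open>n\<close>-dimensional space.\<close>

definition ext_basis :: "nat \<Rightarrow> nat \<Rightarrow> nat list list" where
  "ext_basis k n = filter (\<lambda>S. length S = k) (subseqs [0..<n])"

text \<open>The matrix in that basis of the \<open>k\<close>-th exterior power of the endomorphism given by the square
  matrix \<open>A\<close>: since \<open>A e\<^bsub>T ! 0\<^esub> \<and> \<dots> \<and> A e\<^bsub>T ! (k - 1)\<^esub>\<close> has \<open>e\<^sub>S\<close>-coordinate the minor of \<open>A\<close> with
  rows \<open>S\<close> and columns \<open>T\<close>, this is the matrix of all \<open>k \<times> k\<close> minors.\<close>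

definition ext_power_mat :: "nat \<Rightarrow> rat mat \<Rightarrow> rat mat" where
  "ext_power_mat k A =
     (let B = ext_basis k (dim_row A) in
      mat (length B) (length B)
        (\<lambda>(s, t). det (mat k k (\<lambda>(i, j). A $$ (B ! s ! i, B ! t ! j)))))"

definition ext_power :: "nat \<Rightarrow> ('g \<Rightarrow> rat mat) \<Rightarrow> 'g \<Rightarrow> rat mat" where
  "ext_power k \<rho> = (\<lambda>g. ext_power_mat k (\<rho> g))"


section \<open>The ring of virtual characters\<close>

definition fun_ring :: "('g, 'm) monoid_scheme \<Rightarrow> ('g \<Rightarrow> rat) ring" where
  "fun_ring G = \<lparr>
     carrier = carrier G \<rightarrow>\<^sub>E UNIV,
     monoid.mult = (\<lambda>x y. \<lambda>g\<in>carrier G. x g * y g),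
     monoid.one = (\<lambda>g\<in>carrier G. 1),
     ring.zero = (\<lambda>g\<in>carrier G. 0),
     ring.add = (\<lambda>x y. \<lambda>g\<in>carrier G. x g + y g)\<rparr>"

text \<open>The additive group spanned by the irreducible rational characters. The pointwise product is the
  one induced by the tensor product of representations, as the trace is multiplicative on Kronecker
  products.\<close>

definition char_ring :: "('g, 'm) monoid_scheme \<Rightarrow> ('g \<Rightarrow> rat) ring" where
  "char_ring G = (fun_ring G)
     \<lparr>carrier := generate (add_monoid (fun_ring G))
                  {rep_char G \<rho> | n \<rho>. irreducible_rat_rep G n \<rho>}\<rparr>"

text \<open>The degree of a representation is the value of its character at the identity.\<close>

definition augmentation :: "('g, 'm) monoid_scheme \<Rightarrow> ('g \<Rightarrow> rat) \<Rightarrow> rat" where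
  "augmentation G x = x \<one>\<^bsub>G\<^esub>"

definition augmentation_ideal :: "('g, 'm) monoid_scheme \<Rightarrow> ('g \<Rightarrow> rat) set" where
  "augmentation_ideal G = {x \<in> carrier (char_ring G). augmentation G x = 0}"


section \<open>Lambda and gamma operations\<close>

definition is_lambda_operations ::
  "('g, 'm) monoid_scheme \<Rightarrow> (nat \<Rightarrow> ('g \<Rightarrow> rat) \<Rightarrow> ('g \<Rightarrow> rat)) \<Rightarrow> bool" where
  "is_lambda_operations G L \<longleftrightarrow>
     (\<forall>n. L n \<in> carrier (char_ring G) \<rightarrow> carrier (char_ring G)) \<and>
     (\<forall>d \<rho> n. rat_rep G d \<rho> \<longrightarrow> L n (rep_char G \<rho>) = rep_char G (ext_power n \<rho>)) \<and>
     (\<forall>x\<in>carrier (char_ring G). L 0 x = \<one>\<^bsub>char_ring G\<^esub>) \<and>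
     (\<forall>n. \<forall>x\<in>carrier (char_ring G). \<forall>y\<in>carrier (char_ring G).
        L n (x \<oplus>\<^bsub>char_ring G\<^esub> y) =
        (\<Oplus>\<^bsub>char_ring G\<^esub> i\<in>{..n}. L i x \<otimes>\<^bsub>char_ring G\<^esub> L (n - i) y))"

text \<open>For a finite group \<open>G\<close> such operations exist, and their restrictions to the virtual characters
  are unique, so the choice matters only for arguments outside \<open>char_ring G\<close>.\<close>

definition lambda_op :: "('g, 'm) monoid_scheme \<Rightarrow> nat \<Rightarrow> ('g \<Rightarrow> rat) \<Rightarrow> ('g \<Rightarrow> rat)" where
  "lambda_op G = (SOME L. is_lambda_operations G L)"

text \<open>The integer \<open>n - 1\<close> (which is \<open>-1\<close> for \<open>n = 0\<close>) is a constant function.\<close>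

definition gamma_op :: "('g, 'm) monoid_scheme \<Rightarrow> nat \<Rightarrow> ('g \<Rightarrow> rat) \<Rightarrow> ('g \<Rightarrow> rat)" where
  "gamma_op G n x = lambda_op G n (x \<oplus>\<^bsub>char_ring G\<^esub> (\<lambda>g\<in>carrier G. rat_of_nat n - 1))"

definition gamma_product :: "('g, 'm) monoid_scheme \<Rightarrow> (nat \<times> ('g \<Rightarrow> rat)) list \<Rightarrow> ('g \<Rightarrow> rat)" where
  "gamma_product G ps =
     foldr (\<otimes>\<^bsub>char_ring G\<^esub>) (map (\<lambda>(i, x). gamma_op G i x) ps) \<one>\<^bsub>char_ring G\<^esub>"

definition gamma_filtration :: "('g, 'm) monoid_scheme \<Rightarrow> nat \<Rightarrow> ('g \<Rightarrow> rat) set" where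
  "gamma_filtration G n = generate (add_monoid (char_ring G))
     {gamma_product G ps | ps. snd ` set ps \<subseteq> augmentation_ideal G \<and> n \<le> sum_list (map fst ps)}"


section \<open>The graded character ring\<close>

text \<open>The group of cosets of \<open>gamma_filtration G (n + 1)\<close> in \<open>gamma_filtration G n\<close>; as always with
  \<open>A_Mod\<close>, it is written multiplicatively.\<close>

definition graded_piece :: "('g, 'm) monoid_scheme \<Rightarrow> nat \<Rightarrow> ('g \<Rightarrow> rat) set monoid" where
  "graded_piece G n =
     ((char_ring G)\<lparr>carrier := gamma_filtration G n\<rparr>) A_Mod (gamma_filtration G (n + 1))"

text \<open>The external direct sum of the graded pieces. The product of the classes of
  \<open>x \<in> gamma_filtration G i\<close> and \<open>y \<in> gamma_filtration G j\<close> is the class of \<open>x y\<close> modulo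
  \<open>gamma_filtration G (i + j + 1)\<close>; the \<open>finprod\<close> is a sum in the group \<open>graded_piece G n\<close>.\<close>

definition graded_char_ring :: "('g, 'm) monoid_scheme \<Rightarrow> (nat \<Rightarrow> ('g \<Rightarrow> rat) set) ring" where
  "graded_char_ring G = \<lparr>
     carrier = carrier (sum_group UNIV (graded_piece G)),
     monoid.mult = (\<lambda>a b n. finprod (graded_piece G n)
        (\<lambda>i. rcoset_mult (char_ring G) (gamma_filtration G (n + 1)) (a i) (b (n - i))) {..n}),
     monoid.one = (\<lambda>n. if n = 0 then gamma_filtration G 1 +>\<^bsub>char_ring G\<^esub> \<one>\<^bsub>char_ring G\<^esub>
                else \<one>\<^bsub>graded_piece G n\<^esub>),
     ring.zero = \<one>\<^bsub>sum_group UNIV (graded_piece G)\<^esub>,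
     ring.add = (\<lambda>a b. a \<otimes>\<^bsub>sum_group UNIV (graded_piece G)\<^esub> b)\<rparr>"

definition graded_char_ring_component ::
  "('g, 'm) monoid_scheme \<Rightarrow> nat \<Rightarrow> (nat \<Rightarrow> ('g \<Rightarrow> rat) set) set" where
  "graded_char_ring_component G n =
     {a \<in> carrier (graded_char_ring G). \<forall>m. m \<noteq> n \<longrightarrow> a m = \<one>\<^bsub>graded_piece G m\<^esub>}"

definition graded_ring_iso ::
  "('a, 'm) ring_scheme \<Rightarrow> (nat \<Rightarrow> 'a set) \<Rightarrow> ('b, 'n) ring_scheme \<Rightarrow> (nat \<Rightarrow> 'b set) \<Rightarrow> ('a \<Rightarrow> 'b) set"
  where
  "graded_ring_iso A AG B BG = {h \<in> ring_iso A B. \<forall>n. h ` AG n = BG n}"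


section \<open>The quotient of the integer polynomial ring by \<open>p x\<close>\<close>

definition ideal_px :: "nat \<Rightarrow> (nat \<Rightarrow> int) set" where
  "ideal_px p = PIdl\<^bsub>UP \<Z>\<^esub> (up_ring.monom (UP \<Z>) (int p) 1)"

definition poly_quot_px :: "nat \<Rightarrow> (nat \<Rightarrow> int) set ring" where
  "poly_quot_px p = UP \<Z> Quot ideal_px p"

text \<open>The classes of the polynomials that are homogeneous of degree \<open>n\<close> when \<open>x\<close> has degree \<open>d\<close>.\<close>

definition poly_quot_px_component :: "nat \<Rightarrow> nat \<Rightarrow> nat \<Rightarrow> (nat \<Rightarrow> int) set set" where
  "poly_quot_px_component p d n =
     (\<lambda>f. ideal_px p +>\<^bsub>UP \<Z>\<^esub> f) `
       {f \<in> carrier (UP \<Z>). \<forall>k. up_ring.coeff (UP \<Z>) f k \<noteq> 0 \<longrightarrow> k * d = n}"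

end

theory Submission
  imports Defs "Jordan_Normal_Form.Schur_Decomposition" "Jordan_Normal_Form.DL_Rank"
    "HOL-Computational_Algebra.Formal_Power_Series" "HOL-Number_Theory.Residue_Primitive_Roots"
    "Subresultants.Subresultant_Gcd"
begin

text \<open>
  Rationality: the eigenvalues of an element of \<open>p\<close>-power order under a rational representation come in
  full Galois orbits, because the cyclotomic polynomials of \<open>p\<close>-power order are irreducible. Hence
  \<open>x (g\<^sup>k) = x g\<close> for every rational character \<open>x\<close> of a \<open>p\<close>-group and \<open>k\<close> prime to \<open>p\<close>, i.e. the Adams
  operation \<open>\<psi>\<^sup>k\<close> is the identity. On the other hand \<open>\<psi>\<^sup>k\<close> is multiplication by \<open>k\<^sup>n\<close> on \<open>\<Gamma>\<^sup>n / \<Gamma>\<^bsup>n + 1\<^esup>\<close>: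
  \<open>\<gamma>\<^sup>n (V - dim V)\<close> is the \<open>n\<close>-th elementary symmetric function of the eigenvalues of \<open>\<rho> g - 1\<close>, that
  matrix may be replaced by its companion matrix \<open>A\<close>, whose entry \<open>(i, j)\<close> lies in \<open>\<Gamma>\<^bsup>j - i + 1\<^esup>\<close>, and
  \<open>(1 + A)\<^sup>k - 1\<close> agrees with \<open>k A\<close> up to terms of higher filtration. So \<open>k\<^sup>n - 1\<close> annihilates degree
  \<open>n\<close>, as does the order of \<open>G\<close> for \<open>n > 0\<close>; if \<open>k\<close> is a primitive root mod \<open>p\<close> and \<open>p - 1\<close> does not
  divide \<open>n\<close>, these two integers are coprime.

  For \<open>C\<^sub>p\<close> the augmentation ideal is generated by \<open>u = r - p\<close>, \<open>r\<close> the regular character. Outside the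
  identity the \<open>\<gamma>\<close>-series of \<open>u\<close> is \<open>(1 - t)\<^sup>p - (- t)\<^sup>p\<close>, of degree \<open>p - 1\<close> and congruent to 1 modulo \<open>p\<close>,
  so the coefficient of \<open>t\<^sup>i\<close> in products of powers of such series is divisible by \<open>p\<close> to the power
  \<open>i / (p - 1)\<close> rounded up. Together with \<open>u\<^sup>2 = - p u\<close> this determines \<open>\<Gamma>\<^sup>n\<close>, and \<open>x\<close> corresponds to the
  class of \<open>u\<close> in degree \<open>p - 1\<close>.\<close>

section \<open>Exterior powers of matrices\<close>

text \<open>The usual proof that \<psi>^k acts as k^n splits a character into line elements. This is
  impossible inside the rational representation ring: the eigenvalues of \<open>\<rho> g\<close>,
  taken as functions of g, are not virtual characters, and the entries of
  \<open>\<rho> g - 1\<close> carry no filtration degree. Only the coefficients of the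
  characteristic polynomial of \<open>\<rho> g - 1\<close> do; up to sign they are the values
  \<gamma>^i(V - dim V). The companion matrix has just these coefficients, 0 and 1 as entries, and
  it may be used because the trace of each exterior power of (1 + A)^k - 1 is a function of the
  eigenvalues of A alone. The degree j - i + 1 is compatible with matrix multiplication, and in the
  Leibniz expansion of a principal minor the shifts j - i cancel. The lambda operations are handled
  pointwise, as exponentials of power series in the values x(g^m). Additivity is then the
  exponential law, and the operations selected by \<open>lambda_op\<close> agree with these series
  by uniqueness.\<close>

definition minors_mat :: "nat \<Rightarrow> 'a::comm_ring_1 mat \<Rightarrow> 'a mat" where
  "minors_mat k A =
     (let B = ext_basis k (dim_row A) in
      mat (length B) (length B)
        (\<lambda>(s, t). det (mat k k (\<lambda>(i, j). A $$ (B ! s ! i, B ! t ! j)))))"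

text \<open>Minors over a general commutative ring are needed because eigenvalues, and hence
  triangular forms, are only available over the complex numbers.\<close>

lemma ext_power_mat_eq: "ext_power_mat k A = minors_mat k A"
  unfolding ext_power_mat_def minors_mat_def ..

lemma distinct_ext_basis: "distinct (ext_basis k n)"
  unfolding ext_basis_def
  by (rule distinct_filter) (use distinct_set_subseqs[of "[0..<n]"] in \<open>simp add: distinct_map\<close>)

lemma sorted_wrt_subseqs: "xs \<in> set (subseqs ys) \<Longrightarrow> sorted_wrt P ys \<Longrightarrow> sorted_wrt P xs"
proof (induction ys arbitrary: xs)
  case (Cons y ys)
  have "set ` set (subseqs ys) = Pow (set ys)" by (rule subseqs_powset)
  hence "zs \<in> set (subseqs ys) \<Longrightarrow> set zs \<subseteq> set ys" for zs by blast
  with Cons show ?case by (auto simp: Let_def) blast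
qed simp

lemma ext_basisD:
  assumes "S \<in> set (ext_basis k n)"
  shows "length S = k" "distinct S" "set S \<subseteq> {0..<n}" "sorted_wrt (<) S"
proof -
  have S: "S \<in> set (subseqs [0..<n])" "length S = k" using assms by (auto simp: ext_basis_def)
  show "length S = k" by fact
  show "distinct S" using subseqs_distinctD[OF S(1)] by simp
  show "set S \<subseteq> {0..<n}" using subseqs_powset[of "[0..<n]"] S(1) by auto
  show "sorted_wrt (<) S" by (rule sorted_wrt_subseqs[OF S(1)]) simp
qed

lemma ext_basis_nth_less: "S \<in> set (ext_basis k n) \<Longrightarrow> i < k \<Longrightarrow> S ! i < n"
  using ext_basisD[of S k n] by (metis atLeastLessThan_iff nth_mem subsetD)

lemma ext_basis_unique:
  assumes "S \<in> set (ext_basis k n)" "T \<in> set (ext_basis k n)" "set S = set T"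
  shows "S = T"
  using assms ext_basisD(4) strict_sorted_equal by blast

lemma ext_basis_exists:
  assumes "U \<subseteq> {0..<n}" "card U = k"
  shows "\<exists>S\<in>set (ext_basis k n). set S = U"
proof -
  obtain S where S: "S \<in> set (subseqs [0..<n])" "set S = U"
    using subset_subseqs[of U "[0..<n]"] assms(1) by auto
  have "distinct S" using subseqs_distinctD[OF S(1)] by simp
  hence "length S = k" using S(2) assms(2) distinct_card by fastforce
  with S show ?thesis by (auto simp: ext_basis_def)
qed

lemma sum_nth_ext_basis:
  "(\<Sum>s<length (ext_basis k n). f (ext_basis k n ! s)) = (\<Sum>S\<in>set (ext_basis k n). f S)"
proof -
  have "(\<Sum>S\<in>set (ext_basis k n). f S) = sum_list (map f (ext_basis k n))"
    by (rule sum_list_distinct_conv_sum_set[symmetric, OF distinct_ext_basis])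
  also have "\<dots> = (\<Sum>s<length (ext_basis k n). f (ext_basis k n ! s))"
    by (simp add: sum_list_sum_nth atLeast0LessThan)
  finally show ?thesis ..
qed

text \<open>An injective map from k positions into n indices amounts to its image, listed
  increasingly as S, and the permutation that tells in which order the image is run through. Outside
  \<open>{0..<k}\<close> the map is the identity, as in the index set produced by
  \<open>det_linear_rows_sum\<close>.\<close>

lemma bij_betw_ext_basis_permutations:
  "bij_betw (\<lambda>(S, p) i. if i < k then S ! p i else i)
     (set (ext_basis k n) \<times> {p. p permutes {0..<k}})
     {f. (\<forall>i\<in>{0..<k}. f i \<in> {0..<n}) \<and> (\<forall>i. i \<notin> {0..<k} \<longrightarrow> f i = i) \<and> inj_on f {0..<k}}"
  (is "bij_betw ?h ?D ?I")
proof (rule bij_betw_imageI)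
  have im: "(\<lambda>i. if i < k then S ! p i else i) ` {0..<k} = set S"
    if "S \<in> set (ext_basis k n)" "p permutes {0..<k}" for S p
  proof -
    have "(\<lambda>i. if i < k then S ! p i else i) ` {0..<k} = (\<lambda>i. S ! i) ` p ` {0..<k}"
      by (auto simp: image_iff)
    also have "\<dots> = set S" using permutes_image[OF that(2)] ext_basisD(1)[OF that(1)]
      by (auto simp: set_conv_nth)
    finally show ?thesis .
  qed
  show "inj_on ?h ?D"
  proof (rule inj_onI, clarify)
    fix S p T q
    assume S: "S \<in> set (ext_basis k n)" and T: "T \<in> set (ext_basis k n)"
      and p: "p permutes {0..<k}" and q: "q permutes {0..<k}"
      and eq: "(\<lambda>i. if i < k then S ! p i else i) = (\<lambda>i. if i < k then T ! q i else i)"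
    have ST: "S = T" by (rule ext_basis_unique[OF S T], unfold im[OF S p, symmetric] im[OF T q, symmetric] eq) simp
    have "p i = q i" for i
    proof (cases "i < k")
      case True
      have "S ! p i = S ! q i" using fun_cong[OF eq, of i] True ST by simp
      moreover have "p i < k" "q i < k"
        using True permutes_in_image[OF p, of i] permutes_in_image[OF q, of i] by auto
      ultimately show ?thesis
        using nth_eq_iff_index_eq[OF ext_basisD(2)[OF S]] ext_basisD(1)[OF S] by simp
    next
      case False
      thus ?thesis using p q by (simp add: permutes_def)
    qed
    with ST show "S = T \<and> p = q" by auto
  qed
  show "?h ` ?D = ?I"
  proof (intro equalityI subsetI)
    fix f assume "f \<in> ?h ` ?D"
    then obtain S p where S: "S \<in> set (ext_basis k n)" and p: "p permutes {0..<k}"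
      and f: "f = (\<lambda>i. if i < k then S ! p i else i)" by auto
    have pk: "p i < k" if "i < k" for i using permutes_in_image[OF p, of i] that by auto
    have "inj_on f {0..<k}"
    proof (rule inj_onI)
      fix i j assume "i \<in> {0..<k}" "j \<in> {0..<k}" "f i = f j"
      hence "p i = p j" using nth_eq_iff_index_eq[OF ext_basisD(2)[OF S]] ext_basisD(1)[OF S] pk
        by (simp add: f)
      thus "i = j" using permutes_inj[OF p] by (simp add: inj_eq)
    qed
    thus "f \<in> ?I" using ext_basis_nth_less[OF S] pk by (auto simp: f)
  next
    fix f assume f: "f \<in> ?I"
    have "card (f ` {0..<k}) = k" using f card_image by fastforce
    then obtain S where S: "S \<in> set (ext_basis k n)" "set S = f ` {0..<k}"
      using ext_basis_exists[of "f ` {0..<k}" n k] f by blast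
    \<comment> \<open>The position of \<open>f i\<close> in the increasing list S.\<close>
    define p where "p = (\<lambda>i. if i < k then (THE j. j < k \<and> S ! j = f i) else i)"
    have p: "p i < k \<and> S ! p i = f i" if "i < k" for i
    proof -
      have "f i \<in> set S" using S that by auto
      then obtain j where j: "j < k" "S ! j = f i" using ext_basisD(1)[OF S(1)] by (auto simp: in_set_conv_nth)
      have "\<exists>!j. j < k \<and> S ! j = f i"
        using j nth_eq_iff_index_eq[OF ext_basisD(2)[OF S(1)]] ext_basisD(1)[OF S(1)]
        by (intro ex1I[of _ j]) metis+
      from theI'[OF this] show ?thesis using that by (simp add: p_def)
    qed
    have inj: "inj_on p {0..<k}"
    proof (rule inj_onI)
      fix i j assume ij: "i \<in> {0..<k}" "j \<in> {0..<k}" "p i = p j"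
      hence "f i = f j" using p[of i] p[of j] by auto
      thus "i = j" using f ij by (auto simp: inj_on_def)
    qed
    have "p permutes {0..<k}"
    proof (rule bij_imp_permutes)
      have "p ` {0..<k} \<subseteq> {0..<k}" using p by auto
      thus "bij_betw p {0..<k} {0..<k}"
        using inj endo_inj_surj[of "{0..<k}" p] by (simp add: bij_betw_def)
    qed (simp add: p_def)
    moreover have "f = ?h (S, p)" using p f by (auto simp: fun_eq_iff)
    ultimately show "f \<in> ?h ` ?D" using S by blast
  qed
qed

text \<open>Row i of \<open>A * B\<close> is a combination of the rows of B, so multilinearity gives
  a sum over maps f that pick a row for each i. A repeated row kills the term; the injective f are
  grouped by their image S, and sorting the rows contributes the sign that turns the products of
  entries of A into a determinant.\<close>

theorem Cauchy_Binet:
  fixes A B :: "'a::comm_ring_1 mat"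
  assumes A: "A \<in> carrier_mat k n" and B: "B \<in> carrier_mat n k"
  shows "det (A * B) = (\<Sum>S\<in>set (ext_basis k n).
     det (mat k k (\<lambda>(i, j). A $$ (i, S ! j))) * det (mat k k (\<lambda>(i, j). B $$ (S ! i, j))))"
proof -
  let ?F = "{f. (\<forall>i\<in>{0..<k}. f i \<in> {0..<n}) \<and> (\<forall>i. i \<notin> {0..<k} \<longrightarrow> f i = i)}"
  let ?I = "{f. (\<forall>i\<in>{0..<k}. f i \<in> {0..<n}) \<and> (\<forall>i. i \<notin> {0..<k} \<longrightarrow> f i = i) \<and> inj_on f {0..<k}}"
  let ?P = "{p. p permutes {0..<k}}"
  let ?g = "\<lambda>f. (\<Prod>i = 0..<k. A $$ (i, f i)) * det (mat\<^sub>r k k (\<lambda>i. row B (f i)))"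
  have fin: "finite ?F" by (rule finite_bounded_functions) auto
  have "det (A * B) = (\<Sum>f\<in>?F. det (mat\<^sub>r k k (\<lambda>i. A $$ (i, f i) \<cdot>\<^sub>v row B (f i))))"
    unfolding mat_mul_finsum_alt[OF A B]
    by (rule det_linear_rows_sum) (use A B in auto)
  also have "\<dots> = (\<Sum>f\<in>?F. ?g f)"
    by (rule sum.cong[OF refl], rule det_rows_mul) (use B in auto)
  also have "\<dots> = (\<Sum>f\<in>?I. ?g f)"
  proof (rule sum.mono_neutral_right[OF fin])
    show "\<forall>f\<in>?F - ?I. ?g f = 0"
    proof
      fix f assume "f \<in> ?F - ?I"
      hence "\<not> inj_on f {0..<k}" by auto
      then obtain i j where ij: "i \<noteq> j" "i < k" "j < k" "f i = f j" by (auto simp: inj_on_def)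
      have "det (mat\<^sub>r k k (\<lambda>i. row B (f i))) = 0"
        by (rule det_identical_rows[of _ k i j]) (use ij in auto)
      thus "?g f = 0" by simp
    qed
  qed auto
  also have "\<dots> = (\<Sum>(S, p)\<in>set (ext_basis k n) \<times> ?P. ?g (\<lambda>i. if i < k then S ! p i else i))"
    by (subst sum.reindex_bij_betw[OF bij_betw_ext_basis_permutations, symmetric])
       (simp add: case_prod_unfold)
  also have "\<dots> = (\<Sum>S\<in>set (ext_basis k n). \<Sum>p\<in>?P. ?g (\<lambda>i. if i < k then S ! p i else i))"
    by (rule sum.cartesian_product[symmetric])
  also have "\<dots> = (\<Sum>S\<in>set (ext_basis k n).
     det (mat k k (\<lambda>(i, j). A $$ (i, S ! j))) * det (mat k k (\<lambda>(i, j). B $$ (S ! i, j))))"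
  proof (rule sum.cong[OF refl])
    fix S assume S: "S \<in> set (ext_basis k n)"
    let ?A = "mat k k (\<lambda>(i, j). A $$ (i, S ! j))" and ?B = "mat k k (\<lambda>(i, j). B $$ (S ! i, j))"
    have "(\<Sum>p\<in>?P. ?g (\<lambda>i. if i < k then S ! p i else i)) =
      (\<Sum>p\<in>?P. signof p * (\<Prod>i = 0..<k. ?A $$ (i, p i)) * det ?B)"
    proof (rule sum.cong[OF refl])
      fix p assume "p \<in> ?P"
      hence p: "p permutes {0..<k}" by simp
      have pk: "i < k \<Longrightarrow> p i < k" for i using permutes_in_image[OF p, of i] by simp
      have m: "mat\<^sub>r k k (\<lambda>i. row B (if i < k then S ! p i else i)) = mat k k (\<lambda>(i, j). ?B $$ (p i, j))"
        by (rule eq_matI) (use B pk ext_basis_nth_less[OF S] in auto)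
      have "det (mat\<^sub>r k k (\<lambda>i. row B (if i < k then S ! p i else i))) = signof p * det ?B"
        unfolding m by (rule det_permute_rows) (use p in auto)
      moreover have "(\<Prod>i = 0..<k. A $$ (i, if i < k then S ! p i else i)) = (\<Prod>i = 0..<k. ?A $$ (i, p i))"
        by (rule prod.cong) (auto simp: pk)
      ultimately show "?g (\<lambda>i. if i < k then S ! p i else i) =
         signof p * (\<Prod>i = 0..<k. ?A $$ (i, p i)) * det ?B" by (simp add: ac_simps)
    qed
    also have "\<dots> = det ?A * det ?B"
      by (subst det_def'[of ?A k]) (auto simp: sum_distrib_right)
    finally show "(\<Sum>p\<in>?P. ?g (\<lambda>i. if i < k then S ! p i else i)) = det ?A * det ?B" .
  qed
  finally show ?thesis .
qed

section \<open>Functoriality of the matrices of minors\<close>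

lemma minors_mat_carrier:
  "A \<in> carrier_mat n n \<Longrightarrow> minors_mat k A \<in> carrier_mat (length (ext_basis k n)) (length (ext_basis k n))"
  by (simp add: minors_mat_def Let_def)

lemma minors_mat_index:
  assumes "A \<in> carrier_mat n n" "s < length (ext_basis k n)" "t < length (ext_basis k n)"
  shows "minors_mat k A $$ (s, t) =
     det (mat k k (\<lambda>(i, j). A $$ (ext_basis k n ! s ! i, ext_basis k n ! t ! j)))"
  using assms by (simp add: minors_mat_def Let_def)

text \<open>Functoriality of the exterior power: the entry at (S, T) is Cauchy-Binet for the rows S
  of A and the columns T of B.\<close>

lemma minors_mat_mult:
  assumes A: "A \<in> carrier_mat n n" and B: "B \<in> carrier_mat n n"
  shows "minors_mat k (A * B) = minors_mat k A * minors_mat k B"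
proof (rule eq_matI)
  let ?E = "ext_basis k n"
  note MA = minors_mat_carrier[OF A, of k] and MB = minors_mat_carrier[OF B, of k]
  fix s t assume "s < dim_row (minors_mat k A * minors_mat k B)" "t < dim_col (minors_mat k A * minors_mat k B)"
  hence s: "s < length ?E" and t: "t < length ?E" using MA MB by auto
  let ?S = "?E ! s" and ?T = "?E ! t"
  have S: "?S \<in> set ?E" and T: "?T \<in> set ?E" using s t by auto
  let ?A = "mat k n (\<lambda>(i, j). A $$ (?S ! i, j))" and ?B = "mat n k (\<lambda>(i, j). B $$ (i, ?T ! j))"
  have "minors_mat k (A * B) $$ (s, t) = det (mat k k (\<lambda>(i, j). (A * B) $$ (?S ! i, ?T ! j)))"
    by (rule minors_mat_index) (use A B s t in auto)
  also have "mat k k (\<lambda>(i, j). (A * B) $$ (?S ! i, ?T ! j)) = ?A * ?B"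
    by (rule eq_matI) (use A B ext_basis_nth_less[OF S] ext_basis_nth_less[OF T] in
        \<open>auto simp: scalar_prod_def intro!: sum.cong\<close>)
  also have "det (?A * ?B) = (\<Sum>R\<in>set ?E. det (mat k k (\<lambda>(i, j). ?A $$ (i, R ! j))) *
      det (mat k k (\<lambda>(i, j). ?B $$ (R ! i, j))))"
    by (rule Cauchy_Binet) auto
  also have "\<dots> = (\<Sum>R\<in>set ?E. det (mat k k (\<lambda>(i, j). A $$ (?S ! i, R ! j))) *
      det (mat k k (\<lambda>(i, j). B $$ (R ! i, ?T ! j))))"
    by (rule sum.cong[OF refl], intro arg_cong2[where f = "(*)"] arg_cong[where f = det] eq_matI)
       (auto simp: ext_basis_nth_less)
  also have "\<dots> = (\<Sum>r<length ?E. minors_mat k A $$ (s, r) * minors_mat k B $$ (r, t))"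
    unfolding sum_nth_ext_basis[symmetric]
    by (rule sum.cong) (use s t minors_mat_index[OF A] minors_mat_index[OF B] in auto)
  also have "\<dots> = (minors_mat k A * minors_mat k B) $$ (s, t)"
    using s t MA MB by (auto simp: scalar_prod_def atLeast0LessThan)
  finally show "minors_mat k (A * B) $$ (s, t) = (minors_mat k A * minors_mat k B) $$ (s, t)" .
qed (use assms in \<open>auto simp: minors_mat_def Let_def\<close>)

lemma minors_mat_one: "minors_mat k (1\<^sub>m n :: 'a::comm_ring_1 mat) = 1\<^sub>m (length (ext_basis k n))"
proof (rule eq_matI)
  let ?E = "ext_basis k n"
  fix s t assume "s < dim_row (1\<^sub>m (length ?E))" "t < dim_col (1\<^sub>m (length ?E))"
  hence s: "s < length ?E" and t: "t < length ?E" by auto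
  let ?S = "?E ! s" and ?T = "?E ! t"
  have S: "?S \<in> set ?E" and T: "?T \<in> set ?E" using s t by auto
  let ?M = "mat k k (\<lambda>(i, j). (1\<^sub>m n :: 'a mat) $$ (?S ! i, ?T ! j))"
  have M: "minors_mat k (1\<^sub>m n) $$ (s, t) = det ?M"
    by (rule minors_mat_index) (use s t in auto)
  show "minors_mat k (1\<^sub>m n :: 'a mat) $$ (s, t) = 1\<^sub>m (length ?E) $$ (s, t)"
  proof (cases "s = t")
    case True
    have "?M = 1\<^sub>m k"
      by (rule eq_matI) (use True ext_basisD[OF S] ext_basis_nth_less[OF S] in
         \<open>auto simp: nth_eq_iff_index_eq\<close>)
    hence "det ?M = 1" by simp
    thus ?thesis using M True s by simp
  next
    case False
    have "?S \<noteq> ?T" using False s t distinct_ext_basis[of k n] by (simp add: nth_eq_iff_index_eq)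
    hence "set ?S \<noteq> set ?T" using ext_basis_unique[OF S T] by blast
    moreover have "card (set ?S) = card (set ?T)" using ext_basisD[OF S] ext_basisD[OF T]
      by (simp add: distinct_card)
    ultimately have "\<not> set ?S \<subseteq> set ?T" using card_subset_eq[of "set ?T" "set ?S"] by auto
    then obtain i where i: "i < k" "?S ! i \<notin> set ?T" using ext_basisD(1)[OF S]
      by (metis in_set_conv_nth subsetI)
    \<comment> \<open>The index \<open>?S ! i\<close> occurs among no column indices, so row i
      vanishes.\<close>
    have "?M = mat\<^sub>r k k (\<lambda>j. if j = i then 0\<^sub>v k else row ?M j)"
    proof (rule eq_matI)
      fix a b assume "a < dim_row (mat\<^sub>r k k (\<lambda>j. if j = i then 0\<^sub>v k else row ?M j))"
        "b < dim_col (mat\<^sub>r k k (\<lambda>j. if j = i then 0\<^sub>v k else row ?M j))"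
      hence ab: "a < k" "b < k" by auto
      have "?T ! b \<noteq> ?S ! i" using i ab ext_basisD(1)[OF T] by (metis nth_mem)
      thus "?M $$ (a, b) = mat\<^sub>r k k (\<lambda>j. if j = i then 0\<^sub>v k else row ?M j) $$ (a, b)"
        using ab i ext_basis_nth_less[OF S] ext_basis_nth_less[OF T] by auto
    qed auto
    also have "det \<dots> = 0" by (rule det_row_0) (use i in auto)
    finally have "det ?M = 0" .
    thus ?thesis using M False s t by simp
  qed
qed (auto simp: minors_mat_def Let_def)

section \<open>Traces and eigenvalues\<close>

definition tr :: "'a::comm_monoid_add mat \<Rightarrow> 'a" where
  "tr A = (\<Sum>i<dim_row A. A $$ (i, i))"

lemma mat_trace_eq: "mat_trace A = tr A"
  by (simp add: mat_trace_def tr_def)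

lemma tr_mult_commute:
  fixes A B :: "'a::comm_semiring_0 mat"
  assumes "A \<in> carrier_mat n m" "B \<in> carrier_mat m n"
  shows "tr (A * B) = tr (B * A)"
proof -
  have "tr (A * B) = (\<Sum>i<n. \<Sum>j<m. A $$ (i, j) * B $$ (j, i))"
    using assms by (auto simp: tr_def scalar_prod_def atLeast0LessThan intro!: sum.cong)
  also have "\<dots> = (\<Sum>j<m. \<Sum>i<n. B $$ (j, i) * A $$ (i, j))"
    by (subst sum.swap) (simp add: mult.commute)
  also have "\<dots> = tr (B * A)"
    using assms by (auto simp: tr_def scalar_prod_def atLeast0LessThan intro!: sum.cong)
  finally show ?thesis .
qed

lemma tr_similar:
  fixes A :: "'a::comm_semiring_1 mat"
  assumes "similar_mat_wit A B P Q"
  shows "tr A = tr B"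
proof -
  define n where "n = dim_row A"
  note s = similar_mat_witD[OF n_def assms]
  have "tr A = tr (P * (B * Q))" using s by simp
  also have "\<dots> = tr (B * Q * P)" by (rule tr_mult_commute) (use s in auto)
  also have "B * Q * P = B * (Q * P)" by (rule assoc_mult_mat) (use s in auto)
  also have "\<dots> = B" using s by simp
  finally show ?thesis .
qed

text \<open>Transports similarity to exterior powers, so that their traces can be read off a
  triangular form.\<close>

lemma similar_mat_wit_minors_mat:
  fixes A :: "'a::comm_ring_1 mat"
  assumes "similar_mat_wit A B P Q"
  shows "similar_mat_wit (minors_mat k A) (minors_mat k B) (minors_mat k P) (minors_mat k Q)"
proof -
  define n where "n = dim_row A"
  note s = similar_mat_witD[OF n_def assms]
  note m = minors_mat_mult[of _ n, symmetric] minors_mat_one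
  show ?thesis
    by (rule similar_mat_witI[of _ _ "length (ext_basis k n)"])
       (use s in \<open>auto simp: m intro: minors_mat_carrier\<close>)
qed

lemma upper_triangular_mult:
  fixes A B :: "'a::semiring_0 mat"
  assumes "A \<in> carrier_mat n n" "B \<in> carrier_mat n n" "upper_triangular A" "upper_triangular B"
  shows "upper_triangular (A * B)" "i < n \<Longrightarrow> (A * B) $$ (i, i) = A $$ (i, i) * B $$ (i, i)"
proof -
  show "upper_triangular (A * B)"
  proof (rule upper_triangularI)
    fix j i assume ij: "j < i" "i < dim_row (A * B)"
    have "A $$ (i, k) * B $$ (k, j) = 0" if "k < n" for k
      by (cases "k < i") (use ij that assms in \<open>auto simp: upper_triangular_def\<close>)
    thus "(A * B) $$ (i, j) = 0" using ij assms by (simp add: scalar_prod_def)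
  qed
next
  assume i: "i < n"
  have "A $$ (i, k) * B $$ (k, i) = 0" if "k < n" "k \<noteq> i" for k
    by (cases "k < i") (use i that assms in \<open>auto simp: upper_triangular_def\<close>)
  hence "(\<Sum>k = 0..<n. A $$ (i, k) * B $$ (k, i)) = (\<Sum>k\<in>{i}. A $$ (i, k) * B $$ (k, i))"
    by (intro sum.mono_neutral_right) (use i in auto)
  thus "(A * B) $$ (i, i) = A $$ (i, i) * B $$ (i, i)" using i assms by (simp add: scalar_prod_def)
qed

lemma upper_triangular_pow:
  fixes A :: "'a::comm_semiring_1 mat"
  assumes A: "A \<in> carrier_mat n n" "upper_triangular A"
  shows "upper_triangular (A ^\<^sub>m k) \<and> (\<forall>i<n. (A ^\<^sub>m k) $$ (i, i) = (A $$ (i, i)) ^ k)"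
proof (induction k)
  case (Suc k)
  have "A ^\<^sub>m k \<in> carrier_mat n n" using A by simp
  with Suc upper_triangular_mult[of "A ^\<^sub>m k" n A] A show ?case by (auto simp: mult.commute)
qed (use A in auto)

text \<open>The generating series of the elementary symmetric functions of the list.\<close>

definition elem_fps :: "'a::comm_ring_1 list \<Rightarrow> 'a fps" where
  "elem_fps es = (\<Prod>e\<leftarrow>es. 1 + fps_const e * fps_X)"

lemma elem_fps_Cons: "elem_fps (e # es) = (1 + fps_const e * fps_X) * elem_fps es"
  by (simp add: elem_fps_def)

text \<open>Sublists of \<open>x # xs\<close> either omit x or start with it, which matches the two
  terms of the new linear factor.\<close>

lemma sum_list_subseqs_prod:
  "(\<Sum>S\<leftarrow>filter (\<lambda>S. length S = k) (subseqs xs). \<Prod>x\<leftarrow>S. f x) = fps_nth (elem_fps (map f xs)) k"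
proof (induction xs arbitrary: k)
  case (Cons x xs)
  have *: "fps_nth (elem_fps (map f (x # xs))) k =
     fps_nth (elem_fps (map f xs)) k + (case k of 0 \<Rightarrow> 0 | Suc k \<Rightarrow> f x * fps_nth (elem_fps (map f xs)) k)"
    by (cases k) (simp_all add: elem_fps_Cons distrib_right mult.assoc)
  show ?case
  proof (cases k)
    case 0
    have "filter (\<lambda>S. length S = 0) (map ((#) x) (subseqs xs)) = []" by (simp add: filter_empty_conv)
    with 0 * Cons[of 0] show ?thesis by (simp add: Let_def)
  next
    case (Suc l)
    have "filter (\<lambda>S. length S = Suc l) (map ((#) x) (subseqs xs)) =
      map ((#) x) (filter (\<lambda>S. length S = l) (subseqs xs))" by (simp add: filter_map o_def)
    hence "(\<Sum>S\<leftarrow>filter (\<lambda>S. length S = Suc l) (map ((#) x) (subseqs xs)). \<Prod>x\<leftarrow>S. f x) =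
       f x * (\<Sum>S\<leftarrow>filter (\<lambda>S. length S = l) (subseqs xs). \<Prod>x\<leftarrow>S. f x)"
      by (simp add: o_def sum_list_const_mult)
    with Suc * Cons show ?thesis by (simp add: Let_def)
  qed
qed (simp add: elem_fps_def)

text \<open>Since S is increasing, the principal minor on S is again triangular, so its determinant
  is the product of its diagonal entries; summing over S gives an elementary symmetric function of
  the diagonal.\<close>

lemma tr_minors_mat_triangular:
  fixes T :: "'a::comm_ring_1 mat"
  assumes T: "T \<in> carrier_mat n n" "upper_triangular T"
  shows "tr (minors_mat k T) = fps_nth (elem_fps (diag_mat T)) k"
proof -
  let ?E = "ext_basis k n"
  have "tr (minors_mat k T) = (\<Sum>s<length ?E. det (mat k k (\<lambda>(i, j). T $$ (?E ! s ! i, ?E ! s ! j))))"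
    unfolding tr_def using minors_mat_carrier[OF T(1), of k] minors_mat_index[OF T(1), of _ k] by auto
  also have "\<dots> = (\<Sum>S\<in>set ?E. det (mat k k (\<lambda>(i, j). T $$ (S ! i, S ! j))))"
    by (rule sum_nth_ext_basis)
  also have "\<dots> = (\<Sum>S\<in>set ?E. \<Prod>x\<leftarrow>S. T $$ (x, x))"
  proof (rule sum.cong[OF refl])
    fix S assume S: "S \<in> set ?E"
    let ?M = "mat k k (\<lambda>(i, j). T $$ (S ! i, S ! j))"
    have "upper_triangular ?M"
    proof (rule upper_triangularI)
      fix j i assume "j < i" "i < dim_row ?M"
      moreover hence "S ! j < S ! i" using ext_basisD[OF S] by (simp add: sorted_wrt_nth_less)
      ultimately show "?M $$ (i, j) = 0" using T ext_basis_nth_less[OF S, of i]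
        by (auto simp: upper_triangular_def)
    qed
    hence "det ?M = prod_list (diag_mat ?M)" by (rule det_upper_triangular) auto
    also have "diag_mat ?M = map (\<lambda>x. T $$ (x, x)) S"
      using ext_basisD(1)[OF S] by (intro nth_equalityI) (auto simp: diag_mat_def)
    finally show "det ?M = (\<Prod>x\<leftarrow>S. T $$ (x, x))" .
  qed
  also have "\<dots> = (\<Sum>S\<leftarrow>?E. \<Prod>x\<leftarrow>S. T $$ (x, x))"
    by (rule sum_list_distinct_conv_sum_set[symmetric, OF distinct_ext_basis])
  also have "\<dots> = fps_nth (elem_fps (map (\<lambda>x. T $$ (x, x)) [0..<n])) k"
    unfolding ext_basis_def by (rule sum_list_subseqs_prod)
  also have "map (\<lambda>x. T $$ (x, x)) [0..<n] = diag_mat T" using T by (simp add: diag_mat_def)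
  finally show ?thesis .
qed

lemma tr_triangular: "tr T = sum_list (diag_mat T)"
  by (simp add: tr_def diag_mat_def sum_list_sum_nth atLeast0LessThan)

section \<open>Traces of exterior powers in terms of eigenvalues\<close>

lemma Schur_triangularization:
  fixes A :: "complex mat"
  assumes A: "A \<in> carrier_mat n n" and es: "char_poly A = (\<Prod>e\<leftarrow>es. [:- e, 1:])"
  obtains T P Q where "similar_mat_wit A T P Q" "upper_triangular T" "diag_mat T = es" "length es = n"
proof -
  obtain T P Q where "schur_decomposition A es = (T, P, Q)" by (cases "schur_decomposition A es")
  from schur_decomposition[OF A es this] have s: "similar_mat_wit A T P Q" "upper_triangular T" "diag_mat T = es"
    by auto
  have "T \<in> carrier_mat n n" using similar_mat_witD2[OF A s(1)] by simp
  hence "length es = n" using s(3) by (auto simp: diag_mat_def)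
  with s that show thesis by blast
qed

lemma similar_mat_wit_pow_shift:
  fixes A :: "'a::comm_ring_1 mat"
  assumes "similar_mat_wit A T P Q" "A \<in> carrier_mat n n"
  shows "similar_mat_wit ((1\<^sub>m n + A) ^\<^sub>m k - 1\<^sub>m n) ((1\<^sub>m n + T) ^\<^sub>m k - 1\<^sub>m n) P Q"
proof -
  note s = similar_mat_witD2[OF assms(2,1)]
  have 1: "similar_mat_wit (1\<^sub>m n + A) (1\<^sub>m n + T) P Q"
  proof (rule similar_mat_witI[of _ _ n])
    have "P * (1\<^sub>m n + T) * Q = (P * 1\<^sub>m n + P * T) * Q"
      by (subst mult_add_distrib_mat[of _ n n _ n]) (use s in auto)
    also have "\<dots> = P * 1\<^sub>m n * Q + P * T * Q"
      by (rule add_mult_distrib_mat[of _ n n _ _ n]) (use s in auto)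
    finally show "1\<^sub>m n + A = P * (1\<^sub>m n + T) * Q" using s by simp
  qed (use s in auto)
  note 2 = similar_mat_wit_pow[OF 1, of k]
  have c: "1\<^sub>m n + A \<in> carrier_mat n n" using s by simp
  hence c': "(1\<^sub>m n + A) ^\<^sub>m k \<in> carrier_mat n n" by simp
  note s' = similar_mat_witD2[OF c' 2]
  let ?B = "(1\<^sub>m n + A) ^\<^sub>m k" and ?S = "(1\<^sub>m n + T) ^\<^sub>m k"
  show ?thesis
  proof (rule similar_mat_witI[of _ _ n])
    have "P * (?S - 1\<^sub>m n) * Q = (P * ?S - P * 1\<^sub>m n) * Q"
      by (subst mult_minus_distrib_mat[of _ n n _ n]) (use s s' in auto)
    also have "\<dots> = P * ?S * Q - P * 1\<^sub>m n * Q"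
      by (rule minus_mult_distrib_mat[of _ n n _ _ n]) (use s s' in auto)
    finally show "?B - 1\<^sub>m n = P * (?S - 1\<^sub>m n) * Q" using s s' by simp
  qed (use s s' in auto)
qed

context
  fixes A :: "complex mat" and n :: nat and es :: "complex list"
  assumes A: "A \<in> carrier_mat n n" and es: "char_poly A = (\<Prod>e\<leftarrow>es. [:- e, 1:])"
begin

lemma length_eigenvalues: "length es = n"
  using Schur_triangularization[OF A es] by metis

lemma tr_pow_eigenvalues: "tr (A ^\<^sub>m k) = (\<Sum>e\<leftarrow>es. e ^ k)"
proof -
  obtain T P Q where T: "similar_mat_wit A T P Q" "upper_triangular T" "diag_mat T = es" "length es = n"
    using Schur_triangularization[OF A es] by metis
  have c: "T \<in> carrier_mat n n" using similar_mat_witD2[OF A T(1)] by simp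
  have "tr (A ^\<^sub>m k) = tr (T ^\<^sub>m k)" by (rule tr_similar[OF similar_mat_wit_pow[OF T(1)]])
  also have "\<dots> = (\<Sum>x\<leftarrow>diag_mat T. x ^ k)"
    using upper_triangular_pow[OF c T(2), of k] c
    by (auto simp: tr_triangular diag_mat_def intro!: arg_cong[where f = sum_list])
  finally show ?thesis using T(3) by simp
qed

text \<open>In triangular form each diagonal entry e becomes \<open>(1 + e) ^ k - 1\<close>. The
  trace thus depends on the characteristic polynomial of A alone, which is what makes the exchange
  for a companion matrix legitimate.\<close>

lemma tr_minors_mat_pow_shift_eigenvalues:
  "tr (minors_mat j ((1\<^sub>m n + A) ^\<^sub>m k - 1\<^sub>m n)) = fps_nth (elem_fps (map (\<lambda>e. (1 + e) ^ k - 1) es)) j"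
proof -
  obtain T P Q where T: "similar_mat_wit A T P Q" "upper_triangular T" "diag_mat T = es" "length es = n"
    using Schur_triangularization[OF A es] by metis
  have c: "T \<in> carrier_mat n n" using similar_mat_witD2[OF A T(1)] by simp
  let ?S = "(1\<^sub>m n + T) ^\<^sub>m k - 1\<^sub>m n"
  have S: "?S \<in> carrier_mat n n" using c by auto
  have u: "upper_triangular (1\<^sub>m n + T)" using T(2) c by (auto simp: upper_triangular_def)
  have c': "1\<^sub>m n + T \<in> carrier_mat n n" using c by simp
  note p = upper_triangular_pow[OF c' u, of k]
  have u': "upper_triangular ?S" using p c by (auto simp: upper_triangular_def)
  have d: "diag_mat ?S = map (\<lambda>e. (1 + e) ^ k - 1) es"
    unfolding T(3)[symmetric] using p c by (auto simp: diag_mat_def)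
  have "tr (minors_mat j ((1\<^sub>m n + A) ^\<^sub>m k - 1\<^sub>m n)) = tr (minors_mat j ?S)"
    by (rule tr_similar[OF similar_mat_wit_minors_mat[OF similar_mat_wit_pow_shift[OF T(1) A]]])
  thus ?thesis using tr_minors_mat_triangular[OF S u'] d by simp
qed

lemma tr_minors_mat_eigenvalues: "tr (minors_mat j A) = fps_nth (elem_fps es) j"
proof -
  have "(1\<^sub>m n + A) ^\<^sub>m 1 - 1\<^sub>m n = A" using A by (auto intro!: eq_matI)
  thus ?thesis using tr_minors_mat_pow_shift_eigenvalues[of j 1] by simp
qed

lemma char_poly_minus_one: "char_poly (A - 1\<^sub>m n) = (\<Prod>e\<leftarrow>map (\<lambda>e. e - 1) es. [:- e, 1:])"
proof -
  obtain T P Q where T: "similar_mat_wit A T P Q" "upper_triangular T" "diag_mat T = es" "length es = n"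
    using Schur_triangularization[OF A es] by metis
  note s = similar_mat_witD2[OF A T(1)]
  have "similar_mat_wit (A - 1\<^sub>m n) (T - 1\<^sub>m n) P Q"
  proof (rule similar_mat_witI[of _ _ n])
    have "P * (T - 1\<^sub>m n) * Q = (P * T - P * 1\<^sub>m n) * Q"
      by (subst mult_minus_distrib_mat[of _ n n _ n]) (use s in auto)
    also have "\<dots> = P * T * Q - P * 1\<^sub>m n * Q"
      by (rule minus_mult_distrib_mat[of _ n n _ _ n]) (use s in auto)
    finally show "A - 1\<^sub>m n = P * (T - 1\<^sub>m n) * Q" using s by simp
  qed (use s in auto)
  hence "char_poly (A - 1\<^sub>m n) = char_poly (T - 1\<^sub>m n)"
    by (intro char_poly_similar) (auto simp: similar_mat_def)
  also have "\<dots> = (\<Prod>e\<leftarrow>diag_mat (T - 1\<^sub>m n). [:- e, 1:])"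
    by (rule char_poly_upper_triangular[of _ n]) (use s T(2) in \<open>auto simp: upper_triangular_def\<close>)
  also have "diag_mat (T - 1\<^sub>m n) = map (\<lambda>e. e - 1) es"
    unfolding T(3)[symmetric] using s by (auto simp: diag_mat_def)
  finally show ?thesis .
qed

end

text \<open>Vieta's formulas; they will identify the coefficients of characteristic polynomials with
  traces of exterior powers.\<close>

lemma coeff_prod_linear:
  assumes "i \<le> length es"
  shows "Polynomial.coeff (\<Prod>e\<leftarrow>es. [:- e, 1:]) i =
    (- 1) ^ (length es - i) * fps_nth (elem_fps es) (length es - i)"
  using assms
proof (induction es arbitrary: i)
  case (Cons e es)
  have *: "Polynomial.coeff ([:- e, 1:] * p) i = (case i of 0 \<Rightarrow> 0 | Suc i \<Rightarrow> Polynomial.coeff p i) - e * Polynomial.coeff p i"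
    for p :: "'a poly" by (cases i) (simp_all add: coeff_pCons)
  have z: "Polynomial.coeff (\<Prod>e\<leftarrow>es. [:- e, 1:]) j = 0" if "j > length es" for j
    using that degree_linear_factors[of uminus es] by (intro coeff_eq_0) simp
  have z': "fps_nth (elem_fps xs) j = 0" if "j > length xs" for xs :: "'a list" and j
    using that
  proof (induction xs arbitrary: j)
    case (Cons x xs)
    thus ?case by (cases j) (simp_all add: elem_fps_Cons distrib_right mult.assoc)
  qed (simp add: elem_fps_def)
  have s: "fps_nth (elem_fps (e # es)) j = fps_nth (elem_fps es) j +
      (case j of 0 \<Rightarrow> 0 | Suc j \<Rightarrow> e * fps_nth (elem_fps es) j)" for j
    by (cases j) (simp_all add: elem_fps_Cons distrib_right mult.assoc)
  show ?case
  proof (cases i)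
    case 0
    thus ?thesis unfolding list.map prod_list.Cons * using Cons.IH[of 0] by (simp add: s z')
  next
    case (Suc j)
    show ?thesis
    proof (cases "j = length es")
      case True
      thus ?thesis unfolding list.map prod_list.Cons * using Suc Cons.IH[of j] z[of i] by (simp add: s)
    next
      case False
      hence "Suc (length es - Suc j) = length es - j" using Suc Cons.prems by simp
      hence l: "length es - j = Suc (length es - Suc j)" by simp
      have "Polynomial.coeff (\<Prod>e\<leftarrow>es. [:- e, 1:]) j =
          (- 1) ^ (length es - j) * fps_nth (elem_fps es) (length es - j)"
        "Polynomial.coeff (\<Prod>e\<leftarrow>es. [:- e, 1:]) (Suc j) =
          (- 1) ^ (length es - Suc j) * fps_nth (elem_fps es) (length es - Suc j)"
        using Cons.prems Suc False Cons.IH[of j] Cons.IH[of "Suc j"] by simp_all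
      thus ?thesis unfolding list.map prod_list.Cons * using Suc l by (simp add: s algebra_simps)
    qed
  qed
qed (simp add: elem_fps_def)

section \<open>Power series determined by power sums\<close>

text \<open>Comparing coefficients of t^m expresses m + 1 times the next coefficient through the
  earlier ones; characteristic 0 allows the division.\<close>

lemma fps_ode_unique:
  fixes F G S :: "'a::field_char_0 fps"
  assumes "fps_deriv F = F * S" "fps_deriv G = G * S" "fps_nth F 0 = fps_nth G 0"
  shows "F = G"
proof (rule fps_ext)
  fix n show "fps_nth F n = fps_nth G n"
  proof (induction n rule: less_induct)
    case (less n)
    show ?case
    proof (cases n)
      case (Suc m)
      have eq: "of_nat (Suc m) * fps_nth H (Suc m) = (\<Sum>i=0..m. fps_nth H i * fps_nth S (m - i))"
        if "fps_deriv H = H * S" for H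
      proof -
        have "fps_nth (fps_deriv H) m = fps_nth (H * S) m" using that by simp
        thus ?thesis by (simp add: fps_mult_nth)
      qed
      have "of_nat (Suc m) * fps_nth F (Suc m) = of_nat (Suc m) * fps_nth G (Suc m)"
        unfolding eq[OF assms(1)] eq[OF assms(2)] by (rule sum.cong) (use less Suc in auto)
      thus ?thesis using Suc by (simp del: of_nat_Suc)
    qed (use assms in simp)
  qed
qed

text \<open>The solution of F' = F S with constant term 1; it turns sums into products.\<close>

definition exp_fps :: "'a::field_char_0 fps \<Rightarrow> 'a fps" where
  "exp_fps S = fps_compose (fps_exp 1) (fps_integral0 S)"

lemma fps_deriv_exp_fps: "fps_deriv (exp_fps S) = exp_fps S * S"
  by (simp add: exp_fps_def fps_compose_deriv fps_deriv_fps_integral)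

lemma exp_fps_nth_0 [simp]: "fps_nth (exp_fps S) 0 = 1"
  by (simp add: exp_fps_def)

lemma exp_fps_eqI: "fps_deriv F = F * S \<Longrightarrow> fps_nth F 0 = 1 \<Longrightarrow> exp_fps S = F"
  by (rule fps_ode_unique[of _ S]) (simp_all add: fps_deriv_exp_fps)

lemma exp_fps_add: "exp_fps (S + T) = exp_fps S * exp_fps T"
  by (rule exp_fps_eqI) (simp_all add: fps_deriv_exp_fps algebra_simps)

lemma exp_fps_0 [simp]: "exp_fps 0 = 1"
  by (rule exp_fps_eqI) simp_all

text \<open>If \<open>s m\<close> is the m-th power sum of a list, this is the logarithmic
  derivative of the series of its elementary symmetric functions.\<close>

definition psum_fps :: "(nat \<Rightarrow> 'a::comm_ring_1) \<Rightarrow> 'a fps" where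
  "psum_fps s = Abs_fps (\<lambda>m. (- 1) ^ m * s (Suc m))"

lemma psum_fps_add: "psum_fps (\<lambda>m. s m + t m) = psum_fps s + psum_fps t"
  by (simp add: psum_fps_def fps_eq_iff algebra_simps)

lemma psum_fps_cong: "(\<And>m. s (Suc m) = t (Suc m)) \<Longrightarrow> psum_fps s = psum_fps t"
  by (simp add: psum_fps_def)

lemma psum_fps_0 [simp]: "psum_fps (\<lambda>_. 0) = 0"
  by (simp add: psum_fps_def fps_eq_iff)

lemma elem_fps_nth_0 [simp]: "fps_nth (elem_fps es) 0 = 1"
  by (induction es) (simp_all add: elem_fps_Cons, simp add: elem_fps_def)

text \<open>Newton's identities: the logarithmic derivative of 1 + e t has the coefficients
  \<open>(- 1) ^ m * e ^ Suc m\<close>, and logarithmic derivatives of a product add up.\<close>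

lemma fps_deriv_elem_fps: "fps_deriv (elem_fps es) = elem_fps es * psum_fps (\<lambda>m. \<Sum>e\<leftarrow>es. e ^ m)"
proof (induction es)
  case (Cons e es)
  have "fps_nth ((1 + fps_const e * fps_X) * psum_fps ((^) e)) k = fps_nth (fps_const e) k" for k
    by (cases k) (simp_all add: psum_fps_def distrib_right mult.assoc)
  hence "(1 + fps_const e * fps_X) * psum_fps ((^) e) = fps_const e" by (simp add: fps_eq_iff)
  moreover have "psum_fps (\<lambda>m. \<Sum>x\<leftarrow>e # es. x ^ m) = psum_fps ((^) e) + psum_fps (\<lambda>m. \<Sum>x\<leftarrow>es. x ^ m)"
    using psum_fps_add[of "(^) e"] by simp
  moreover have "fps_deriv (elem_fps (e # es)) =
      fps_const e * elem_fps es + (1 + fps_const e * fps_X) * (elem_fps es * psum_fps (\<lambda>m. \<Sum>x\<leftarrow>es. x ^ m))"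
    by (simp add: elem_fps_Cons Cons algebra_simps)
  moreover have "L * F * (P + Q) = L * P * F + L * (F * Q)" for L F P Q :: "'a fps"
    by (simp add: algebra_simps)
  ultimately show ?case by (simp only: elem_fps_Cons)
qed (simp add: elem_fps_def)

lemma elem_fps_eq_exp_fps:
  fixes es :: "'a::field_char_0 list"
  shows "elem_fps es = exp_fps (psum_fps (\<lambda>m. \<Sum>e\<leftarrow>es. e ^ m))"
  by (rule exp_fps_eqI[symmetric]) (simp_all add: fps_deriv_elem_fps)

section \<open>Descent of identities from the complex to the rational numbers\<close>

definition complex_fps :: "rat fps \<Rightarrow> complex fps" where
  "complex_fps F = Abs_fps (\<lambda>n. of_rat (fps_nth F n))"

lemma complex_fps_nth [simp]: "fps_nth (complex_fps F) n = of_rat (fps_nth F n)"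
  by (simp add: complex_fps_def)

lemma complex_fps_inj: "complex_fps F = complex_fps G \<longleftrightarrow> F = G"
  by (simp add: fps_eq_iff)

lemma complex_fps_mult: "complex_fps (F * G) = complex_fps F * complex_fps G"
  by (simp add: fps_eq_iff fps_mult_nth of_rat_sum of_rat_mult)

lemma complex_fps_one: "complex_fps 1 = 1"
  by (simp add: fps_eq_iff)

lemma complex_fps_power: "complex_fps (F ^ n) = complex_fps F ^ n"
  by (induction n) (simp_all add: complex_fps_mult complex_fps_one)

lemma complex_fps_compose: "complex_fps (fps_compose F G) = fps_compose (complex_fps F) (complex_fps G)"
  by (simp add: fps_eq_iff fps_compose_nth of_rat_sum of_rat_mult flip: complex_fps_power)

lemma complex_fps_deriv: "complex_fps (fps_deriv F) = fps_deriv (complex_fps F)"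
  by (simp add: fps_eq_iff of_rat_mult of_rat_add)

lemma complex_fps_exp_fps: "complex_fps (exp_fps S) = exp_fps (complex_fps S)"
  by (rule exp_fps_eqI[symmetric]) (simp_all add: fps_deriv_exp_fps flip: complex_fps_deriv complex_fps_mult)

abbreviation complex_mat :: "rat mat \<Rightarrow> complex mat" where
  "complex_mat \<equiv> map_mat of_rat"

lemma complex_mat_minors_mat:
  assumes "A \<in> carrier_mat n n"
  shows "minors_mat k (complex_mat A) = complex_mat (minors_mat k A)"
proof (rule eq_matI)
  let ?E = "ext_basis k n"
  fix s t assume "s < dim_row (complex_mat (minors_mat k A))" "t < dim_col (complex_mat (minors_mat k A))"
  hence s: "s < length ?E" "?E ! s \<in> set ?E" and t: "t < length ?E" "?E ! t \<in> set ?E"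
    using minors_mat_carrier[OF assms, of k] by auto
  have m: "mat k k (\<lambda>(i, j). complex_mat A $$ (?E ! s ! i, ?E ! t ! j)) =
      complex_mat (mat k k (\<lambda>(i, j). A $$ (?E ! s ! i, ?E ! t ! j)))"
    by (rule eq_matI) (use assms ext_basis_nth_less[OF s(2)] ext_basis_nth_less[OF t(2)] in auto)
  show "minors_mat k (complex_mat A) $$ (s, t) = complex_mat (minors_mat k A) $$ (s, t)"
    using assms s t minors_mat_carrier[OF assms, of k] by (simp add: minors_mat_index[of _ n] m)
qed (use assms in \<open>auto simp: minors_mat_def Let_def\<close>)

lemma tr_complex_mat: "A \<in> carrier_mat n n \<Longrightarrow> tr (complex_mat A) = of_rat (tr A)"
  by (auto simp: tr_def of_rat_sum intro!: sum.cong)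

lemma complex_mat_pow: "A \<in> carrier_mat n n \<Longrightarrow> complex_mat (A ^\<^sub>m k) = complex_mat A ^\<^sub>m k"
  by (rule of_rat_hom.mat_hom_pow)

lemma complex_mat_shift_pow:
  assumes "A \<in> carrier_mat n n"
  shows "complex_mat ((1\<^sub>m n + A) ^\<^sub>m k - 1\<^sub>m n) = (1\<^sub>m n + complex_mat A) ^\<^sub>m k - 1\<^sub>m n"
proof -
  have c: "1\<^sub>m n + A \<in> carrier_mat n n" using assms by simp
  have c': "(1\<^sub>m n + A) ^\<^sub>m k \<in> carrier_mat n n" using c by simp
  have "complex_mat (1\<^sub>m n + A) = 1\<^sub>m n + complex_mat A"
    using assms by (auto intro!: eq_matI simp: of_rat_add)
  moreover have "complex_mat (B - 1\<^sub>m n) = complex_mat B - 1\<^sub>m n" if "B \<in> carrier_mat n n" for B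
    using that by (auto intro!: eq_matI simp: of_rat_diff)
  note this[OF c']
  ultimately show ?thesis using complex_mat_pow[OF c] by simp
qed

lemma char_poly_complex_mat:
  fixes A :: "rat mat"
  shows "A \<in> carrier_mat n n \<Longrightarrow> char_poly (complex_mat A) = map_poly of_rat (char_poly A)"
  by (rule of_rat_hom.char_poly_hom)

lemma ex_eigenvalues:
  fixes A :: "rat mat"
  assumes "A \<in> carrier_mat n n"
  obtains es where "char_poly (complex_mat A) = (\<Prod>e\<leftarrow>es. [:- e, 1:])"
  using char_poly_factorized[of "complex_mat A" n] assms by auto

text \<open>Newton's identities for the complex eigenvalues; both sides have rational coefficients
  and the embedding of series is injective. Hence the character of an exterior power at g is
  determined by the values of the character at the powers of g.\<close>

lemma tr_minors_mat_eq_exp_fps: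
  fixes A :: "rat mat"
  assumes A: "A \<in> carrier_mat n n"
  shows "Abs_fps (\<lambda>k. tr (minors_mat k A)) = exp_fps (psum_fps (\<lambda>m. tr (A ^\<^sub>m m)))"
proof -
  obtain es where es: "char_poly (complex_mat A) = (\<Prod>e\<leftarrow>es. [:- e, 1:])"
    using ex_eigenvalues[OF A] .
  have cA: "complex_mat A \<in> carrier_mat n n" using A by simp
  have "complex_fps (Abs_fps (\<lambda>k. tr (minors_mat k A))) = elem_fps es"
    using tr_minors_mat_eigenvalues[OF cA es]
    by (simp add: fps_eq_iff complex_mat_minors_mat[OF A] tr_complex_mat[OF minors_mat_carrier[OF A]])
  also have "\<dots> = exp_fps (psum_fps (\<lambda>m. of_rat (tr (A ^\<^sub>m m))))"
    unfolding elem_fps_eq_exp_fps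
    using tr_pow_eigenvalues[OF cA es] A by (simp add: tr_complex_mat[symmetric, of _ n] complex_mat_pow[symmetric])
  also have "psum_fps (\<lambda>m. of_rat (tr (A ^\<^sub>m m))) = complex_fps (psum_fps (\<lambda>m. tr (A ^\<^sub>m m)))"
    by (simp add: fps_eq_iff psum_fps_def of_rat_mult of_rat_power)
  finally show ?thesis by (simp add: complex_fps_exp_fps[symmetric] complex_fps_inj)
qed

text \<open>A and B may fail to be similar: both traces are the same symmetric function of the same
  eigenvalues. This is applied to \<open>\<rho> g - 1\<close> and the companion matrix of its
  characteristic polynomial.\<close>

lemma tr_minors_mat_pow_shift_cong:
  fixes A B :: "rat mat"
  assumes A: "A \<in> carrier_mat n n" and B: "B \<in> carrier_mat n n" and eq: "char_poly A = char_poly B"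
  shows "tr (minors_mat j ((1\<^sub>m n + A) ^\<^sub>m k - 1\<^sub>m n)) = tr (minors_mat j ((1\<^sub>m n + B) ^\<^sub>m k - 1\<^sub>m n))"
proof -
  obtain es where es: "char_poly (complex_mat A) = (\<Prod>e\<leftarrow>es. [:- e, 1:])"
    using ex_eigenvalues[OF A] .
  have es': "char_poly (complex_mat B) = (\<Prod>e\<leftarrow>es. [:- e, 1:])"
    using es eq char_poly_complex_mat[OF A] char_poly_complex_mat[OF B] by simp
  have "tr (minors_mat j ((1\<^sub>m n + complex_mat A) ^\<^sub>m k - 1\<^sub>m n)) =
      tr (minors_mat j ((1\<^sub>m n + complex_mat B) ^\<^sub>m k - 1\<^sub>m n))"
    using tr_minors_mat_pow_shift_eigenvalues[OF _ es, of n] tr_minors_mat_pow_shift_eigenvalues[OF _ es', of n]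
      A B by simp
  moreover have "(1\<^sub>m n + M) ^\<^sub>m k - 1\<^sub>m n \<in> carrier_mat n n" if "M \<in> carrier_mat n n" for M :: "rat mat"
    using that by auto
  ultimately show ?thesis using A B
    by (simp add: complex_mat_shift_pow[symmetric] complex_mat_minors_mat[of _ n]
        tr_complex_mat[OF minors_mat_carrier[of _ n]])
qed

lemma coeff_char_poly_eq_tr_minors_mat:
  fixes A :: "rat mat"
  assumes A: "A \<in> carrier_mat n n" and "i \<le> n"
  shows "Polynomial.coeff (char_poly A) i = (- 1) ^ (n - i) * tr (minors_mat (n - i) A)"
proof -
  obtain es where es: "char_poly (complex_mat A) = (\<Prod>e\<leftarrow>es. [:- e, 1:])"
    using ex_eigenvalues[OF A] .
  have cA: "complex_mat A \<in> carrier_mat n n" using A by simp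
  have "of_rat (Polynomial.coeff (char_poly A) i) = Polynomial.coeff (char_poly (complex_mat A)) i"
    by (simp add: char_poly_complex_mat[OF A])
  also have "\<dots> = (- 1) ^ (n - i) * fps_nth (elem_fps es) (n - i)"
    unfolding es using coeff_prod_linear[of i es] assms(2) length_eigenvalues[OF cA es] by simp
  also have "fps_nth (elem_fps es) (n - i) = of_rat (tr (minors_mat (n - i) A))"
    using tr_minors_mat_eigenvalues[OF cA es]
    by (simp add: complex_mat_minors_mat[OF A] tr_complex_mat[OF minors_mat_carrier[OF A]])
  also have "(- 1) ^ (n - i) * (of_rat (tr (minors_mat (n - i) A)) :: complex) =
      of_rat ((- 1) ^ (n - i) * tr (minors_mat (n - i) A))"
    by (simp add: of_rat_mult of_rat_power)
  finally show ?thesis by simp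
qed

text \<open>The substitution that turns the \<open>\<lambda>\<close>-series into the \<open>\<gamma>\<close>-series.\<close>

definition shift_fps :: "'a::field fps" where
  "shift_fps = fps_X * inverse (1 - fps_X)"

lemma shift_fps_mult: "shift_fps * (1 - fps_X) = (fps_X :: 'a::field fps)"
  by (simp add: shift_fps_def mult.assoc inverse_mult_eq_1)

lemma shift_fps_nth_0 [simp]: "fps_nth shift_fps 0 = 0"
  by (simp add: shift_fps_def)

text \<open>Multiplying by 1 - t turns the power i + 1 of t / (1 - t) into t times the power i; on
  coefficients this is Pascal's rule.\<close>

lemma shift_fps_power_nth: "fps_nth (shift_fps ^ Suc i :: 'a::field fps) (Suc m) = of_nat (m choose i)"
proof (induction m arbitrary: i)
  have rec: "fps_nth (shift_fps ^ Suc i) (Suc m) = fps_nth (shift_fps ^ Suc i) m + fps_nth (shift_fps ^ i :: 'a fps) m" for i m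
  proof -
    have "shift_fps ^ Suc i * (1 - fps_X) = shift_fps ^ i * (shift_fps * (1 - fps_X :: 'a fps))"
      by (simp add: algebra_simps)
    hence "fps_nth (shift_fps ^ Suc i * (1 - fps_X)) (Suc m) = fps_nth (shift_fps ^ i * (fps_X :: 'a fps)) (Suc m)"
      by (simp only: shift_fps_mult)
    moreover have "fps_nth (A * (1 - fps_X)) (Suc m) = fps_nth A (Suc m) - fps_nth A m" for A :: "'a fps"
      by (simp add: right_diff_distrib)
    ultimately show ?thesis by (simp del: power_Suc add: diff_eq_eq add.commute)
  qed
  have z: "fps_nth (shift_fps ^ i :: 'a fps) 0 = (if i = 0 then 1 else 0)" for i
    by (simp add: fps_nth_power_0)
  {
    case 0
    show ?case by (subst rec) (cases i; simp add: z del: power_Suc)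
  next
    case (Suc m)
    note IH = Suc
    show ?case
    proof (cases i)
      case 0
      have "fps_nth (shift_fps ^ Suc i :: 'a fps) (Suc (Suc m)) = fps_nth (shift_fps ^ Suc i :: 'a fps) (Suc m)"
        unfolding rec[of i "Suc m"] using 0 by simp
      thus ?thesis unfolding IH using 0 by simp
    next
      case (Suc j)
      have "fps_nth (shift_fps ^ Suc i :: 'a fps) (Suc (Suc m)) = of_nat (m choose i) + of_nat (m choose j)"
        unfolding rec[of i "Suc m"] IH by (simp only: Suc IH)
      thus ?thesis using Suc by simp
    qed
  }
qed

lemma one_plus_X_power_nth: "fps_nth ((1 + fps_X) ^ m :: 'a::field_char_0 fps) k = of_nat (m choose k)"
proof (induction m arbitrary: k)
  case (Suc m)
  show ?case by (cases k) (simp_all add: distrib_right Suc)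
qed (simp add: binomial_eq_0_iff)

text \<open>The reason why \<gamma>^n(x) = \<lambda>^n(x + n - 1) is the coefficient of t^n of the
  \<lambda>-series taken at t / (1 - t): adding the integer m = n - 1 multiplies the
  \<lambda>-series by (1 + t)^m, and for i > 0 both sides weight the coefficient i by the same
  binomial coefficient, \<open>m choose (i - 1)\<close> or
  \<open>m choose (Suc m - i)\<close>.\<close>

lemma fps_nth_shift_compose:
  fixes F :: "'a::field_char_0 fps"
  shows "fps_nth (fps_compose F shift_fps) (Suc m) = fps_nth (F * (1 + fps_X) ^ m) (Suc m)"
proof -
  have "fps_nth (fps_compose F shift_fps) (Suc m) = (\<Sum>i=0..Suc m. fps_nth F i * fps_nth (shift_fps ^ i) (Suc m))"
    by (simp add: fps_compose_nth)
  also have "\<dots> = (\<Sum>i=0..Suc m. fps_nth F i * fps_nth ((1 + fps_X) ^ m) (Suc m - i))"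
  proof (rule sum.cong[OF refl])
    fix i assume "i \<in> {0..Suc m}"
    thus "fps_nth F i * fps_nth (shift_fps ^ i) (Suc m) = fps_nth F i * fps_nth ((1 + fps_X) ^ m) (Suc m - i)"
    proof (cases i)
      case (Suc j)
      with \<open>i \<in> {0..Suc m}\<close> have "m choose j = m choose (m - j)" by (intro binomial_symmetric) simp
      thus ?thesis unfolding Suc shift_fps_power_nth one_plus_X_power_nth by simp
    qed (simp add: one_plus_X_power_nth binomial_eq_0)
  qed
  finally show ?thesis by (simp add: fps_mult_nth)
qed

lemma exp_fps_const: "exp_fps (psum_fps (\<lambda>_. of_nat k)) = (1 + fps_X) ^ k"
proof -
  have "elem_fps (replicate k 1) = (1 + fps_X :: 'a fps) ^ k"
    by (simp add: elem_fps_def)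
  moreover have "(\<lambda>m. \<Sum>e\<leftarrow>replicate k 1. e ^ m) = (\<lambda>_. of_nat k :: 'a)"
    by (simp add: sum_list_replicate)
  ultimately show ?thesis using elem_fps_eq_exp_fps[of "replicate k 1 :: 'a list"] by simp
qed

lemma shift_compose_one_plus_X:
  "fps_compose (1 + fps_X) shift_fps * (1 - fps_X) = (1 :: 'a::field_char_0 fps)"
  by (simp add: fps_compose_add_distrib distrib_right shift_fps_mult)

text \<open>Each factor satisfies (1 + e t / (1 - t)) (1 - t) = 1 + (e - 1) t. So the
  \<gamma>-series of V - dim V has the eigenvalues of \<open>\<rho> g - 1\<close> in place of those
  of \<open>\<rho> g\<close>.\<close>

lemma shift_compose_elem_fps:
  fixes es :: "'a::field_char_0 list"
  shows "fps_compose (elem_fps es) shift_fps * (1 - fps_X) ^ length es = elem_fps (map (\<lambda>e. e - 1) es)"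
proof (induction es)
  case (Cons e es)
  have "fps_compose (1 + fps_const e * fps_X) shift_fps * (1 - fps_X) = (1 - fps_X) + fps_const e * (shift_fps * (1 - fps_X))"
    by (simp add: fps_compose_add_distrib fps_compose_mult_distrib distrib_right mult.assoc)
  also have "\<dots> = 1 + fps_const (e - 1) * fps_X"
    unfolding shift_fps_mult by (simp add: algebra_simps flip: fps_const_sub)
  finally have 1: "fps_compose (1 + fps_const e * fps_X) shift_fps * (1 - fps_X) = 1 + fps_const (e - 1) * fps_X" .
  have "fps_compose (elem_fps (e # es)) shift_fps * (1 - fps_X) ^ length (e # es) =
    (fps_compose (1 + fps_const e * fps_X) shift_fps * (1 - fps_X)) *
    (fps_compose (elem_fps es) shift_fps * (1 - fps_X) ^ length es)"
    by (simp add: elem_fps_Cons fps_compose_mult_distrib ac_simps)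
  thus ?case by (simp only: 1 Cons) (simp add: elem_fps_Cons)
qed (simp add: elem_fps_def)

section \<open>Invariant subspaces and block triangular form\<close>

text \<open>The columns of P are a maximal independent subset S of W, followed by vectors completing
  it to a basis. By maximality S spans W, so in this basis every matrix that preserves W has a
  vanishing lower left block.\<close>

lemma subspace_adapted_basis:
  fixes W :: "rat vec set"
  assumes W: "VectorSpace.subspace class_ring W (module_vec TYPE(rat) n)"
    and nz: "W \<noteq> {0\<^sub>v n}" and nf: "W \<noteq> carrier_vec n"
  obtains m P Q where "0 < m" "m < n" "P \<in> carrier_mat n n" "Q \<in> carrier_mat n n"
    "P * Q = 1\<^sub>m n" "Q * P = 1\<^sub>m n"
    "\<And>M i j. M \<in> carrier_mat n n \<Longrightarrow> (\<And>w. w \<in> W \<Longrightarrow> M *\<^sub>v w \<in> W) \<Longrightarrow>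
       m \<le> i \<Longrightarrow> i < n \<Longrightarrow> j < m \<Longrightarrow> (Q * (M * P)) $$ (i, j) = 0"
proof -
  interpret vec_space "TYPE(rat)" n .
  have sub: "submodule class_ring W V" using W by (simp add: subspace_def)
  have WC: "W \<subseteq> carrier_vec n" using sub by (auto simp: submodule_def)
  have z: "0\<^sub>v n \<in> W" using sub by (auto simp: submodule_def)
  have bound: "finite S \<and> card S \<le> n" if "S \<subseteq> carrier_vec n" "lin_indpt S" for S
    using li_le_dim[OF fin_dim _ that(2)] that(1) dim_is_n by auto
  have e: "lin_indpt {}" by (auto simp: lin_dep_def)
  have "\<exists>S. finite S \<and> maximal S (\<lambda>S. S \<subseteq> W \<and> lin_indpt S)"
    by (rule maximal_exists[of _ n "{}"]) (use bound WC e in auto)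
  then obtain S where S: "finite S" "maximal S (\<lambda>S. S \<subseteq> W \<and> lin_indpt S)" by auto
  have SW: "S \<subseteq> W" "lin_indpt S" using S(2) by (auto simp: maximal_def)
  have SC: "S \<subseteq> carrier_vec n" using SW WC by auto
  have "\<exists>B. finite B \<and> maximal B (\<lambda>B. B \<subseteq> carrier_vec n \<and> lin_indpt B \<and> S \<subseteq> B)"
    by (rule maximal_exists[of _ n S]) (use bound SC SW in auto)
  then obtain B where B: "finite B" "maximal B (\<lambda>B. B \<subseteq> carrier_vec n \<and> lin_indpt B \<and> S \<subseteq> B)" by auto
  have BC: "B \<subseteq> carrier_vec n" "lin_indpt B" "S \<subseteq> B" using B(2) by (auto simp: maximal_def)
  have "maximal B (\<lambda>S. S \<subseteq> carrier V \<and> lin_indpt S)" using B(2) BC by (auto simp: maximal_def)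
  hence bas: "basis B" using max_li_is_basis[of B] by auto
  have cB: "card B = n" using dim_basis[OF B(1) bas] dim_is_n by simp
  have WS: "W \<subseteq> span S"
  proof
    fix w assume w: "w \<in> W"
    show "w \<in> span S"
    proof (cases "w \<in> S")
      case True
      thus ?thesis using in_own_span[of S] SC by auto
    next
      case False
      have "\<not> lin_indpt (S \<union> {w})"
        using S(2) w False SW unfolding maximal_def by blast
      thus ?thesis using lin_dep_iff_in_span[of S w] SC SW False w WC by auto
    qed
  qed
  obtain xs where xs: "set xs = S" "distinct xs" using finite_distinct_list[OF S(1)] by auto
  obtain ys where ys: "set ys = B - S" "distinct ys" using finite_distinct_list[of "B - S"] B(1) by auto
  define m where "m = length xs"
  have dist: "distinct (xs @ ys)" using xs ys by auto
  have set: "set (xs @ ys) = B" using xs ys BC by auto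
  have len: "length (xs @ ys) = n" using distinct_card[OF dist] set cB by simp
  define P where "P = mat_of_cols n (xs @ ys)"
  have P: "P \<in> carrier_mat n n" using len by (simp add: P_def mat_of_cols_def)
  have cols: "cols P = xs @ ys" unfolding P_def by (rule cols_mat_of_cols) (use set BC in auto)
  have colP: "col P j = (xs @ ys) ! j" if "j < n" for j
    using that cols P by (metis carrier_matD(2) cols_nth)
  have "det P \<noteq> 0"
  proof
    assume "det P = 0"
    then obtain v where "v \<in> carrier_vec n" "v \<noteq> 0\<^sub>v n" "P *\<^sub>v v = 0\<^sub>v n"
      using det_0_iff_vec_prod_zero_field[OF P] by auto
    hence "lin_dep (set (cols P))" using lin_depI[OF P] dist cols by simp
    thus False using BC set cols by simp
  qed
  from det_non_zero_imp_unit[OF P this, of "()"]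
  obtain Q where Q: "Q \<in> carrier_mat n n" "P * Q = 1\<^sub>m n" "Q * P = 1\<^sub>m n"
    by (auto simp: Units_def ring_mat_simps)
  show thesis
  proof
    show "P \<in> carrier_mat n n" "Q \<in> carrier_mat n n" "P * Q = 1\<^sub>m n" "Q * P = 1\<^sub>m n" by fact+
    show "0 < m"
    proof (rule ccontr)
      assume "\<not> 0 < m"
      hence "S = {}" using xs by (simp add: m_def)
      hence "W \<subseteq> {0\<^sub>v n}" using WS span_empty by simp
      thus False using nz z by auto
    qed
    show "m < n"
    proof (rule ccontr)
      assume "\<not> m < n"
      hence "length ys = 0" using len unfolding m_def length_append by linarith
      hence "ys = []" by simp
      hence "S = B" using set xs by simp
      hence "carrier_vec n = span S" using bas by (simp add: basis_def)
      also have "span S \<subseteq> W" using span_is_subset[OF SW(1) sub] .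
      finally show False using nf WC by auto
    qed
  next
    fix M i j
    assume M: "M \<in> carrier_mat n n" and inv: "\<And>w. w \<in> W \<Longrightarrow> M *\<^sub>v w \<in> W"
      and ij: "m \<le> i" "i < n" "j < m"
    have jn: "j < n" using ij by simp
    have "col P j \<in> S" using colP[OF jn] ij xs by (auto simp: m_def nth_append)
    hence "M *\<^sub>v col P j \<in> span S" using inv SW WS by auto
    then obtain a where a: "lincomb a S = M *\<^sub>v col P j"
      using finite_in_span[OF S(1), of "M *\<^sub>v col P j"] SC by auto
    \<comment> \<open>Coordinates of \<open>M *\<^sub>v col P j\<close> in the whole basis: zero on
      the vectors outside S.\<close>
    define b where "b = (\<lambda>x. if x \<in> S then a x else 0)"
    have "lincomb a S = lincomb b B"
    proof (rule eq_vecI)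
      fix k assume "k < dim_vec (lincomb b B)"
      hence k: "k < n" using lincomb_dim[OF B(1) BC(1)] by simp
      have "(\<Sum>x\<in>B. b x * x $ k) = (\<Sum>x\<in>S. b x * x $ k)"
        by (rule sum.mono_neutral_right) (use B BC b_def in auto)
      also have "\<dots> = (\<Sum>x\<in>S. a x * x $ k)" by (rule sum.cong) (auto simp: b_def)
      finally show "lincomb a S $ k = lincomb b B $ k"
        using lincomb_index[OF k SC, of a] lincomb_index[OF k BC(1), of b] by simp
    qed (use lincomb_dim[OF B(1) BC(1)] lincomb_dim[OF S(1) SC] in simp)
    also have "\<dots> = P *\<^sub>v vec n (\<lambda>i. b (col P i))"
      using mat_mult_eq_lincomb[OF P, of b] dist cols set by simp
    finally have eq: "M *\<^sub>v col P j = P *\<^sub>v vec n (\<lambda>i. b (col P i))" using a by simp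
    have "col (Q * (M * P)) j = Q *\<^sub>v (M *\<^sub>v col P j)"
    proof -
      have "col (Q * (M * P)) j = Q *\<^sub>v col (M * P) j" by (rule col_mult2) (use Q M P jn in auto)
      also have "col (M * P) j = M *\<^sub>v col P j" by (rule col_mult2) (use M P jn in auto)
      finally show ?thesis .
    qed
    also have "\<dots> = (Q * P) *\<^sub>v vec n (\<lambda>i. b (col P i))"
      unfolding eq by (rule assoc_mult_mat_vec[symmetric]) (use Q P in auto)
    also have "\<dots> = vec n (\<lambda>i. b (col P i))" using Q by simp
    finally have "col (Q * (M * P)) j = vec n (\<lambda>i. b (col P i))" .
    moreover have "(Q * (M * P)) $$ (i, j) = col (Q * (M * P)) j $ i"
      by (rule index_col[symmetric]) (use ij jn Q M P in auto)
    ultimately have "(Q * (M * P)) $$ (i, j) = b (col P i)" using ij by simp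
    moreover have "col P i \<notin> S"
    proof -
      have "col P i = ys ! (i - m)" using colP[of i] ij by (simp add: m_def nth_append)
      moreover have "ys ! (i - m) \<in> set ys" using ij len by (intro nth_mem) (simp add: m_def)
      ultimately show ?thesis using ys by simp
    qed
    ultimately show "(Q * (M * P)) $$ (i, j) = 0" by (simp add: b_def)
  qed
qed

text \<open>With vanishing lower left blocks, the mixed terms in the sums for the diagonal blocks
  drop out. The two blocks are the actions on an invariant subspace and on the quotient by
  it.\<close>

lemma block_triangular_mult:
  fixes M N :: "'a::semiring_0 mat"
  assumes M: "M \<in> carrier_mat n n" and N: "N \<in> carrier_mat n n" and mn: "m \<le> n"
    and M0: "\<And>i j. m \<le> i \<Longrightarrow> i < n \<Longrightarrow> j < m \<Longrightarrow> M $$ (i, j) = 0"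
    and N0: "\<And>i j. m \<le> i \<Longrightarrow> i < n \<Longrightarrow> j < m \<Longrightarrow> N $$ (i, j) = 0"
  shows "mat m m (($$) (M * N)) = mat m m (($$) M) * mat m m (($$) N)"
    and "mat (n - m) (n - m) (\<lambda>(i, j). (M * N) $$ (i + m, j + m)) =
      mat (n - m) (n - m) (\<lambda>(i, j). M $$ (i + m, j + m)) * mat (n - m) (n - m) (\<lambda>(i, j). N $$ (i + m, j + m))"
proof -
  have split: "sum f {0..<n} = sum f {0..<m} + (\<Sum>k = 0..<n - m. f (k + m))" for f :: "nat \<Rightarrow> 'a"
  proof -
    have "sum f {0..<n} = sum f {0..<m} + sum f {m..<n}" using mn by (simp add: sum.atLeastLessThan_concat)
    also have "sum f {m..<n} = (\<Sum>k = 0..<n - m. f (k + m))"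
      using sum.shift_bounds_nat_ivl[of f 0 m "n - m"] mn by simp
    finally show ?thesis .
  qed
  have MN: "(M * N) $$ (i, j) = (\<Sum>k = 0..<m. M $$ (i, k) * N $$ (k, j)) +
      (\<Sum>k = 0..<n - m. M $$ (i, k + m) * N $$ (k + m, j))" if "i < n" "j < n" for i j
  proof -
    have "(M * N) $$ (i, j) = (\<Sum>k = 0..<n. M $$ (i, k) * N $$ (k, j))"
      using M N that by (simp add: scalar_prod_def)
    thus ?thesis by (simp only: split)
  qed
  show "mat m m (($$) (M * N)) = mat m m (($$) M) * mat m m (($$) N)" (is "?l = ?r")
  proof (rule eq_matI)
    fix i j assume "i < dim_row ?r" "j < dim_col ?r"
    hence ij: "i < m" "j < m" by auto
    have "(\<Sum>k = 0..<n - m. M $$ (i, k + m) * N $$ (k + m, j)) = 0"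
      by (rule sum.neutral) (use N0 ij in auto)
    thus "?l $$ (i, j) = ?r $$ (i, j)" using ij mn MN[of i j] by (simp add: scalar_prod_def)
  qed auto
  show "mat (n - m) (n - m) (\<lambda>(i, j). (M * N) $$ (i + m, j + m)) =
      mat (n - m) (n - m) (\<lambda>(i, j). M $$ (i + m, j + m)) * mat (n - m) (n - m) (\<lambda>(i, j). N $$ (i + m, j + m))"
    (is "?l = ?r")
  proof (rule eq_matI)
    fix i j assume "i < dim_row ?r" "j < dim_col ?r"
    hence ij: "i < n - m" "j < n - m" by auto
    have "(\<Sum>k = 0..<m. M $$ (i + m, k) * N $$ (k, j + m)) = 0"
      by (rule sum.neutral) (use M0 ij in auto)
    thus "?l $$ (i, j) = ?r $$ (i, j)" using ij mn MN[of "i + m" "j + m"] by (simp add: scalar_prod_def)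
  qed auto
qed

lemma tr_four_block_mat:
  fixes M N :: "'a::comm_monoid_add mat"
  assumes "M \<in> carrier_mat n n" "N \<in> carrier_mat m m"
  shows "tr (four_block_mat M (0\<^sub>m n m) (0\<^sub>m m n) N) = tr M + tr N"
proof -
  have "tr (four_block_mat M (0\<^sub>m n m) (0\<^sub>m m n) N) =
      (\<Sum>i = 0..<n. M $$ (i, i)) + (\<Sum>i = n..<n + m. N $$ (i - n, i - n))"
    using assms by (simp add: tr_def flip: atLeast0LessThan sum.atLeastLessThan_concat[of 0 n "n + m"])
  also have "(\<Sum>i = n..<n + m. N $$ (i - n, i - n)) = (\<Sum>i = 0..<m. N $$ (i, i))"
    using sum.shift_bounds_nat_ivl[of "\<lambda>i. N $$ (i - n, i - n)" 0 n m] by (simp add: add.commute)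
  finally show ?thesis using assms by (simp add: tr_def atLeast0LessThan)
qed

section \<open>Rational representations and virtual characters\<close>

context group
begin

text \<open>Multiplicativity and the value at the identity already give invertibility, as
  \<open>\<rho> (inv g)\<close> inverts \<open>\<rho> g\<close>.\<close>

lemma rat_rep_iff:
  "rat_rep G n \<rho> \<longleftrightarrow> (\<forall>g\<in>carrier G. \<rho> g \<in> carrier_mat n n) \<and>
     (\<forall>g\<in>carrier G. \<forall>h\<in>carrier G. \<rho> (g \<otimes> h) = \<rho> g * \<rho> h) \<and> \<rho> \<one> = 1\<^sub>m n"
  (is "_ \<longleftrightarrow> ?R")
proof
  let ?M = "ring_mat TYPE(rat) n ()"
  have mon: "monoid ?M" using ring_mat[where 'a = rat, of n "()"] by (simp add: ring_def)
  {
    assume "rat_rep G n \<rho>"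
    hence h: "\<rho> \<in> hom G (units_of ?M)" by (simp add: rat_rep_def)
    have "\<rho> \<one> = \<one>\<^bsub>units_of ?M\<^esub>"
      by (rule hom_one[OF h is_group monoid.units_group[OF mon]])
    with h show ?R by (auto simp: hom_def units_of_def ring_mat_simps Units_def Pi_def)
  }
  {
    assume R: ?R
    have "\<rho> g \<in> Units ?M" if g: "g \<in> carrier G" for g
    proof -
      have "\<rho> g * \<rho> (inv g) = 1\<^sub>m n" "\<rho> (inv g) * \<rho> g = 1\<^sub>m n"
        using R g by (metis inv_closed r_inv, metis inv_closed l_inv)
      thus ?thesis using R g unfolding Units_def by (auto simp: ring_mat_simps)
    qed
    with R show "rat_rep G n \<rho>"
      by (auto simp: rat_rep_def hom_def units_of_def ring_mat_simps)
  }
qed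

lemma rat_repD:
  assumes "rat_rep G n \<rho>"
  shows "g \<in> carrier G \<Longrightarrow> \<rho> g \<in> carrier_mat n n"
    "g \<in> carrier G \<Longrightarrow> h \<in> carrier G \<Longrightarrow> \<rho> (g \<otimes> h) = \<rho> g * \<rho> h" "\<rho> \<one> = 1\<^sub>m n"
  using assms by (auto simp: rat_rep_iff)

lemma rat_rep_pow:
  assumes "rat_rep G n \<rho>" "g \<in> carrier G"
  shows "\<rho> (g [^] (k :: nat)) = \<rho> g ^\<^sub>m k"
  using assms
proof (induction k)
  case 0
  thus ?case using rat_repD(1,3)[OF 0(1)] by (metis carrier_matD(1) nat_pow_0 pow_mat.simps(1))
qed (simp add: rat_repD)

lemma rat_rep_ext_power:
  assumes "rat_rep G n \<rho>"
  shows "rat_rep G (length (ext_basis k n)) (ext_power k \<rho>)"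
  using assms unfolding rat_rep_iff ext_power_def ext_power_mat_eq
  by (auto simp: minors_mat_carrier minors_mat_mult[of _ n] minors_mat_one)

lemma rat_rep_one: "rat_rep G n (\<lambda>_. 1\<^sub>m n)"
  by (simp add: rat_rep_iff)

lemma rat_rep_sum:
  assumes \<rho>: "rat_rep G n \<rho>" and \<sigma>: "rat_rep G m \<sigma>"
  shows "rat_rep G (n + m) (\<lambda>g. four_block_mat (\<rho> g) (0\<^sub>m n m) (0\<^sub>m m n) (\<sigma> g))"
  unfolding rat_rep_iff
proof (intro conjI ballI)
  fix g h assume gh: "g \<in> carrier G" "h \<in> carrier G"
  note c = rat_repD(1)[OF \<rho> gh(1)] rat_repD(1)[OF \<rho> gh(2)] rat_repD(1)[OF \<sigma> gh(1)] rat_repD(1)[OF \<sigma> gh(2)]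
  have "\<rho> g * \<rho> h \<in> carrier_mat n n" "\<sigma> g * \<sigma> h \<in> carrier_mat m m" using c by auto
  thus "four_block_mat (\<rho> (g \<otimes> h)) (0\<^sub>m n m) (0\<^sub>m m n) (\<sigma> (g \<otimes> h)) =
     four_block_mat (\<rho> g) (0\<^sub>m n m) (0\<^sub>m m n) (\<sigma> g) * four_block_mat (\<rho> h) (0\<^sub>m n m) (0\<^sub>m m n) (\<sigma> h)"
    using c rat_repD(2)[OF \<rho> gh] rat_repD(2)[OF \<sigma> gh]
    by (subst mult_four_block_mat[of _ n n _ m _ m _ _ n _ m])
       (simp_all add: left_mult_zero_mat[of _ n n] left_mult_zero_mat[of _ m m]
          right_mult_zero_mat[of _ n n] right_mult_zero_mat[of _ m m])
qed (use rat_repD[OF \<rho>] rat_repD[OF \<sigma>] in auto)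

text \<open>A proper nonzero invariant subspace makes all \<open>\<rho> g\<close> block triangular
  in an adapted basis, and the trace is the sum of the traces of the subrepresentation and of the
  quotient.\<close>

lemma rat_rep_split:
  assumes \<rho>: "rat_rep G n \<rho>" and n: "0 < n" and "\<not> irreducible_rat_rep G n \<rho>"
  obtains m \<sigma> l \<tau> where "m < n" "l < n" "rat_rep G m \<sigma>" "rat_rep G l \<tau>"
    "\<And>g. g \<in> carrier G \<Longrightarrow> tr (\<rho> g) = tr (\<sigma> g) + tr (\<tau> g)"
proof -
  obtain W where W: "VectorSpace.subspace class_ring W (module_vec TYPE(rat) n)"
    "W \<noteq> {0\<^sub>v n}" "W \<noteq> carrier_vec n" and inv: "\<And>g w. g \<in> carrier G \<Longrightarrow> w \<in> W \<Longrightarrow> \<rho> g *\<^sub>v w \<in> W"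
    using assms by (auto simp: irreducible_rat_rep_def)
  obtain m P Q where m: "0 < m" "m < n" and P: "P \<in> carrier_mat n n" and Q: "Q \<in> carrier_mat n n"
    and PQ: "P * Q = 1\<^sub>m n" and QP: "Q * P = 1\<^sub>m n"
    and z: "\<And>M i j. M \<in> carrier_mat n n \<Longrightarrow> (\<And>w. w \<in> W \<Longrightarrow> M *\<^sub>v w \<in> W) \<Longrightarrow>
       m \<le> i \<Longrightarrow> i < n \<Longrightarrow> j < m \<Longrightarrow> (Q * (M * P)) $$ (i, j) = 0"
    using subspace_adapted_basis[OF W] by metis
  define B where "B = (\<lambda>g. Q * (\<rho> g * P))"
  have B: "B g \<in> carrier_mat n n" if "g \<in> carrier G" for g
    using rat_repD(1)[OF \<rho> that] P Q by (simp add: B_def)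
  have B0: "B g $$ (i, j) = 0" if "g \<in> carrier G" "m \<le> i" "i < n" "j < m" for g i j
    unfolding B_def by (rule z) (use that rat_repD(1)[OF \<rho>] inv in auto)
  have Bmult: "B (g \<otimes> h) = B g * B h" if "g \<in> carrier G" "h \<in> carrier G" for g h
  proof -
    note c = rat_repD(1)[OF \<rho> that(1)] rat_repD(1)[OF \<rho> that(2)] P Q
    have "B g * B h = Q * (\<rho> g * P * (Q * (\<rho> h * P)))"
      unfolding B_def by (rule assoc_mult_mat) (use c in auto)
    also have "\<rho> g * P * (Q * (\<rho> h * P)) = \<rho> g * (P * (Q * (\<rho> h * P)))"
      by (rule assoc_mult_mat) (use c in auto)
    also have "P * (Q * (\<rho> h * P)) = P * Q * (\<rho> h * P)"
      by (rule assoc_mult_mat[symmetric]) (use c in auto)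
    also have "\<dots> = \<rho> h * P" using c PQ by simp
    also have "\<rho> g * (\<rho> h * P) = \<rho> g * \<rho> h * P" by (rule assoc_mult_mat[symmetric]) (use c in auto)
    finally show ?thesis using rat_repD(2)[OF \<rho> that] by (simp add: B_def)
  qed
  have B1: "B \<one> = 1\<^sub>m n" using rat_repD(3)[OF \<rho>] QP P by (simp add: B_def)
  have trB: "tr (B g) = tr (\<rho> g)" if "g \<in> carrier G" for g
  proof -
    note c = rat_repD(1)[OF \<rho> that] P Q
    have "tr (B g) = tr (\<rho> g * P * Q)" unfolding B_def by (rule tr_mult_commute) (use c in auto)
    also have "\<rho> g * P * Q = \<rho> g * (P * Q)" by (rule assoc_mult_mat) (use c in auto)
    finally show ?thesis using c PQ by simp
  qed
  let ?\<sigma> = "\<lambda>g. mat m m (($$) (B g))"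
  let ?\<tau> = "\<lambda>g. mat (n - m) (n - m) (\<lambda>(i, j). B g $$ (i + m, j + m))"
  show thesis
  proof
    show "m < n" "n - m < n" using m by auto
    show "rat_rep G m ?\<sigma>" "rat_rep G (n - m) ?\<tau>"
      unfolding rat_rep_iff using m B1 block_triangular_mult[OF B B _ B0 B0, of _ _ m]
      by (auto simp: Bmult intro!: eq_matI)
    show "tr (\<rho> g) = tr (?\<sigma> g) + tr (?\<tau> g)" if g: "g \<in> carrier G" for g
    proof -
      have "(\<Sum>i = 0..<n. B g $$ (i, i)) = (\<Sum>i = 0..<m. B g $$ (i, i)) + (\<Sum>i = m..<n. B g $$ (i, i))"
        using m by (simp add: sum.atLeastLessThan_concat)
      also have "(\<Sum>i = m..<n. B g $$ (i, i)) = (\<Sum>i = 0..<n - m. B g $$ (i + m, i + m))"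
        using sum.shift_bounds_nat_ivl[of "\<lambda>i. B g $$ (i, i)" 0 m "n - m"] m by simp
      finally show ?thesis using trB[OF g] B[OF g] by (simp add: tr_def atLeast0LessThan)
    qed
  qed
qed

section \<open>Virtual characters inside the ring of rational-valued functions\<close>

lemma fun_ring_sel:
  "carrier (fun_ring G) = extensional (carrier G)"
  "x \<otimes>\<^bsub>fun_ring G\<^esub> y = (\<lambda>g\<in>carrier G. x g * y g)"
  "x \<oplus>\<^bsub>fun_ring G\<^esub> y = (\<lambda>g\<in>carrier G. x g + y g)"
  "\<one>\<^bsub>fun_ring G\<^esub> = (\<lambda>g\<in>carrier G. 1)" "\<zero>\<^bsub>fun_ring G\<^esub> = (\<lambda>g\<in>carrier G. 0)"
  by (simp_all add: fun_ring_def PiE_def)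

lemma cring_fun_ring: "cring (fun_ring G)"
proof (rule cringI)
  have eq: "x = y" if "x \<in> extensional (carrier G)" "y \<in> extensional (carrier G)" "\<And>g. g \<in> carrier G \<Longrightarrow> x g = y g"
    for x y :: "'a \<Rightarrow> rat" using that by (rule extensionalityI)
  show "abelian_group (fun_ring G)"
  proof (rule abelian_groupI)
    fix x assume x: "x \<in> carrier (fun_ring G)"
    have 1: "(\<lambda>g\<in>carrier G. - x g) \<oplus>\<^bsub>fun_ring G\<^esub> x = \<zero>\<^bsub>fun_ring G\<^esub>"
      unfolding fun_ring_sel by (rule eq) simp_all
    show "\<exists>y\<in>carrier (fun_ring G). y \<oplus>\<^bsub>fun_ring G\<^esub> x = \<zero>\<^bsub>fun_ring G\<^esub>"
      by (intro bexI[of _ "\<lambda>g\<in>carrier G. - x g"] 1) (simp add: fun_ring_sel)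
  qed (unfold fun_ring_sel; (rule eq)?; simp add: add.assoc add.commute)+
  show "comm_monoid (fun_ring G)"
    by (rule comm_monoidI; unfold fun_ring_sel; (rule eq)?; simp add: mult.assoc mult.commute)
  show "(x \<oplus>\<^bsub>fun_ring G\<^esub> y) \<otimes>\<^bsub>fun_ring G\<^esub> z =
       x \<otimes>\<^bsub>fun_ring G\<^esub> z \<oplus>\<^bsub>fun_ring G\<^esub> y \<otimes>\<^bsub>fun_ring G\<^esub> z" for x y z
    unfolding fun_ring_sel by (rule eq) (simp_all add: distrib_right)
qed

lemma fun_ring_a_inv: "x \<in> carrier (fun_ring G) \<Longrightarrow> \<ominus>\<^bsub>fun_ring G\<^esub> x = (\<lambda>g\<in>carrier G. - x g)"
proof -
  interpret F: cring "fun_ring G" by (rule cring_fun_ring)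
  assume x: "x \<in> carrier (fun_ring G)"
  have "(\<lambda>g\<in>carrier G. - x g) \<oplus>\<^bsub>fun_ring G\<^esub> x = \<zero>\<^bsub>fun_ring G\<^esub>"
    unfolding fun_ring_sel by (rule extensionalityI[of _ "carrier G"]) simp_all
  thus ?thesis by (rule F.minus_equality) (use x in \<open>simp_all add: fun_ring_sel\<close>)
qed

text \<open>Membership up to the values outside \<open>carrier G\<close>, so that characters can be
  written as plain functions in place of extensional ones.\<close>

definition vchar :: "('a \<Rightarrow> rat) \<Rightarrow> bool" where
  "vchar f \<longleftrightarrow> restrict f (carrier G) \<in> carrier (char_ring G)"

lemma vchar_cong: "(\<And>g. g \<in> carrier G \<Longrightarrow> f g = h g) \<Longrightarrow> vchar f \<longleftrightarrow> vchar h"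
  by (simp add: vchar_def cong: restrict_cong)

lemma carrier_char_ring:
  "carrier (char_ring G) = generate (add_monoid (fun_ring G)) {rep_char G \<rho> | n \<rho>. irreducible_rat_rep G n \<rho>}"
  by (simp add: char_ring_def)

lemma char_ring_sel:
  "x \<otimes>\<^bsub>char_ring G\<^esub> y = (\<lambda>g\<in>carrier G. x g * y g)"
  "x \<oplus>\<^bsub>char_ring G\<^esub> y = (\<lambda>g\<in>carrier G. x g + y g)"
  "\<one>\<^bsub>char_ring G\<^esub> = (\<lambda>g\<in>carrier G. 1)" "\<zero>\<^bsub>char_ring G\<^esub> = (\<lambda>g\<in>carrier G. 0)"
  by (simp_all add: char_ring_def fun_ring_def)

lemma rep_char_eq: "rep_char G \<rho> = (\<lambda>g\<in>carrier G. tr (\<rho> g))"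
  by (simp add: rep_char_def mat_trace_eq)

lemma char_ring_subgroup: "subgroup (carrier (char_ring G)) (add_monoid (fun_ring G))"
proof -
  interpret F: cring "fun_ring G" by (rule cring_fun_ring)
  have "{rep_char G \<rho> | n \<rho>. irreducible_rat_rep G n \<rho>} \<subseteq> carrier (add_monoid (fun_ring G))"
    by (auto simp: rep_char_eq fun_ring_sel)
  thus ?thesis unfolding carrier_char_ring by (rule group.generate_is_subgroup[OF F.a_group])
qed

lemma carrier_char_ring_extensional: "x \<in> carrier (char_ring G) \<Longrightarrow> x \<in> extensional (carrier G)"
  using subgroup.subset[OF char_ring_subgroup] unfolding partial_object.simps monoid.simps fun_ring_sel by blast

lemma vchar_carrier: "x \<in> carrier (char_ring G) \<Longrightarrow> vchar x"
  by (simp add: vchar_def carrier_char_ring_extensional extensional_restrict)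

lemma vchar_zero: "vchar (\<lambda>_. 0)"
  using subgroup.one_closed[OF char_ring_subgroup] by (simp add: vchar_def fun_ring_sel)

lemma vchar_add:
  assumes "vchar f" "vchar h"
  shows "vchar (\<lambda>g. f g + h g)"
proof -
  have "restrict f (carrier G) \<oplus>\<^bsub>fun_ring G\<^esub> restrict h (carrier G) = (\<lambda>g\<in>carrier G. f g + h g)"
    by (auto simp: fun_ring_sel fun_eq_iff)
  thus ?thesis using subgroup.m_closed[OF char_ring_subgroup assms[unfolded vchar_def]] by (simp add: vchar_def)
qed

lemma vchar_uminus:
  assumes "vchar f"
  shows "vchar (\<lambda>g. - f g)"
proof -
  have "\<ominus>\<^bsub>fun_ring G\<^esub> (restrict f (carrier G)) = (\<lambda>g\<in>carrier G. - f g)"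
    by (subst fun_ring_a_inv) (auto simp: fun_ring_sel fun_eq_iff)
  thus ?thesis using subgroup.m_inv_closed[OF char_ring_subgroup assms[unfolded vchar_def]]
    by (simp add: vchar_def a_inv_def)
qed

lemma vchar_diff: "vchar f \<Longrightarrow> vchar h \<Longrightarrow> vchar (\<lambda>g. f g - h g)"
  using vchar_add[OF _ vchar_uminus, of f h] by simp

lemma vchar_sum: "(\<And>i. i \<in> A \<Longrightarrow> vchar (f i)) \<Longrightarrow> vchar (\<lambda>g. \<Sum>i\<in>A. f i g)"
  by (induction A rule: infinite_finite_induct) (auto intro: vchar_zero vchar_add)

text \<open>The generators are the irreducible characters only; an arbitrary one is reached by
  splitting, with induction on the degree.\<close>

lemma vchar_rat_rep: "rat_rep G n \<rho> \<Longrightarrow> vchar (\<lambda>g. tr (\<rho> g))"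
proof (induction n arbitrary: \<rho> rule: less_induct)
  case (less n)
  consider "n = 0" | "irreducible_rat_rep G n \<rho>" | "0 < n" "\<not> irreducible_rat_rep G n \<rho>" by blast
  thus ?case
  proof cases
    case 1
    hence "tr (\<rho> g) = 0" if "g \<in> carrier G" for g
      using rat_repD(1)[OF less.prems that] by (simp add: tr_def)
    thus ?thesis using vchar_zero vchar_cong[of "\<lambda>g. tr (\<rho> g)" "\<lambda>_. 0"] by simp
  next
    case 2
    hence "rep_char G \<rho> \<in> carrier (char_ring G)"
      unfolding carrier_char_ring by (intro generate.incl) auto
    thus ?thesis by (simp add: vchar_def rep_char_eq)
  next
    case 3
    obtain m \<sigma> l \<tau> where *: "m < n" "l < n" "rat_rep G m \<sigma>" "rat_rep G l \<tau>"
      "\<And>g. g \<in> carrier G \<Longrightarrow> tr (\<rho> g) = tr (\<sigma> g) + tr (\<tau> g)"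
      using rat_rep_split[OF less.prems 3] by metis
    have "vchar (\<lambda>g. tr (\<sigma> g) + tr (\<tau> g))"
      by (rule vchar_add[OF less.IH[OF *(1,3)] less.IH[OF *(2,4)]])
    thus ?thesis using vchar_cong[of "\<lambda>g. tr (\<rho> g)" "\<lambda>g. tr (\<sigma> g) + tr (\<tau> g)"] *(5) by simp
  qed
qed

lemma vchar_of_nat: "vchar (\<lambda>_. of_nat n)"
  using vchar_rat_rep[OF rat_rep_one[of n]] by (simp add: tr_def)

lemma vchar_of_int: "vchar (\<lambda>_. of_int k)"
proof (cases "k \<ge> 0")
  case True
  thus ?thesis using vchar_of_nat[of "nat k"] by simp
next
  case False
  thus ?thesis using vchar_uminus[OF vchar_of_nat[of "nat (- k)"]] by simp
qed

text \<open>Direct sums collect all generators with positive sign into one representation and those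
  with negative sign into another.\<close>

lemma vchar_iff_diff:
  "vchar f \<longleftrightarrow> (\<exists>n \<rho> m \<sigma>. rat_rep G n \<rho> \<and> rat_rep G m \<sigma> \<and> (\<forall>g\<in>carrier G. f g = tr (\<rho> g) - tr (\<sigma> g)))"
proof
  assume "\<exists>n \<rho> m \<sigma>. rat_rep G n \<rho> \<and> rat_rep G m \<sigma> \<and> (\<forall>g\<in>carrier G. f g = tr (\<rho> g) - tr (\<sigma> g))"
  then obtain n \<rho> m \<sigma> where *: "rat_rep G n \<rho>" "rat_rep G m \<sigma>" "\<forall>g\<in>carrier G. f g = tr (\<rho> g) - tr (\<sigma> g)"
    by blast
  have "vchar (\<lambda>g. tr (\<rho> g) - tr (\<sigma> g))" by (intro vchar_diff vchar_rat_rep[OF *(1)] vchar_rat_rep[OF *(2)])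
  thus "vchar f" using *(3) vchar_cong[of f "\<lambda>g. tr (\<rho> g) - tr (\<sigma> g)"] by simp
next
  assume "vchar f"
  hence *: "restrict f (carrier G) \<in> generate (add_monoid (fun_ring G)) {rep_char G \<rho> | n \<rho>. irreducible_rat_rep G n \<rho>}"
    by (simp add: vchar_def carrier_char_ring)
  define D where "D = (\<lambda>f. \<exists>n \<rho> m \<sigma>. rat_rep G n \<rho> \<and> rat_rep G m \<sigma> \<and> (\<forall>g\<in>carrier G. f g = tr (\<rho> g) - tr (\<sigma> g)))"
  have DI: "D f" if "rat_rep G n \<rho>" "rat_rep G m \<sigma>" "\<And>g. g \<in> carrier G \<Longrightarrow> f g = tr (\<rho> g) - tr (\<sigma> g)" for f n \<rho> m \<sigma>
    unfolding D_def using that by blast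
  \<comment> \<open>The representation of degree 0 has character 0 and fills the side that is
    missing for a single generator.\<close>
  have one: "tr (1\<^sub>m 0 :: rat mat) = 0" by (simp add: tr_def)
  from * have "D (restrict f (carrier G))"
  proof (induction rule: generate.induct)
    case one
    show ?case by (rule DI[OF rat_rep_one[of 0] rat_rep_one[of 0]]) (simp add: fun_ring_sel)
  next
    case (incl h)
    then obtain n \<rho> where h: "irreducible_rat_rep G n \<rho>" "h = rep_char G \<rho>" by blast
    hence "rat_rep G n \<rho>" by (simp add: irreducible_rat_rep_def)
    from DI[OF this rat_rep_one[of 0]] show ?case using h by (simp add: rep_char_eq one)
  next
    case (inv h)
    then obtain n \<rho> where h: "irreducible_rat_rep G n \<rho>" "h = rep_char G \<rho>" by blast
    hence r: "rat_rep G n \<rho>" by (simp add: irreducible_rat_rep_def)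
    have "inv\<^bsub>add_monoid (fun_ring G)\<^esub> h = (\<lambda>g\<in>carrier G. - h g)"
      using fun_ring_a_inv[of h] h(2) by (simp add: a_inv_def fun_ring_sel rep_char_eq)
    thus ?case using DI[OF rat_rep_one[of 0] r] h by (simp add: rep_char_eq one)
  next
    case (eng x y)
    obtain n \<rho> m \<sigma> where 1: "rat_rep G n \<rho>" "rat_rep G m \<sigma>" "\<forall>g\<in>carrier G. x g = tr (\<rho> g) - tr (\<sigma> g)"
      using eng unfolding D_def by blast
    obtain n' \<rho>' m' \<sigma>' where 2: "rat_rep G n' \<rho>'" "rat_rep G m' \<sigma>'" "\<forall>g\<in>carrier G. y g = tr (\<rho>' g) - tr (\<sigma>' g)"
      using eng unfolding D_def by blast
    show ?case
      by (rule DI[OF rat_rep_sum[OF 1(1) 2(1)] rat_rep_sum[OF 1(2) 2(2)]])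
         (simp add: fun_ring_sel 1(3) 2(3) tr_four_block_mat[OF rat_repD(1)[OF 1(1)] rat_repD(1)[OF 2(1)]]
           tr_four_block_mat[OF rat_repD(1)[OF 1(2)] rat_repD(1)[OF 2(2)]])
  qed
  then obtain n \<rho> m \<sigma> where **: "rat_rep G n \<rho>" "rat_rep G m \<sigma>"
    "\<forall>g\<in>carrier G. restrict f (carrier G) g = tr (\<rho> g) - tr (\<sigma> g)" unfolding D_def by blast
  have "D f" by (rule DI[OF **(1,2)]) (use **(3) in auto)
  thus "\<exists>n \<rho> m \<sigma>. rat_rep G n \<rho> \<and> rat_rep G m \<sigma> \<and> (\<forall>g\<in>carrier G. f g = tr (\<rho> g) - tr (\<sigma> g))"
    unfolding D_def .
qed

end

text \<open>The coefficients of 1 / F are integer polynomials in those of F. Properties closed under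
  sums, products and signs thereby pass from the series of y to that of - y.\<close>

lemma fps_inverse_nth_Suc:
  assumes "F * H = 1" "fps_nth F 0 = (1 :: 'a::comm_ring_1)"
  shows "fps_nth H (Suc n) = - (\<Sum>i = 0..n. fps_nth F (Suc i) * fps_nth H (n - i))"
proof -
  have "0 = fps_nth (F * H) (Suc n)" using assms by simp
  also have "\<dots> = fps_nth H (Suc n) + (\<Sum>i = Suc 0..Suc n. fps_nth F i * fps_nth H (Suc n - i))"
    unfolding fps_mult_nth by (subst sum.atLeast_Suc_atMost) (use assms in simp_all)
  also have "(\<Sum>i = Suc 0..Suc n. fps_nth F i * fps_nth H (Suc n - i)) =
      (\<Sum>i = 0..n. fps_nth F (Suc i) * fps_nth H (n - i))"
    by (subst sum.shift_bounds_cl_Suc_ivl) simp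
  finally show ?thesis by (simp add: eq_neg_iff_add_eq_0)
qed

section \<open>The lambda operations\<close>

context group
begin

text \<open>The series \<lambda>_t(x)(g), expressed through the Adams operations x(g^m). It makes
  sense for every function x; the exponential law holds by construction, and what remains to be
  shown is that its coefficients are virtual characters when x is one.\<close>

definition lam_ps :: "('a \<Rightarrow> rat) \<Rightarrow> 'a \<Rightarrow> rat fps" where
  "lam_ps x g = exp_fps (psum_fps (\<lambda>m. x (g [^] m)))"

lemma lam_ps_cong:
  "(\<And>h. h \<in> carrier G \<Longrightarrow> x h = y h) \<Longrightarrow> g \<in> carrier G \<Longrightarrow> lam_ps x g = lam_ps y g"
  unfolding lam_ps_def by (intro arg_cong[where f = exp_fps] psum_fps_cong) simp

lemma lam_ps_add: "lam_ps (\<lambda>g. x g + y g) g = lam_ps x g * lam_ps y g"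
  by (simp add: lam_ps_def psum_fps_add exp_fps_add)

lemma lam_ps_0 [simp]: "lam_ps (\<lambda>_. 0) g = 1"
  by (simp add: lam_ps_def)

lemma lam_ps_nth_0 [simp]: "fps_nth (lam_ps x g) 0 = 1"
  by (simp add: lam_ps_def)

lemma lam_ps_uminus: "lam_ps x g * lam_ps (\<lambda>g. - x g) g = 1"
  using lam_ps_add[of x "\<lambda>g. - x g" g] by simp

lemma lam_ps_nth_1:
  assumes "g \<in> carrier G"
  shows "fps_nth (lam_ps x g) 1 = x g"
proof -
  have "fps_nth (fps_deriv (lam_ps x g)) 0 = fps_nth (lam_ps x g * psum_fps (\<lambda>m. x (g [^] m))) 0"
    by (simp add: lam_ps_def fps_deriv_exp_fps)
  thus ?thesis using assms by (simp add: psum_fps_def)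
qed

lemma lam_ps_rat_rep:
  assumes "rat_rep G n \<rho>" "g \<in> carrier G"
  shows "fps_nth (lam_ps (\<lambda>g. tr (\<rho> g)) g) k = tr (minors_mat k (\<rho> g))"
  using tr_minors_mat_eq_exp_fps[OF rat_repD(1)[OF assms]]
  by (simp add: lam_ps_def rat_rep_pow[OF assms] fps_eq_iff)

lemma vchar_lam_ps_rat_rep:
  assumes "rat_rep G n \<rho>"
  shows "vchar (\<lambda>g. fps_nth (lam_ps (\<lambda>g. tr (\<rho> g)) g) k)"
proof -
  have "vchar (\<lambda>g. tr (ext_power k \<rho> g))" by (rule vchar_rat_rep[OF rat_rep_ext_power[OF assms]])
  thus ?thesis
    by (subst vchar_cong[of _ "\<lambda>g. tr (ext_power k \<rho> g)"])
       (simp_all add: lam_ps_rat_rep[OF assms] ext_power_def ext_power_mat_eq)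
qed

text \<open>Closure under products does not need Kronecker products of matrices:
  \<open>\<Lambda>\<^sup>2(V \<oplus> W) = \<Lambda>\<^sup>2 V \<oplus> V \<otimes> W \<oplus> \<Lambda>\<^sup>2 W\<close>.\<close>

lemma vchar_mult_rat_rep:
  assumes \<rho>: "rat_rep G n \<rho>" and \<sigma>: "rat_rep G m \<sigma>"
  shows "vchar (\<lambda>g. tr (\<rho> g) * tr (\<sigma> g))"
proof -
  let ?x = "\<lambda>g. tr (\<rho> g)" and ?y = "\<lambda>g. tr (\<sigma> g)"
  let ?\<tau> = "\<lambda>g. four_block_mat (\<rho> g) (0\<^sub>m n m) (0\<^sub>m m n) (\<sigma> g)"
  have "?x g * ?y g = fps_nth (lam_ps (\<lambda>g. tr (?\<tau> g)) g) 2 - fps_nth (lam_ps ?x g) 2 - fps_nth (lam_ps ?y g) 2"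
    if g: "g \<in> carrier G" for g
  proof -
    have "lam_ps (\<lambda>g. tr (?\<tau> g)) g = lam_ps (\<lambda>g. ?x g + ?y g) g"
      by (rule lam_ps_cong) (use g tr_four_block_mat[OF rat_repD(1)[OF \<rho>] rat_repD(1)[OF \<sigma>]] in auto)
    moreover have "fps_nth (F * H) 2 = fps_nth F 2 * fps_nth H 0 + fps_nth F 1 * fps_nth H 1 + fps_nth F 0 * fps_nth H 2"
      for F H :: "rat fps"
      by (simp add: fps_mult_nth numeral_2_eq_2)
    ultimately show ?thesis using lam_ps_nth_1[OF g] by (simp add: lam_ps_add)
  qed
  moreover have "vchar (\<lambda>g. fps_nth (lam_ps (\<lambda>g. tr (?\<tau> g)) g) 2 - fps_nth (lam_ps ?x g) 2 - fps_nth (lam_ps ?y g) 2)"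
    by (intro vchar_diff vchar_lam_ps_rat_rep[OF \<rho>] vchar_lam_ps_rat_rep[OF \<sigma>]
          vchar_lam_ps_rat_rep[OF rat_rep_sum[OF \<rho> \<sigma>]])
  ultimately show ?thesis
    by (subst vchar_cong[of _ "\<lambda>g. fps_nth (lam_ps (\<lambda>g. tr (?\<tau> g)) g) 2 - fps_nth (lam_ps ?x g) 2 - fps_nth (lam_ps ?y g) 2"])
qed

lemma vcharE:
  assumes "vchar f"
  obtains n \<rho> m \<sigma> where "rat_rep G n \<rho>" "rat_rep G m \<sigma>"
    "\<forall>g\<in>carrier G. f g = tr (\<rho> g) - tr (\<sigma> g)"
  using assms[unfolded vchar_iff_diff] by metis

lemma vchar_mult:
  assumes "vchar f" "vchar h"
  shows "vchar (\<lambda>g. f g * h g)"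
proof -
  obtain n \<rho> m \<sigma> where 1: "rat_rep G n \<rho>" "rat_rep G m \<sigma>"
    "\<forall>g\<in>carrier G. f g = tr (\<rho> g) - tr (\<sigma> g)" by (rule vcharE[OF assms(1)])
  obtain n' \<rho>' m' \<sigma>' where 2: "rat_rep G n' \<rho>'" "rat_rep G m' \<sigma>'"
    "\<forall>g\<in>carrier G. h g = tr (\<rho>' g) - tr (\<sigma>' g)" by (rule vcharE[OF assms(2)])
  let ?p = "\<lambda>g. tr (\<rho> g) * tr (\<rho>' g) - tr (\<rho> g) * tr (\<sigma>' g) - (tr (\<sigma> g) * tr (\<rho>' g) - tr (\<sigma> g) * tr (\<sigma>' g))"
  have "vchar ?p"
    by (intro vchar_diff vchar_mult_rat_rep[OF 1(1) 2(1)] vchar_mult_rat_rep[OF 1(1) 2(2)]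
          vchar_mult_rat_rep[OF 1(2) 2(1)] vchar_mult_rat_rep[OF 1(2) 2(2)])
  thus ?thesis by (subst vchar_cong[of _ ?p]) (simp_all add: 1(3) 2(3) algebra_simps)
qed

text \<open>\<lambda>_t(- y) is the inverse of \<lambda>_t(y), and the recursion for its
  coefficients uses sums, products and signs only.\<close>

lemma vchar_lam_ps_uminus:
  assumes "\<And>k. vchar (\<lambda>g. fps_nth (lam_ps y g) k)"
  shows "vchar (\<lambda>g. fps_nth (lam_ps (\<lambda>g. - y g) g) n)"
proof (induction n rule: less_induct)
  case (less n)
  show ?case
  proof (cases n)
    case 0
    thus ?thesis using vchar_of_nat[of 1] by simp
  next
    case (Suc k)
    show ?thesis unfolding Suc fps_inverse_nth_Suc[OF lam_ps_uminus lam_ps_nth_0]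
      by (intro vchar_uminus vchar_sum vchar_mult assms less) (use Suc in auto)
  qed
qed

lemma vchar_lam_ps:
  assumes "vchar x"
  shows "vchar (\<lambda>g. fps_nth (lam_ps x g) k)"
proof -
  obtain n \<rho> m \<sigma> where 1: "rat_rep G n \<rho>" "rat_rep G m \<sigma>"
    "\<forall>g\<in>carrier G. x g = tr (\<rho> g) - tr (\<sigma> g)" by (rule vcharE[OF assms])
  have "lam_ps x g = lam_ps (\<lambda>g. tr (\<rho> g)) g * lam_ps (\<lambda>g. - tr (\<sigma> g)) g" if "g \<in> carrier G" for g
    unfolding lam_ps_add[symmetric] by (rule lam_ps_cong) (use 1 that in auto)
  hence "fps_nth (lam_ps x g) k =
      (\<Sum>i = 0..k. fps_nth (lam_ps (\<lambda>g. tr (\<rho> g)) g) i * fps_nth (lam_ps (\<lambda>g. - tr (\<sigma> g)) g) (k - i))"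
    if "g \<in> carrier G" for g using that by (simp add: fps_mult_nth)
  moreover have "vchar (\<lambda>g. \<Sum>i = 0..k. fps_nth (lam_ps (\<lambda>g. tr (\<rho> g)) g) i * fps_nth (lam_ps (\<lambda>g. - tr (\<sigma> g)) g) (k - i))"
    by (intro vchar_sum vchar_mult vchar_lam_ps_uminus vchar_lam_ps_rat_rep[OF 1(1)] vchar_lam_ps_rat_rep[OF 1(2)])
  ultimately show ?thesis
    by (subst vchar_cong[where h = "\<lambda>g. \<Sum>i = 0..k. fps_nth (lam_ps (\<lambda>g. tr (\<rho> g)) g) i *
        fps_nth (lam_ps (\<lambda>g. - tr (\<sigma> g)) g) (k - i)"])
qed

lemma restrict_in_char_ring: "vchar f \<Longrightarrow> restrict f (carrier G) \<in> carrier (char_ring G)"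
  by (simp add: vchar_def)

lemma cring_char_ring: "cring (char_ring G)"
proof -
  interpret F: cring "fun_ring G" by (rule cring_fun_ring)
  let ?H = "carrier (char_ring G)"
  have sub: "?H \<subseteq> carrier (fun_ring G)" using subgroup.subset[OF char_ring_subgroup] by simp
  have "subcring ?H (fun_ring G)"
  proof (rule F.subcringI'[OF F.subringI])
    show "?H \<subseteq> carrier (fun_ring G)" by fact
    show "\<one>\<^bsub>fun_ring G\<^esub> \<in> ?H" using restrict_in_char_ring[OF vchar_of_nat[of 1]] by (simp add: fun_ring_sel)
    show "\<ominus>\<^bsub>fun_ring G\<^esub> h \<in> ?H" if "h \<in> ?H" for h
      using restrict_in_char_ring[OF vchar_uminus[OF vchar_carrier[OF that]]] sub that
      by (subst fun_ring_a_inv) auto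
    show "h1 \<otimes>\<^bsub>fun_ring G\<^esub> h2 \<in> ?H" if "h1 \<in> ?H" "h2 \<in> ?H" for h1 h2
      using restrict_in_char_ring[OF vchar_mult[OF vchar_carrier[OF that(1)] vchar_carrier[OF that(2)]]]
      by (simp add: fun_ring_sel)
    show "h1 \<oplus>\<^bsub>fun_ring G\<^esub> h2 \<in> ?H" if "h1 \<in> ?H" "h2 \<in> ?H" for h1 h2
      using restrict_in_char_ring[OF vchar_add[OF vchar_carrier[OF that(1)] vchar_carrier[OF that(2)]]]
      by (simp add: fun_ring_sel)
  qed
  hence "cring ((fun_ring G)\<lparr>carrier := ?H\<rparr>)" using F.subcring_iff[OF sub] by simp
  moreover have "(fun_ring G)\<lparr>carrier := ?H\<rparr> = char_ring G" by (simp add: char_ring_def)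
  ultimately show ?thesis by simp
qed

lemma finsum_char_ring:
  assumes "finite A" "\<And>i. i \<in> A \<Longrightarrow> f i \<in> carrier (char_ring G)"
  shows "finsum (char_ring G) f A = (\<lambda>g\<in>carrier G. \<Sum>i\<in>A. f i g)"
proof -
  interpret R: cring "char_ring G" by (rule cring_char_ring)
  show ?thesis using assms
  proof (induction A)
    case (insert a A)
    have "finsum (char_ring G) f (insert a A) = f a \<oplus>\<^bsub>char_ring G\<^esub> finsum (char_ring G) f A"
      by (rule R.finsum_insert) (use insert in auto)
    also have "\<dots> = (\<lambda>g\<in>carrier G. \<Sum>i\<in>insert a A. f i g)"
      using insert by (auto simp: char_ring_sel fun_eq_iff restrict_def)
    finally show ?case .
  qed (simp add: char_ring_sel)
qed

text \<open>Existence, which gives the choice in \<open>lambda_op\<close> its meaning.\<close>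

lemma is_lambda_operations_lam_ps:
  "is_lambda_operations G (\<lambda>n x. \<lambda>g\<in>carrier G. fps_nth (lam_ps x g) n)"
  unfolding is_lambda_operations_def
proof (intro conjI allI impI ballI)
  fix n show "(\<lambda>x. \<lambda>g\<in>carrier G. fps_nth (lam_ps x g) n) \<in> carrier (char_ring G) \<rightarrow> carrier (char_ring G)"
    using restrict_in_char_ring[OF vchar_lam_ps[OF vchar_carrier]] by auto
next
  fix d \<rho> n assume r: "rat_rep G d \<rho>"
  have "lam_ps (rep_char G \<rho>) g = lam_ps (\<lambda>g. tr (\<rho> g)) g" if "g \<in> carrier G" for g
    by (rule lam_ps_cong) (use that in \<open>auto simp: rep_char_eq\<close>)
  thus "(\<lambda>g\<in>carrier G. fps_nth (lam_ps (rep_char G \<rho>) g) n) = rep_char G (ext_power n \<rho>)"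
    unfolding rep_char_eq[of "ext_power n \<rho>"]
    by (intro restrict_ext) (simp add: lam_ps_rat_rep[OF r] ext_power_def ext_power_mat_eq)
next
  fix x assume "x \<in> carrier (char_ring G)"
  show "(\<lambda>g\<in>carrier G. fps_nth (lam_ps x g) 0) = \<one>\<^bsub>char_ring G\<^esub>"
    by (simp add: char_ring_sel)
next
  fix n x y assume x: "x \<in> carrier (char_ring G)" and y: "y \<in> carrier (char_ring G)"
  have "(\<lambda>g\<in>carrier G. fps_nth (lam_ps (x \<oplus>\<^bsub>char_ring G\<^esub> y) g) n) =
    (\<lambda>g\<in>carrier G. \<Sum>i\<le>n. fps_nth (lam_ps x g) i * fps_nth (lam_ps y g) (n - i))"
  proof (rule restrict_ext)
    fix g assume g: "g \<in> carrier G"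
    have "lam_ps (x \<oplus>\<^bsub>char_ring G\<^esub> y) g = lam_ps x g * lam_ps y g"
      unfolding lam_ps_add[symmetric] by (rule lam_ps_cong) (use g in \<open>auto simp: char_ring_sel\<close>)
    thus "fps_nth (lam_ps (x \<oplus>\<^bsub>char_ring G\<^esub> y) g) n = (\<Sum>i\<le>n. fps_nth (lam_ps x g) i * fps_nth (lam_ps y g) (n - i))"
      by (simp add: fps_mult_nth atLeast0AtMost)
  qed
  also have "\<dots> = (\<Oplus>\<^bsub>char_ring G\<^esub> i\<in>{..n}. (\<lambda>g\<in>carrier G. fps_nth (lam_ps x g) i) \<otimes>\<^bsub>char_ring G\<^esub>
      (\<lambda>g\<in>carrier G. fps_nth (lam_ps y g) (n - i)))"
    using restrict_in_char_ring[OF vchar_mult[OF vchar_lam_ps[OF vchar_carrier[OF x]] vchar_lam_ps[OF vchar_carrier[OF y]]]]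
    by (subst finsum_char_ring) (auto simp: char_ring_sel cong: restrict_cong)
  finally show "(\<lambda>g\<in>carrier G. fps_nth (lam_ps (x \<oplus>\<^bsub>char_ring G\<^esub> y) g) n) =
     (\<Oplus>\<^bsub>char_ring G\<^esub> i\<in>{..n}. (\<lambda>g\<in>carrier G. fps_nth (lam_ps x g) i) \<otimes>\<^bsub>char_ring G\<^esub>
      (\<lambda>g\<in>carrier G. fps_nth (lam_ps y g) (n - i)))" .
qed

text \<open>With x = \<rho> - \<sigma>, the addition formula for x + \<sigma> = \<rho> and the
  prescribed values on representations determine the series of x times that of \<sigma>; the latter
  has constant term 1 and can be cancelled.\<close>

lemma lambda_operations_unique:
  assumes L: "is_lambda_operations G L" and x: "x \<in> carrier (char_ring G)" and g: "g \<in> carrier G"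
  shows "L n x g = fps_nth (lam_ps x g) n"
proof -
  obtain d \<rho> e \<sigma> where 1: "rat_rep G d \<rho>" "rat_rep G e \<sigma>"
    "\<forall>g\<in>carrier G. x g = tr (\<rho> g) - tr (\<sigma> g)" by (rule vcharE[OF vchar_carrier[OF x]])
  have L1: "L n (rep_char G \<tau>) g = fps_nth (lam_ps (\<lambda>g. tr (\<tau> g)) g) n" if "rat_rep G d \<tau>" for d \<tau> n
  proof -
    have "L n (rep_char G \<tau>) = rep_char G (ext_power n \<tau>)" using L that unfolding is_lambda_operations_def by blast
    thus ?thesis using g lam_ps_rat_rep[OF that g] by (simp add: rep_char_eq ext_power_def ext_power_mat_eq)
  qed
  have s: "rep_char G \<sigma> \<in> carrier (char_ring G)"
    using restrict_in_char_ring[OF vchar_rat_rep[OF 1(2)]] by (simp add: rep_char_eq)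
  have xs: "x \<oplus>\<^bsub>char_ring G\<^esub> rep_char G \<sigma> = rep_char G \<rho>"
    using 1(3) by (auto simp: char_ring_sel rep_char_eq fun_eq_iff)
  have LC: "L i y \<in> carrier (char_ring G)" if "y \<in> carrier (char_ring G)" for i y
    using L that unfolding is_lambda_operations_def by blast
  interpret R: cring "char_ring G" by (rule cring_char_ring)
  have "Abs_fps (\<lambda>n. L n x g) * lam_ps (\<lambda>g. tr (\<sigma> g)) g = lam_ps (\<lambda>g. tr (\<rho> g)) g"
  proof (rule fps_ext)
    fix n
    have "L n (x \<oplus>\<^bsub>char_ring G\<^esub> rep_char G \<sigma>) =
        (\<Oplus>\<^bsub>char_ring G\<^esub> i\<in>{..n}. L i x \<otimes>\<^bsub>char_ring G\<^esub> L (n - i) (rep_char G \<sigma>))"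
      using L x s unfolding is_lambda_operations_def by blast
    hence "L n (rep_char G \<rho>) = (\<lambda>g\<in>carrier G. \<Sum>i\<le>n. (L i x \<otimes>\<^bsub>char_ring G\<^esub> L (n - i) (rep_char G \<sigma>)) g)"
      unfolding xs by (subst (asm) finsum_char_ring) (auto simp: LC x s)
    hence "L n (rep_char G \<rho>) g = (\<Sum>i\<le>n. L i x g * L (n - i) (rep_char G \<sigma>) g)"
      using g by (simp add: char_ring_sel)
    thus "fps_nth (Abs_fps (\<lambda>n. L n x g) * lam_ps (\<lambda>g. tr (\<sigma> g)) g) n = fps_nth (lam_ps (\<lambda>g. tr (\<rho> g)) g) n"
      by (simp add: L1[OF 1(1)] L1[OF 1(2)] fps_mult_nth atLeast0AtMost)
  qed
  also have "\<dots> = lam_ps x g * lam_ps (\<lambda>g. tr (\<sigma> g)) g"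
    unfolding lam_ps_add[symmetric] by (rule lam_ps_cong) (use 1(3) g in auto)
  finally have "Abs_fps (\<lambda>n. L n x g) * lam_ps (\<lambda>g. tr (\<sigma> g)) g = lam_ps x g * lam_ps (\<lambda>g. tr (\<sigma> g)) g" .
  moreover have "lam_ps (\<lambda>g. tr (\<sigma> g)) g \<noteq> 0"
    by (metis fps_zero_nth lam_ps_nth_0 zero_neq_one)
  ultimately have "Abs_fps (\<lambda>n. L n x g) = lam_ps x g" by simp
  thus ?thesis by (metis fps_nth_Abs_fps)
qed

lemma is_lambda_operations_lambda_op: "is_lambda_operations G (lambda_op G)"
  unfolding lambda_op_def by (rule someI[of _ "\<lambda>n x. \<lambda>g\<in>carrier G. fps_nth (lam_ps x g) n"]) (rule is_lambda_operations_lam_ps)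

lemma lambda_op_eq:
  assumes "x \<in> carrier (char_ring G)"
  shows "lambda_op G n x = (\<lambda>g\<in>carrier G. fps_nth (lam_ps x g) n)"
proof
  fix g
  have "lambda_op G n x \<in> carrier (char_ring G)"
    using is_lambda_operations_lambda_op assms unfolding is_lambda_operations_def by blast
  hence "lambda_op G n x \<in> extensional (carrier G)" by (rule carrier_char_ring_extensional)
  thus "lambda_op G n x g = (\<lambda>g\<in>carrier G. fps_nth (lam_ps x g) n) g"
    using lambda_operations_unique[OF is_lambda_operations_lambda_op assms, of g n]
    by (cases "g \<in> carrier G") (auto simp: extensional_def)
qed

section \<open>The gamma operations\<close>

text \<open>The classical \<gamma>_t(x) = \<lambda>_s(x) with s = t / (1 - t).\<close>

definition gam_ps :: "('a \<Rightarrow> rat) \<Rightarrow> 'a \<Rightarrow> rat fps" where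
  "gam_ps x g = fps_compose (lam_ps x g) shift_fps"

lemma gam_ps_cong:
  "(\<And>h. h \<in> carrier G \<Longrightarrow> x h = y h) \<Longrightarrow> g \<in> carrier G \<Longrightarrow> gam_ps x g = gam_ps y g"
  using lam_ps_cong[of x y g] by (simp add: gam_ps_def)

lemma gam_ps_add: "gam_ps (\<lambda>g. x g + y g) g = gam_ps x g * gam_ps y g"
  by (simp add: gam_ps_def lam_ps_add fps_compose_mult_distrib)

lemma gam_ps_0 [simp]: "gam_ps (\<lambda>_. 0) g = 1"
  by (simp add: gam_ps_def)

lemma gam_ps_nth_0 [simp]: "fps_nth (gam_ps x g) 0 = 1"
  by (simp add: gam_ps_def)

lemma gam_ps_uminus: "gam_ps x g * gam_ps (\<lambda>g. - x g) g = 1"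
  using gam_ps_add[of x "\<lambda>g. - x g" g] by simp

lemma gamma_op_eq:
  assumes "x \<in> carrier (char_ring G)"
  shows "gamma_op G n x = (\<lambda>g\<in>carrier G. fps_nth (gam_ps x g) n)"
proof -
  let ?y = "x \<oplus>\<^bsub>char_ring G\<^esub> (\<lambda>g\<in>carrier G. rat_of_nat n - 1)"
  have "(\<lambda>g\<in>carrier G. x g + (rat_of_nat n - 1)) \<in> carrier (char_ring G)"
    using vchar_add[OF vchar_carrier[OF assms] vchar_of_int[of "int n - 1"]] by (simp add: vchar_def)
  moreover have y: "?y = (\<lambda>g\<in>carrier G. x g + (rat_of_nat n - 1))"
    by (auto simp: char_ring_sel)
  ultimately have "gamma_op G n x = (\<lambda>g\<in>carrier G. fps_nth (lam_ps ?y g) n)"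
    unfolding gamma_op_def using lambda_op_eq by simp
  also have "\<dots> = (\<lambda>g\<in>carrier G. fps_nth (gam_ps x g) n)"
  proof (rule restrict_ext)
    fix g assume g: "g \<in> carrier G"
    show "fps_nth (lam_ps ?y g) n = fps_nth (gam_ps x g) n"
    proof (cases n)
      \<comment> \<open>Here n - 1 is the degree m of a trivial representation, whose
        \<lambda>-series is (1 + t)^m. For n = 0 the shift is by - 1, but both constant terms are
        1.\<close>
      case (Suc m)
      have "lam_ps ?y g = lam_ps x g * lam_ps (\<lambda>_. of_nat m) g"
        unfolding lam_ps_add[symmetric] by (rule lam_ps_cong) (use g Suc in \<open>auto simp: char_ring_sel\<close>)
      also have "lam_ps (\<lambda>_. of_nat m) g = (1 + fps_X) ^ m"
        by (simp add: lam_ps_def exp_fps_const)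
      finally have "lam_ps ?y g = lam_ps x g * (1 + fps_X) ^ m" .
      thus ?thesis unfolding Suc gam_ps_def fps_nth_shift_compose by (simp only:)
    qed simp
  qed
  finally show ?thesis .
qed

lemma vchar_gam_ps:
  assumes "vchar x"
  shows "vchar (\<lambda>g. fps_nth (gam_ps x g) n)"
proof (cases n)
  case 0
  thus ?thesis using vchar_of_nat[of 1] by simp
next
  case (Suc m)
  have "fps_nth (gam_ps x g) n = (\<Sum>i=0..n. fps_nth (lam_ps x g) i * of_nat (m choose (n - i)))" for g
    unfolding Suc gam_ps_def fps_nth_shift_compose fps_mult_nth one_plus_X_power_nth ..
  thus ?thesis by (simp, intro vchar_sum vchar_mult vchar_lam_ps assms vchar_of_nat)
qed

text \<open>The eigenvalues of \<open>\<rho> g - 1\<close> are e - 1 for the eigenvalues e of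
  \<open>\<rho> g\<close>; subtracting d multiplies the \<gamma>-series by (1 - t)^d, which effects
  exactly this shift.\<close>

lemma gam_ps_rat_rep:
  assumes \<rho>: "rat_rep G d \<rho>" and g: "g \<in> carrier G"
  shows "fps_nth (gam_ps (\<lambda>g. tr (\<rho> g) - of_nat d) g) n = tr (minors_mat n (\<rho> g - 1\<^sub>m d))"
proof -
  note A = rat_repD(1)[OF \<rho> g]
  obtain es where es: "char_poly (complex_mat (\<rho> g)) = (\<Prod>e\<leftarrow>es. [:- e, 1:])" using ex_eigenvalues[OF A] .
  have cA: "complex_mat (\<rho> g) \<in> carrier_mat d d" using A by simp
  note len = length_eigenvalues[OF cA es]
  let ?F = "complex_fps (gam_ps (\<lambda>g. tr (\<rho> g) - of_nat d) g)"
  have *: "complex_fps (lam_ps (\<lambda>g. tr (\<rho> g)) g) = elem_fps es"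
    using tr_minors_mat_eigenvalues[OF cA es] lam_ps_rat_rep[OF \<rho> g]
    by (simp add: fps_eq_iff complex_mat_minors_mat[OF A] tr_complex_mat[OF minors_mat_carrier[OF A]])
  have sh: "complex_fps shift_fps = shift_fps"
  proof -
    have "complex_fps shift_fps * complex_fps (1 - fps_X) = complex_fps fps_X"
      by (simp only: complex_fps_mult[symmetric] shift_fps_mult)
    moreover have "complex_fps (1 - fps_X) = 1 - fps_X" "complex_fps fps_X = fps_X"
      by (simp_all add: fps_eq_iff of_rat_diff)
    ultimately have "complex_fps shift_fps * (1 - fps_X) = shift_fps * (1 - fps_X)" by (simp add: shift_fps_mult)
    moreover have "1 - fps_X \<noteq> (0 :: complex fps)"
    proof
      assume "1 - fps_X = (0 :: complex fps)"
      hence "fps_nth (1 - fps_X :: complex fps) 0 = 0" by simp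
      thus False by simp
    qed
    ultimately show ?thesis by simp
  qed
  have "gam_ps (\<lambda>g. tr (\<rho> g)) g = gam_ps (\<lambda>g. tr (\<rho> g) - of_nat d) g * gam_ps (\<lambda>_. of_nat d) g"
    unfolding gam_ps_add[symmetric] by simp
  moreover have "gam_ps (\<lambda>_. of_nat d) g * (1 - fps_X) ^ d = 1"
  proof -
    have "gam_ps (\<lambda>_. of_nat d) g = fps_compose (1 + fps_X) shift_fps ^ d"
      by (simp add: gam_ps_def lam_ps_def exp_fps_const fps_compose_power)
    thus ?thesis by (simp only: power_mult_distrib[symmetric] shift_compose_one_plus_X power_one)
  qed
  ultimately have "gam_ps (\<lambda>g. tr (\<rho> g) - of_nat d) g = gam_ps (\<lambda>g. tr (\<rho> g)) g * (1 - fps_X) ^ d"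
    by (simp add: mult.assoc)
  hence "?F = complex_fps (gam_ps (\<lambda>g. tr (\<rho> g)) g) * complex_fps (1 - fps_X) ^ d"
    by (simp add: complex_fps_mult complex_fps_power)
  also have "complex_fps (1 - fps_X) = 1 - fps_X" by (simp add: fps_eq_iff of_rat_diff)
  also have "complex_fps (gam_ps (\<lambda>g. tr (\<rho> g)) g) = fps_compose (elem_fps es) shift_fps"
    by (simp add: gam_ps_def complex_fps_compose * sh)
  finally have "?F = elem_fps (map (\<lambda>e. e - 1) es)" using shift_compose_elem_fps[of es] len by simp
  hence "of_rat (fps_nth (gam_ps (\<lambda>g. tr (\<rho> g) - of_nat d) g) n) = fps_nth (elem_fps (map (\<lambda>e. e - 1) es)) n"
    by (metis complex_fps_nth)
  also have "\<dots> = tr (minors_mat n (complex_mat (\<rho> g) - 1\<^sub>m d))"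
    by (rule tr_minors_mat_eigenvalues[OF _ char_poly_minus_one[OF cA es], symmetric, of d]) (use cA in auto)
  also have "complex_mat (\<rho> g) - 1\<^sub>m d = complex_mat (\<rho> g - 1\<^sub>m d)"
    using A by (auto intro!: eq_matI simp: of_rat_diff)
  also have "tr (minors_mat n (complex_mat (\<rho> g - 1\<^sub>m d))) = of_rat (tr (minors_mat n (\<rho> g - 1\<^sub>m d)))"
  proof -
    have c: "\<rho> g - 1\<^sub>m d \<in> carrier_mat d d" using A by auto
    show ?thesis by (simp add: complex_mat_minors_mat[OF c] tr_complex_mat[OF minors_mat_carrier[OF c]])
  qed
  finally show ?thesis by simp
qed

text \<open>Powers of g commute, so the invariance of x passes to all the values x(g^m) that make up
  the series.\<close>

lemma gam_ps_pow:
  assumes "\<And>g. g \<in> carrier G \<Longrightarrow> x (g [^] (k::nat)) = x g" "g \<in> carrier G"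
  shows "gam_ps x (g [^] k) = gam_ps x g"
proof -
  have "x ((g [^] k) [^] m) = x (g [^] m)" for m :: nat
  proof -
    have "(g [^] k) [^] m = (g [^] m) [^] k" unfolding nat_pow_pow[OF assms(2)] by (simp add: mult.commute)
    thus ?thesis using assms by simp
  qed
  thus ?thesis by (simp add: gam_ps_def lam_ps_def)
qed

lemma gam_ps_one_eq_1: "x \<one> = 0 \<Longrightarrow> gam_ps x \<one> = 1"
  by (simp add: gam_ps_def lam_ps_def)

end

section \<open>Companion matrices\<close>

text \<open>Laplace expansion along the first row, where only the first and the last entry can be
  nonzero. The minor of the first is of the same shape with shifted coefficients, which is why c is
  arbitrary in the induction; that of the last is triangular with diagonal - 1.\<close>

lemma det_companion:
  fixes x :: "'a::comm_ring_1"
  shows "det (mat d d (\<lambda>(i, j). (if i = j then x else 0) + (if Suc j = d then c i else if i = Suc j then - 1 else 0)))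
    = x ^ d + (\<Sum>i<d. c i * x ^ i)"
proof (induction d arbitrary: c)
  case 0
  show ?case by (simp add: det_dim_zero)
next
  case (Suc d)
  let ?M = "\<lambda>d c. mat d d (\<lambda>(i, j). (if i = j then x else 0) + (if Suc j = d then c i else if i = Suc j then - 1 else 0 :: 'a))"
  show ?case
  proof (cases "d = 0")
    case True
    have "det (?M 1 c) = ?M 1 c $$ (0, 0)" by (rule det_single) simp
    thus ?thesis using True by simp
  next
    case False
    let ?A = "?M (Suc d) c"
    have A: "?A \<in> carrier_mat (Suc d) (Suc d)" by simp
    have "det ?A = (\<Sum>j<Suc d. ?A $$ (0, j) * cofactor ?A 0 j)"
      by (rule laplace_expansion_row[OF A]) simp
    also have "\<dots> = (\<Sum>j\<in>{0, d}. ?A $$ (0, j) * cofactor ?A 0 j)"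
      by (rule sum.mono_neutral_right) auto
    also have "\<dots> = x * cofactor ?A 0 0 + c 0 * cofactor ?A 0 d"
      using False by simp
    also have "mat_delete ?A 0 0 = ?M d (\<lambda>i. c (Suc i))"
      using False by (intro eq_matI) (auto simp: mat_delete_def)
    hence "cofactor ?A 0 0 = x ^ d + (\<Sum>i<d. c (Suc i) * x ^ i)"
      using Suc[of "\<lambda>i. c (Suc i)"] by (simp add: cofactor_def)
    also have "cofactor ?A 0 d = 1"
    proof -
      let ?T = "mat_delete ?A 0 d"
      have T: "?T \<in> carrier_mat d d" by (simp add: mat_delete_def)
      have u: "upper_triangular ?T"
        by (rule upper_triangularI) (auto simp: mat_delete_def)
      have "diag_mat ?T = replicate d (- 1)"
        by (rule nth_equalityI) (auto simp: diag_mat_def mat_delete_def)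
      hence "det ?T = (- 1) ^ d"
        using det_upper_triangular[OF u T] by simp
      thus ?thesis by (simp add: cofactor_def flip: power_add mult_2)
    qed
    moreover have "(\<Sum>i<Suc d. c i * x ^ i) = c 0 + (\<Sum>i<d. c (Suc i) * (x * x ^ i))"
      by (subst sum.lessThan_Suc_shift) simp
    ultimately show ?thesis by (simp add: distrib_left sum_distrib_left ac_simps del: sum.lessThan_Suc)
  qed
qed

text \<open>With the coefficients in the last column, the weight j - i + 1 of the entry (i, d - 1)
  is d - i, the index of the \<gamma>-operation that will appear there; the ones below the diagonal
  get weight 0.\<close>

definition companion_mat :: "'a::comm_ring_1 poly \<Rightarrow> 'a mat" where
  "companion_mat p = (let d = Polynomial.degree p in
     mat d d (\<lambda>(i, j). if Suc j = d then - Polynomial.coeff p i else if i = Suc j then 1 else 0))"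

lemma companion_mat_carrier: "companion_mat p \<in> carrier_mat (Polynomial.degree p) (Polynomial.degree p)"
  by (simp add: companion_mat_def Let_def)

lemma char_poly_companion_mat:
  fixes p :: "'a::comm_ring_1 poly"
  assumes "monic p"
  shows "char_poly (companion_mat p) = p"
proof -
  let ?d = "Polynomial.degree p" and ?x = "[:0, 1:] :: 'a poly"
  have m1: "[:- 1:] = (- 1 :: 'a poly)" by (metis minus_pCons pCons_one minus_zero)
  have "char_poly_matrix (companion_mat p) =
     mat ?d ?d (\<lambda>(i, j). (if i = j then ?x else 0) +
        (if Suc j = ?d then [:Polynomial.coeff p i:] else if i = Suc j then - 1 else 0))"
    by (rule eq_matI) (auto simp: char_poly_matrix_def companion_mat_def Let_def m1)
  hence "char_poly (companion_mat p) = ?x ^ ?d + (\<Sum>i<?d. [:Polynomial.coeff p i:] * ?x ^ i)"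
    using det_companion[of ?d ?x "\<lambda>i. [:Polynomial.coeff p i:]"] by (simp add: char_poly_def)
  also have "\<dots> = (\<Sum>i<?d. Polynomial.monom (Polynomial.coeff p i) i) + Polynomial.monom (Polynomial.coeff p ?d) ?d"
    unfolding assms by (subst add.commute) (simp add: monom_altdef)
  also have "\<dots> = (\<Sum>i\<le>?d. Polynomial.monom (Polynomial.coeff p i) i)"
    by (rule sum.lessThan_Suc[symmetric, unfolded lessThan_Suc_atMost])
  also have "\<dots> = p" by (rule poly_as_sum_of_monoms)
  finally show ?thesis .
qed

text \<open>Leibniz expansion of all principal minors; in each term the rows and the columns run
  through the same set S, which will make the weights of the entries cancel.\<close>

lemma tr_minors_mat_sum:
  fixes M :: "'a::comm_ring_1 mat"
  assumes "M \<in> carrier_mat d d"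
  shows "tr (minors_mat n M) = (\<Sum>S\<in>set (ext_basis n d). \<Sum>p\<in>{p. p permutes {0..<n}}.
     signof p * (\<Prod>i\<in>{0..<n}. M $$ (S ! i, S ! p i)))"
proof -
  let ?E = "ext_basis n d"
  have "tr (minors_mat n M) = (\<Sum>s<length ?E. det (mat n n (\<lambda>(i, j). M $$ (?E ! s ! i, ?E ! s ! j))))"
    unfolding tr_def using minors_mat_carrier[OF assms, of n] minors_mat_index[OF assms, of _ n] by auto
  also have "\<dots> = (\<Sum>S\<in>set ?E. det (mat n n (\<lambda>(i, j). M $$ (S ! i, S ! j))))"
    by (rule sum_nth_ext_basis)
  also have "\<dots> = (\<Sum>S\<in>set ?E. \<Sum>p\<in>{p. p permutes {0..<n}}. signof p * (\<Prod>i\<in>{0..<n}. M $$ (S ! i, S ! p i)))"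
  proof (rule sum.cong[OF refl])
    fix S
    have "p permutes {0..<n} \<Longrightarrow> i < n \<Longrightarrow> p i < n" for p i using permutes_in_image[of p "{0..<n}" i] by auto
    thus "det (mat n n (\<lambda>(i, j). M $$ (S ! i, S ! j))) =
      (\<Sum>p\<in>{p. p permutes {0..<n}}. signof p * (\<Prod>i\<in>{0..<n}. M $$ (S ! i, S ! p i)))"
      by (subst det_def'[of _ n]) (auto intro!: sum.cong arg_cong2[where f = "(*)"] prod.cong)
  qed
  finally show ?thesis .
qed

section \<open>The gamma filtration\<close>

context group
begin

text \<open>Membership in \<Gamma>^n up to the values outside \<open>carrier G\<close>, like
  \<open>vchar\<close>.\<close>

definition Gam :: "nat \<Rightarrow> ('a \<Rightarrow> rat) \<Rightarrow> bool" where
  "Gam n f \<longleftrightarrow> restrict f (carrier G) \<in> gamma_filtration G n"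

lemma Gam_cong: "(\<And>g. g \<in> carrier G \<Longrightarrow> f g = h g) \<Longrightarrow> Gam n f \<longleftrightarrow> Gam n h"
  by (simp add: Gam_def cong: restrict_cong)

lemma Gam_restrict [simp]: "Gam n (restrict f (carrier G)) \<longleftrightarrow> Gam n f"
  by (rule Gam_cong) simp

lemma vchar_restrict [simp]: "vchar (restrict f (carrier G)) \<longleftrightarrow> vchar f"
  by (rule vchar_cong) simp

lemma Gam_subst: "Gam n h \<Longrightarrow> (\<And>g. g \<in> carrier G \<Longrightarrow> f g = h g) \<Longrightarrow> Gam n f"
  using Gam_cong by blast

lemma augmentation_ideal_iff: "x \<in> augmentation_ideal G \<longleftrightarrow> x \<in> carrier (char_ring G) \<and> x \<one> = 0"
  by (simp add: augmentation_ideal_def augmentation_def)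

lemma char_ring_a_inv:
  assumes "x \<in> carrier (char_ring G)"
  shows "\<ominus>\<^bsub>char_ring G\<^esub> x = (\<lambda>g\<in>carrier G. - x g)"
proof -
  interpret R: cring "char_ring G" by (rule cring_char_ring)
  have c: "(\<lambda>g\<in>carrier G. - x g) \<in> carrier (char_ring G)"
    using vchar_uminus[OF vchar_carrier[OF assms]] by (simp add: vchar_def)
  have "(\<lambda>g\<in>carrier G. - x g) \<oplus>\<^bsub>char_ring G\<^esub> x = \<zero>\<^bsub>char_ring G\<^esub>"
    by (auto simp: char_ring_sel fun_eq_iff)
  thus ?thesis by (rule R.minus_equality) (use c assms in simp_all)
qed

lemma gamma_product_Nil: "gamma_product G [] = (\<lambda>g\<in>carrier G. 1)"
  by (simp add: gamma_product_def char_ring_sel)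

lemma gamma_product_Cons:
  assumes "x \<in> augmentation_ideal G"
  shows "gamma_product G ((i, x) # ps) = (\<lambda>g\<in>carrier G. fps_nth (gam_ps x g) i * gamma_product G ps g)"
  using assms by (auto simp: gamma_product_def char_ring_sel gamma_op_eq augmentation_ideal_iff)

lemma vchar_gamma_product:
  "snd ` set ps \<subseteq> augmentation_ideal G \<Longrightarrow> vchar (gamma_product G ps)"
proof (induction ps)
  case Nil
  show ?case unfolding gamma_product_Nil vchar_restrict using vchar_of_nat[of 1] by simp
next
  case (Cons p ps)
  obtain i x where p: "p = (i, x)" by (cases p)
  hence x: "x \<in> augmentation_ideal G" using Cons.prems by auto
  have "vchar (\<lambda>g. fps_nth (gam_ps x g) i * gamma_product G ps g)"
    by (rule vchar_mult[OF vchar_gam_ps[OF vchar_carrier] Cons.IH]) (use Cons.prems x in \<open>auto simp: augmentation_ideal_iff\<close>)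
  thus ?case unfolding p gamma_product_Cons[OF x] vchar_restrict .
qed

lemma gamma_product_extensional: "gamma_product G ps \<in> extensional (carrier G)"
  by (cases ps) (auto simp: gamma_product_def char_ring_sel)

lemma gamma_product_carrier:
  "snd ` set ps \<subseteq> augmentation_ideal G \<Longrightarrow> gamma_product G ps \<in> carrier (char_ring G)"
  using vchar_gamma_product[of ps] gamma_product_extensional[of ps] by (simp add: vchar_def extensional_restrict)

lemma gamma_product_append:
  assumes "snd ` set ps \<subseteq> augmentation_ideal G"
  shows "g \<in> carrier G \<Longrightarrow> gamma_product G (ps @ qs) g = gamma_product G ps g * gamma_product G qs g"
  using assms
proof (induction ps)
  case (Cons p ps)
  obtain i x where p: "p = (i, x)" by (cases p)
  hence x: "x \<in> augmentation_ideal G" using Cons.prems by auto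
  show ?case using Cons by (simp add: p gamma_product_Cons[OF x])
qed (simp add: gamma_product_Nil)

lemma gamma_filtration_subgroup: "subgroup (gamma_filtration G n) (add_monoid (char_ring G))"
proof -
  interpret R: cring "char_ring G" by (rule cring_char_ring)
  show ?thesis unfolding gamma_filtration_def
    by (rule group.generate_is_subgroup[OF R.a_group]) (use gamma_product_carrier in auto)
qed

lemma gamma_filtration_carrier: "x \<in> gamma_filtration G n \<Longrightarrow> x \<in> carrier (char_ring G)"
  using subgroup.subset[OF gamma_filtration_subgroup] by auto

lemma gamma_filtration_Gam: "x \<in> gamma_filtration G n \<Longrightarrow> Gam n x"
  using gamma_filtration_carrier[of x n] carrier_char_ring_extensional[of x]
  by (simp add: Gam_def extensional_restrict)

lemma gamma_filtration_iff: "x \<in> gamma_filtration G n \<longleftrightarrow> x \<in> extensional (carrier G) \<and> Gam n x"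
  using gamma_filtration_Gam carrier_char_ring_extensional gamma_filtration_carrier
  by (auto simp: Gam_def extensional_restrict)

lemma Gam_vchar: "Gam n f \<Longrightarrow> vchar f"
  unfolding Gam_def vchar_def by (rule gamma_filtration_carrier)

lemma Gam_zero: "Gam n (\<lambda>_. 0)"
  using subgroup.one_closed[OF gamma_filtration_subgroup] by (simp add: Gam_def char_ring_sel)

lemma Gam_add:
  assumes "Gam n f" "Gam n h"
  shows "Gam n (\<lambda>g. f g + h g)"
proof -
  have "restrict f (carrier G) \<oplus>\<^bsub>char_ring G\<^esub> restrict h (carrier G) = (\<lambda>g\<in>carrier G. f g + h g)"
    by (auto simp: char_ring_sel fun_eq_iff)
  thus ?thesis using subgroup.m_closed[OF gamma_filtration_subgroup assms[unfolded Gam_def]] by (simp add: Gam_def)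
qed

lemma Gam_uminus:
  assumes "Gam n f"
  shows "Gam n (\<lambda>g. - f g)"
proof -
  have "\<ominus>\<^bsub>char_ring G\<^esub> (restrict f (carrier G)) = (\<lambda>g\<in>carrier G. - f g)"
    using Gam_vchar[OF assms] by (subst char_ring_a_inv) (auto simp: vchar_def fun_eq_iff)
  thus ?thesis using subgroup.m_inv_closed[OF gamma_filtration_subgroup assms[unfolded Gam_def]]
    by (simp add: Gam_def a_inv_def)
qed

lemma Gam_diff: "Gam n f \<Longrightarrow> Gam n h \<Longrightarrow> Gam n (\<lambda>g. f g - h g)"
  using Gam_add[OF _ Gam_uminus, of n f h] by simp

lemma Gam_sum: "(\<And>i. i \<in> A \<Longrightarrow> Gam n (f i)) \<Longrightarrow> Gam n (\<lambda>g. \<Sum>i\<in>A. f i g)"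
  by (induction A rule: infinite_finite_induct) (auto intro: Gam_zero Gam_add)

lemma Gam_product:
  assumes "snd ` set ps \<subseteq> augmentation_ideal G" "n \<le> sum_list (map fst ps)"
  shows "Gam n (gamma_product G ps)"
proof -
  have "gamma_product G ps \<in> gamma_filtration G n"
    unfolding gamma_filtration_def using assms by (intro generate.incl) auto
  thus ?thesis by (rule gamma_filtration_Gam)
qed

text \<open>Induction over the generation of \<Gamma>^n by products; the case \<open>cong\<close>
  takes care of functions that differ outside \<open>carrier G\<close>.\<close>

lemma Gam_induct [consumes 1, case_names product zero add uminus cong]:
  assumes f: "Gam n f"
    and product: "\<And>ps. snd ` set ps \<subseteq> augmentation_ideal G \<Longrightarrow> n \<le> sum_list (map fst ps) \<Longrightarrow> P (gamma_product G ps)"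
    and zero: "P (\<lambda>_. 0)"
    and add: "\<And>f h. P f \<Longrightarrow> P h \<Longrightarrow> P (\<lambda>g. f g + h g)"
    and uminus: "\<And>f. P f \<Longrightarrow> P (\<lambda>g. - f g)"
    and cong: "\<And>f h. P f \<Longrightarrow> (\<And>g. g \<in> carrier G \<Longrightarrow> f g = h g) \<Longrightarrow> P h"
  shows "P f"
proof -
  have "restrict f (carrier G) \<in> generate (add_monoid (char_ring G))
     {gamma_product G ps | ps. snd ` set ps \<subseteq> augmentation_ideal G \<and> n \<le> sum_list (map fst ps)}"
    using f by (simp add: Gam_def gamma_filtration_def)
  hence "P (restrict f (carrier G))"
  proof (induction rule: generate.induct)
    case one
    show ?case by (rule cong[OF zero]) (simp add: char_ring_sel)
  next
    case (incl h)
    thus ?case using product by blast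
  next
    case (inv h)
    then obtain ps where ps: "h = gamma_product G ps" "snd ` set ps \<subseteq> augmentation_ideal G" "n \<le> sum_list (map fst ps)"
      by blast
    have "inv\<^bsub>add_monoid (char_ring G)\<^esub> h = (\<lambda>g\<in>carrier G. - h g)"
      using char_ring_a_inv[OF gamma_product_carrier[OF ps(2)]] by (simp add: a_inv_def ps(1))
    moreover have "P (\<lambda>g\<in>carrier G. - h g)"
      by (rule cong[OF uminus[OF product[OF ps(2,3)]]]) (simp add: ps(1))
    ultimately show ?case by (simp only:)
  next
    case (eng x y)
    show ?case by (rule cong[OF add[OF eng.IH]]) (simp add: char_ring_sel)
  qed
  thus ?thesis by (rule cong) simp
qed

lemma Gam_mono:
  assumes "Gam n f" "m \<le> n"
  shows "Gam m f"
  using assms(1)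
proof (induction rule: Gam_induct)
  case (product ps)
  thus ?case using assms(2) by (intro Gam_product) auto
next
  case (cong f h)
  thus ?case using Gam_cong[of f h] by simp
qed (auto intro: Gam_zero Gam_add Gam_uminus)

text \<open>On generators this is concatenation of the two lists of factors; the inductions extend
  it bilinearly.\<close>

lemma Gam_mult:
  assumes "Gam m f" "Gam n h"
  shows "Gam (m + n) (\<lambda>g. f g * h g)"
  using assms(1)
proof (induction rule: Gam_induct)
  case (product ps)
  show ?case using assms(2)
  proof (induction rule: Gam_induct)
    case (product qs)
    have "Gam (m + n) (gamma_product G (ps @ qs))"
      using product \<open>snd ` set ps \<subseteq> augmentation_ideal G\<close> \<open>m \<le> sum_list (map fst ps)\<close>
      by (intro Gam_product) auto
    thus ?case
      by (rule Gam_subst) (simp add: gamma_product_append[OF \<open>snd ` set ps \<subseteq> augmentation_ideal G\<close>])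
  next
    case (add f h)
    thus ?case by (simp add: distrib_left Gam_add)
  next
    case (uminus f)
    thus ?case using Gam_uminus[OF uminus] by simp
  next
    case (cong f h)
    show ?case by (rule Gam_subst[OF cong(1)]) (simp add: cong(2))
  qed (simp add: Gam_zero)
next
  case (add f h)
  thus ?case by (simp add: distrib_right Gam_add)
next
  case (uminus f)
  thus ?case using Gam_uminus[OF uminus] by simp
next
  case (cong f h)
  show ?case by (rule Gam_subst[OF cong(1)]) (simp add: cong(2))
qed (simp add: Gam_zero)

lemma Gam_one: "Gam 0 (\<lambda>_. 1)"
  using Gam_product[of "[]" 0] Gam_cong[of "gamma_product G []" "\<lambda>_. 1"] by (simp add: gamma_product_Nil)

lemma Gam_of_nat_mult: "Gam n f \<Longrightarrow> Gam n (\<lambda>g. of_nat k * f g)"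
  by (induction k) (auto simp: distrib_right intro: Gam_zero Gam_add)

lemma Gam_of_int_mult:
  assumes "Gam n f"
  shows "Gam n (\<lambda>g. of_int k * f g)"
proof (cases "k \<ge> 0")
  case True
  thus ?thesis using Gam_of_nat_mult[OF assms, of "nat k"] by simp
next
  case False
  thus ?thesis using Gam_uminus[OF Gam_of_nat_mult[OF assms, of "nat (- k)"]] by simp
qed

lemma Gam_gam_ps:
  assumes "vchar x" "x \<one> = 0"
  shows "Gam n (\<lambda>g. fps_nth (gam_ps x g) n)"
proof -
  let ?x = "restrict x (carrier G)"
  have x: "?x \<in> augmentation_ideal G" using assms by (simp add: augmentation_ideal_iff vchar_def)
  have "Gam n (gamma_product G [(n, ?x)])" by (rule Gam_product) (use x in auto)
  moreover have "gam_ps ?x g = gam_ps x g" if "g \<in> carrier G" for g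
    by (rule gam_ps_cong) (use that in auto)
  ultimately show ?thesis by (auto simp: gamma_product_Cons[OF x] gamma_product_Nil elim!: Gam_subst)
qed

lemma gam_ps_nth_1:
  assumes "g \<in> carrier G"
  shows "fps_nth (gam_ps x g) 1 = x g"
  using fps_nth_shift_compose[of "lam_ps x g" 0] lam_ps_nth_1[OF assms] by (simp add: gam_ps_def)

lemma Gam_1: "vchar x \<Longrightarrow> x \<one> = 0 \<Longrightarrow> Gam 1 x"
  using Gam_gam_ps[of x 1] by (rule Gam_subst) (simp_all add: gam_ps_nth_1 del: One_nat_def)

text \<open>An x of augmentation 0 has \<gamma>-series 1 at the identity, since only the value of x
  there enters. A product of positive weight has a factor of positive index, which vanishes at the
  identity.\<close>

lemma Gam_at_one:
  assumes "Gam n f" "n > 0"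
  shows "f \<one> = 0"
  using assms(1)
proof (induction rule: Gam_induct)
  case (product ps)
  have "gamma_product G ps \<one> = 0" if "snd ` set ps \<subseteq> augmentation_ideal G" "0 < sum_list (map fst ps)" for ps
    using that
  proof (induction ps)
    case (Cons p ps)
    obtain i x where p: "p = (i, x)" by (cases p)
    hence x: "x \<in> augmentation_ideal G" using Cons.prems by auto
    hence "gam_ps x \<one> = 1" by (intro gam_ps_one_eq_1) (simp add: augmentation_ideal_iff)
    thus ?case using Cons by (cases i) (auto simp: p gamma_product_Cons[OF x])
  qed simp
  thus ?case using product assms(2) by auto
qed auto

section \<open>Filtered matrices\<close>

text \<open>Integer degrees, because the entries below the diagonal of the companion matrices get negative ones.\<close>

definition GamZ :: "int \<Rightarrow> ('a \<Rightarrow> rat) \<Rightarrow> bool" where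
  "GamZ z f \<longleftrightarrow> Gam (nat z) f"

lemma GamZ_mult: "GamZ a f \<Longrightarrow> GamZ b h \<Longrightarrow> GamZ (a + b) (\<lambda>g. f g * h g)"
  unfolding GamZ_def by (rule Gam_mono[OF Gam_mult]) auto

lemma GamZ_mono: "GamZ b f \<Longrightarrow> a \<le> b \<Longrightarrow> GamZ a f"
  unfolding GamZ_def by (erule Gam_mono) auto

lemma GamZ_one: "a \<le> 0 \<Longrightarrow> GamZ a (\<lambda>_. 1)"
  by (simp add: GamZ_def Gam_one)

lemma GamZ_zero: "GamZ a (\<lambda>_. 0)"
  by (simp add: GamZ_def Gam_zero)

lemma GamZ_add: "GamZ a f \<Longrightarrow> GamZ a h \<Longrightarrow> GamZ a (\<lambda>g. f g + h g)"
  by (simp add: GamZ_def Gam_add)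

lemma GamZ_sum: "(\<And>i. i \<in> A \<Longrightarrow> GamZ a (f i)) \<Longrightarrow> GamZ a (\<lambda>g. \<Sum>i\<in>A. f i g)"
  by (simp add: GamZ_def Gam_sum)

lemma GamZ_of_nat_mult: "GamZ a f \<Longrightarrow> GamZ a (\<lambda>g. of_nat k * f g)"
  by (simp add: GamZ_def Gam_of_nat_mult)

lemma GamZ_of_int_mult: "GamZ a f \<Longrightarrow> GamZ a (\<lambda>g. of_int k * f g)"
  by (simp add: GamZ_def Gam_of_int_mult)

lemma GamZ_subst: "GamZ a h \<Longrightarrow> (\<And>g. g \<in> carrier G \<Longrightarrow> f g = h g) \<Longrightarrow> GamZ a f"
  unfolding GamZ_def by (rule Gam_subst)

text \<open>With P the product of the c and Q that of the k c + e over A, adjoining a factor rests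
  on (k c + e) Q - k^(m+1) c P = (k c + e) (Q - k^m P) + k^m e P, where m = card A. The first
  conjunct is carried along to know the degree of P.\<close>

lemma GamZ_prod_congruence:
  assumes "finite A" "\<And>i. i \<in> A \<Longrightarrow> GamZ (a i) (c i)" "\<And>i. i \<in> A \<Longrightarrow> GamZ (a i + 1) (e i)"
  shows "GamZ (\<Sum>i\<in>A. a i) (\<lambda>g. \<Prod>i\<in>A. c i g) \<and>
    GamZ ((\<Sum>i\<in>A. a i) + 1) (\<lambda>g. (\<Prod>i\<in>A. of_nat k * c i g + e i g) - of_nat (k ^ card A) * (\<Prod>i\<in>A. c i g))"
  using assms
proof (induction A)
  case (insert i A)
  let ?P = "\<lambda>g. \<Prod>i\<in>A. c i g" and ?Q = "\<lambda>g. \<Prod>i\<in>A. of_nat k * c i g + e i g"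
  let ?s = "\<Sum>i\<in>A. a i"
  have IH: "GamZ ?s ?P" "GamZ (?s + 1) (\<lambda>g. ?Q g - of_nat (k ^ card A) * ?P g)"
    using insert by auto
  have c: "GamZ (a i) (c i)" "GamZ (a i + 1) (e i)" using insert.prems by auto
  have 1: "GamZ (a i + ?s) (\<lambda>g. c i g * ?P g)" by (rule GamZ_mult[OF c(1) IH(1)])
  have "GamZ (a i) (\<lambda>g. of_nat k * c i g + e i g)"
    by (intro GamZ_add GamZ_of_nat_mult c(1) GamZ_mono[OF c(2)]) simp
  from GamZ_mult[OF this IH(2)]
  have 2: "GamZ (a i + ?s + 1) (\<lambda>g. (of_nat k * c i g + e i g) * (?Q g - of_nat (k ^ card A) * ?P g))"
    by (simp add: add.assoc)
  from GamZ_of_nat_mult[OF GamZ_mult[OF c(2) IH(1)], of "k ^ card A"]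
  have 3: "GamZ (a i + ?s + 1) (\<lambda>g. of_nat (k ^ card A) * (e i g * ?P g))" by (simp add: algebra_simps)
  have "GamZ (a i + ?s + 1) (\<lambda>g. (of_nat k * c i g + e i g) * ?Q g - of_nat (k ^ Suc (card A)) * (c i g * ?P g))"
    by (rule GamZ_subst[OF GamZ_add[OF 2 3]]) (simp add: algebra_simps)
  thus ?case using 1 insert by simp
qed (simp add: GamZ_one GamZ_zero)

text \<open>Matrices of degree z for the grading in which the basis vector of index i has weight i;
  this weighting makes degrees add up under matrix multiplication.\<close>

definition filt :: "nat \<Rightarrow> int \<Rightarrow> ('a \<Rightarrow> rat mat) \<Rightarrow> bool" where
  "filt d z M \<longleftrightarrow> (\<forall>g\<in>carrier G. M g \<in> carrier_mat d d) \<and>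
     (\<forall>i<d. \<forall>j<d. GamZ (z + int j - int i) (\<lambda>g. M g $$ (i, j)))"

lemma filt_carrier: "filt d z M \<Longrightarrow> g \<in> carrier G \<Longrightarrow> M g \<in> carrier_mat d d"
  by (simp add: filt_def)

lemma filt_dim:
  assumes "filt d z M" "g \<in> carrier G"
  shows "dim_row (M g) = d" "dim_col (M g) = d"
  using filt_carrier[OF assms] by auto

lemma filt_mult:
  assumes "filt d a M" "filt d b N"
  shows "filt d (a + b) (\<lambda>g. M g * N g)"
  unfolding filt_def
proof (intro conjI allI impI ballI)
  fix i j assume ij: "i < d" "j < d"
  have "GamZ (a + b + int j - int i) (\<lambda>g. \<Sum>k\<in>{0..<d}. M g $$ (i, k) * N g $$ (k, j))"
  proof (rule GamZ_sum)
    fix k assume "k \<in> {0..<d}"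
    hence "GamZ (a + int k - int i) (\<lambda>g. M g $$ (i, k))" "GamZ (b + int j - int k) (\<lambda>g. N g $$ (k, j))"
      using assms ij by (auto simp: filt_def)
    from GamZ_mult[OF this] show "GamZ (a + b + int j - int i) (\<lambda>g. M g $$ (i, k) * N g $$ (k, j))"
      by (simp add: algebra_simps)
  qed
  thus "GamZ (a + b + int j - int i) (\<lambda>g. (M g * N g) $$ (i, j))"
    by (rule GamZ_subst) (use ij in \<open>simp add: scalar_prod_def filt_dim[OF assms(1)] filt_dim[OF assms(2)]\<close>)
qed (auto intro!: mult_carrier_mat filt_carrier[OF assms(1)] filt_carrier[OF assms(2)])

lemma filt_add:
  assumes "filt d a M" "filt d a N"
  shows "filt d a (\<lambda>g. M g + N g)"
  unfolding filt_def
proof (intro conjI allI impI ballI)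
  fix i j assume ij: "i < d" "j < d"
  have "GamZ (a + int j - int i) (\<lambda>g. M g $$ (i, j) + N g $$ (i, j))"
    using assms ij by (intro GamZ_add) (auto simp: filt_def)
  thus "GamZ (a + int j - int i) (\<lambda>g. (M g + N g) $$ (i, j))"
    by (rule GamZ_subst) (use ij in \<open>simp add: filt_dim[OF assms(1)] filt_dim[OF assms(2)]\<close>)
qed (auto intro!: add_carrier_mat filt_carrier[OF assms(2)])

lemma filt_of_nat_smult:
  assumes "filt d a M"
  shows "filt d a (\<lambda>g. of_nat k \<cdot>\<^sub>m M g)"
  unfolding filt_def
proof (intro conjI allI impI ballI)
  fix i j assume ij: "i < d" "j < d"
  have "GamZ (a + int j - int i) (\<lambda>g. of_nat k * M g $$ (i, j))"
    using assms ij by (intro GamZ_of_nat_mult) (auto simp: filt_def)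
  thus "GamZ (a + int j - int i) (\<lambda>g. (of_nat k \<cdot>\<^sub>m M g) $$ (i, j))"
    by (rule GamZ_subst) (use ij in \<open>simp add: filt_dim[OF assms(1)]\<close>)
qed (auto intro!: smult_carrier_mat filt_carrier[OF assms(1)])

lemma filt_entry: "filt d z M \<Longrightarrow> i < d \<Longrightarrow> j < d \<Longrightarrow> GamZ (z + int j - int i) (\<lambda>g. M g $$ (i, j))"
  by (simp add: filt_def)

lemma filt_mono:
  assumes "filt d b M" "a \<le> b"
  shows "filt d a M"
proof -
  have "GamZ (a + int j - int i) (\<lambda>g. M g $$ (i, j))" if "i < d" "j < d" for i j
    by (rule GamZ_mono[OF filt_entry[OF assms(1) that]]) (use assms(2) in simp)
  thus ?thesis using filt_carrier[OF assms(1)] by (simp add: filt_def)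
qed

text \<open>All terms of the binomial expansion beyond the linear one contain C at least twice,
  hence have degree at least 2.\<close>

lemma filt_pow_shift:
  assumes C: "filt d 1 C"
  shows "\<exists>E. filt d 2 E \<and> (\<forall>g\<in>carrier G. (1\<^sub>m d + C g) ^\<^sub>m k - 1\<^sub>m d = of_nat k \<cdot>\<^sub>m C g + E g)"
proof (induction k)
  case 0
  show ?case
    by (rule exI[of _ "\<lambda>_. 0\<^sub>m d d"])
       (auto simp: filt_def GamZ_zero filt_dim[OF C] intro!: eq_matI)
next
  case (Suc k)
  then obtain E where E: "filt d 2 E" "\<forall>g\<in>carrier G. (1\<^sub>m d + C g) ^\<^sub>m k - 1\<^sub>m d = of_nat k \<cdot>\<^sub>m C g + E g"
    by blast
  \<comment> \<open>The remainder in (1 + k C + E) (1 + C) = 1 + (k + 1) C + (E + k C^2 + E C); its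
    last term even has degree 3.\<close>
  let ?F = "\<lambda>g. E g + of_nat k \<cdot>\<^sub>m (C g * C g) + E g * C g"
  have "filt d 2 ?F"
    using filt_mult[OF C C] filt_mult[OF E(1) C]
    by (intro filt_add filt_of_nat_smult E(1)) (simp_all add: filt_mono[of d 3 _ 2])
  moreover have "(1\<^sub>m d + C g) ^\<^sub>m Suc k - 1\<^sub>m d = of_nat (Suc k) \<cdot>\<^sub>m C g + ?F g" if g: "g \<in> carrier G" for g
  proof -
    note c = filt_carrier[OF C g] filt_carrier[OF E(1) g]
    let ?c = "of_nat k :: rat"
    have c1: "1\<^sub>m d + C g \<in> carrier_mat d d" using c by simp
    hence c2: "(1\<^sub>m d + C g) ^\<^sub>m k \<in> carrier_mat d d" by simp
    have "(1\<^sub>m d + C g) ^\<^sub>m k = 1\<^sub>m d + (?c \<cdot>\<^sub>m C g + E g)"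
    proof -
      have "M = 1\<^sub>m d + (M - 1\<^sub>m d)" if "M \<in> carrier_mat d d" for M :: "rat mat"
        using that by (intro eq_matI) auto
      from this[OF c2] show ?thesis using E(2) g by simp
    qed
    hence "(1\<^sub>m d + C g) ^\<^sub>m Suc k = (1\<^sub>m d + (?c \<cdot>\<^sub>m C g + E g)) * (1\<^sub>m d + C g)" by simp
    also have "\<dots> = (1\<^sub>m d + C g) + (?c \<cdot>\<^sub>m C g + E g) * (1\<^sub>m d + C g)"
      using c by (subst add_mult_distrib_mat[of _ d d _ _ d]) auto
    also have "(?c \<cdot>\<^sub>m C g + E g) * (1\<^sub>m d + C g) = (?c \<cdot>\<^sub>m C g + E g) + (?c \<cdot>\<^sub>m C g + E g) * C g"
      using c by (subst mult_add_distrib_mat[of _ d d _ d]) auto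
    also have "(?c \<cdot>\<^sub>m C g + E g) * C g = ?c \<cdot>\<^sub>m (C g * C g) + E g * C g"
      using c by (subst add_mult_distrib_mat[of _ d d _ _ d]) auto
    finally have eq: "(1\<^sub>m d + C g) ^\<^sub>m Suc k =
        1\<^sub>m d + C g + (?c \<cdot>\<^sub>m C g + E g + (?c \<cdot>\<^sub>m (C g * C g) + E g * C g))" .
    have CC: "C g * C g \<in> carrier_mat d d" "E g * C g \<in> carrier_mat d d" using c by auto
    show ?thesis unfolding eq
      by (rule eq_matI) (use c CC in \<open>auto simp: algebra_simps simp del: index_mult_mat(1)\<close>)
  qed
  ultimately show ?case by blast
qed

text \<open>In the Leibniz term of a permutation p on S, the degrees
  \<open>1 + S ! p i - S ! i\<close> add up to n because p permutes the positions. Each such product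
  lies in \<Gamma>^n, and replacing C by k C + E multiplies it by k^n modulo \<Gamma>^(n+1).\<close>

lemma tr_minors_mat_congruence:
  assumes C: "filt d 1 C" and E: "filt d 2 E"
  shows "Gam (Suc n) (\<lambda>g. tr (minors_mat n (of_nat k \<cdot>\<^sub>m C g + E g)) - of_nat (k ^ n) * tr (minors_mat n (C g)))"
proof -
  let ?P = "{p. p permutes {0..<n}}"
  let ?f = "\<lambda>S p g. (\<Prod>i\<in>{0..<n}. of_nat k * C g $$ (S ! i, S ! p i) + E g $$ (S ! i, S ! p i)) -
     of_nat (k ^ card {0..<n}) * (\<Prod>i\<in>{0..<n}. C g $$ (S ! i, S ! p i))"
  have "GamZ (int n + 1) (\<lambda>g. \<Sum>S\<in>set (ext_basis n d). \<Sum>p\<in>?P. of_int (sign p) * ?f S p g)"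
  proof (intro GamZ_sum GamZ_of_int_mult)
    fix S p assume S: "S \<in> set (ext_basis n d)" and "p \<in> ?P"
    hence p: "p permutes {0..<n}" by simp
    have pn: "p i < n" if "i < n" for i using permutes_in_image[OF p, of i] that by auto
    let ?a = "\<lambda>i. 1 + int (S ! p i) - int (S ! i)"
    have "(\<Sum>i\<in>{0..<n}. int (S ! p i)) = (\<Sum>i\<in>{0..<n}. int (S ! i))"
      by (rule sum.permute[OF p, of "\<lambda>i. int (S ! i)", unfolded o_def, symmetric])
    hence s: "(\<Sum>i\<in>{0..<n}. ?a i) = int n" by (simp add: sum.distrib sum_subtractf)
    have "GamZ ((\<Sum>i\<in>{0..<n}. ?a i) + 1) (?f S p)"
    proof (intro GamZ_prod_congruence[THEN conjunct2])
      fix i assume "i \<in> {0..<n}"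
      hence i: "S ! i < d" "S ! p i < d" using pn ext_basis_nth_less[OF S] by auto
      show "GamZ (?a i) (\<lambda>g. C g $$ (S ! i, S ! p i))" using filt_entry[OF C] i by simp
      show "GamZ (?a i + 1) (\<lambda>g. E g $$ (S ! i, S ! p i))" using filt_entry[OF E i] by (simp add: algebra_simps)
    qed simp
    thus "GamZ (int n + 1) (?f S p)" by (simp only: s)
  qed
  hence "Gam (Suc n) (\<lambda>g. \<Sum>S\<in>set (ext_basis n d). \<Sum>p\<in>?P. of_int (sign p) * ?f S p g)"
    by (simp add: GamZ_def nat_add_distrib)
  thus ?thesis
  proof (rule Gam_subst)
    fix g assume g: "g \<in> carrier G"
    note c = filt_carrier[OF C g] filt_carrier[OF E g]
    have CE: "of_nat k \<cdot>\<^sub>m C g + E g \<in> carrier_mat d d" using c by simp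
    have idx: "S ! p i < d" if "S \<in> set (ext_basis n d)" "p permutes {0..<n}" "i < n" for S p i
      using ext_basis_nth_less[OF that(1), of "p i"] permutes_in_image[OF that(2), of i] that(3) by auto
    have "tr (minors_mat n (of_nat k \<cdot>\<^sub>m C g + E g)) = (\<Sum>S\<in>set (ext_basis n d). \<Sum>p\<in>?P.
       signof p * (\<Prod>i\<in>{0..<n}. of_nat k * C g $$ (S ! i, S ! p i) + E g $$ (S ! i, S ! p i)))"
      unfolding tr_minors_mat_sum[OF CE]
      using c idx ext_basis_nth_less by (intro sum.cong arg_cong2[where f = "(*)"] prod.cong) auto
    thus "tr (minors_mat n (of_nat k \<cdot>\<^sub>m C g + E g)) - of_nat (k ^ n) * tr (minors_mat n (C g)) =
       (\<Sum>S\<in>set (ext_basis n d). \<Sum>p\<in>?P. of_int (sign p) * ?f S p g)"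
      unfolding tr_minors_mat_sum[OF c(1)]
      by (simp add: sum_distrib_left sum_subtractf[symmetric] algebra_simps)
  qed
qed

text \<open>By invariance under k-th powers, \<gamma>^n(x) at g is also the trace of the n-th
  exterior power of \<open>\<rho> (g [^] k) - 1\<close>, that is of (1 + Y)^k - 1. Passing to the
  companion matrix C turns this into k C + E with filtered entries, and the congruence for such
  matrices yields k^n \<gamma>^n(x).\<close>

lemma gam_ps_rat_rep_congruence:
  assumes \<rho>: "rat_rep G d \<rho>" and inv: "\<And>g. g \<in> carrier G \<Longrightarrow> tr (\<rho> (g [^] k)) = tr (\<rho> g)"
  defines "x \<equiv> \<lambda>g. tr (\<rho> g) - of_nat d"
  shows "Gam (Suc n) (\<lambda>g. of_nat (k ^ n) * fps_nth (gam_ps x g) n - fps_nth (gam_ps x g) n)"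
proof -
  define Y where "Y = (\<lambda>g. \<rho> g - 1\<^sub>m d)"
  have Y: "Y g \<in> carrier_mat d d" if "g \<in> carrier G" for g
    using rat_repD(1)[OF \<rho> that] by (auto simp: Y_def)
  define C where "C = (\<lambda>g. companion_mat (char_poly (Y g)))"
  have deg: "Polynomial.degree (char_poly (Y g)) = d" "monic (char_poly (Y g))" if "g \<in> carrier G" for g
    using degree_monic_char_poly[OF Y[OF that]] by auto
  have Cc: "C g \<in> carrier_mat d d" if "g \<in> carrier G" for g
    using companion_mat_carrier[of "char_poly (Y g)"] deg[OF that] by (simp add: C_def)
  have cp: "char_poly (C g) = char_poly (Y g)" if "g \<in> carrier G" for g
    unfolding C_def by (rule char_poly_companion_mat[OF deg(2)[OF that]])
  have gam: "fps_nth (gam_ps x g) n = tr (minors_mat n (Y g))" if "g \<in> carrier G" for g n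
    using gam_ps_rat_rep[OF \<rho> that] by (simp add: x_def Y_def)
  have x1: "x \<one> = 0" using rat_repD(3)[OF \<rho>] by (simp add: x_def tr_def)
  have xv: "vchar x" unfolding x_def by (intro vchar_diff vchar_rat_rep[OF \<rho>] vchar_of_nat)
  have "filt d 1 C" unfolding filt_def
  proof (intro conjI ballI allI impI)
    fix i j assume ij: "i < d" "j < d"
    have "GamZ (1 + int j - int i) (\<lambda>g. if Suc j = d then - ((- 1) ^ (d - i) * fps_nth (gam_ps x g) (d - i))
        else if i = Suc j then 1 else 0)"
    proof (cases "Suc j = d")
      case True
      have "nat (1 + int j - int i) = d - i" using True ij by auto
      moreover have "Gam (d - i) (\<lambda>g. - (of_int ((- 1) ^ (d - i)) * fps_nth (gam_ps x g) (d - i)))"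
        by (intro Gam_uminus Gam_of_int_mult Gam_gam_ps xv x1)
      ultimately show ?thesis using True by (simp add: GamZ_def)
    qed (auto intro: GamZ_one GamZ_zero)
    thus "GamZ (1 + int j - int i) (\<lambda>g. C g $$ (i, j))"
    proof (rule GamZ_subst)
      fix g assume g: "g \<in> carrier G"
      show "C g $$ (i, j) = (if Suc j = d then - ((- 1) ^ (d - i) * fps_nth (gam_ps x g) (d - i))
        else if i = Suc j then 1 else 0)"
        using ij deg(1)[OF g] coeff_char_poly_eq_tr_minors_mat[OF Y[OF g], of i]
        by (auto simp: C_def companion_mat_def Let_def gam[OF g])
    qed
  qed (rule Cc)
  note C = this
  obtain E where E: "filt d 2 E" "\<forall>g\<in>carrier G. (1\<^sub>m d + C g) ^\<^sub>m k - 1\<^sub>m d = of_nat k \<cdot>\<^sub>m C g + E g"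
    using filt_pow_shift[OF C] by blast
  have gC: "tr (minors_mat n (C g)) = fps_nth (gam_ps x g) n" if g: "g \<in> carrier G" for g
  proof -
    have "(1\<^sub>m d + M) ^\<^sub>m 1 - 1\<^sub>m d = M" if "M \<in> carrier_mat d d" for M :: "rat mat"
      using that by (auto intro!: eq_matI)
    thus ?thesis using tr_minors_mat_pow_shift_cong[OF Cc[OF g] Y[OF g] cp[OF g], of n 1] Cc[OF g] Y[OF g] gam[OF g]
      by simp
  qed
  have gCk: "tr (minors_mat n (of_nat k \<cdot>\<^sub>m C g + E g)) = fps_nth (gam_ps x g) n" if g: "g \<in> carrier G" for g
  proof -
    have "1\<^sub>m d + Y g = \<rho> g" using rat_repD(1)[OF \<rho> g] by (auto simp: Y_def intro!: eq_matI)
    hence "(1\<^sub>m d + Y g) ^\<^sub>m k - 1\<^sub>m d = Y (g [^] k)" using rat_rep_pow[OF \<rho> g] by (simp add: Y_def)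
    hence "tr (minors_mat n ((1\<^sub>m d + C g) ^\<^sub>m k - 1\<^sub>m d)) = tr (minors_mat n (Y (g [^] k)))"
      using tr_minors_mat_pow_shift_cong[OF Cc[OF g] Y[OF g] cp[OF g], of n k] by simp
    also have "\<dots> = fps_nth (gam_ps x (g [^] k)) n" using gam[of "g [^] k"] g by simp
    also have "gam_ps x (g [^] k) = gam_ps x g" by (rule gam_ps_pow) (use inv g in \<open>auto simp: x_def\<close>)
    finally show ?thesis using E(2) g by simp
  qed
  have "Gam (Suc n) (\<lambda>g. - (tr (minors_mat n (of_nat k \<cdot>\<^sub>m C g + E g)) - of_nat (k ^ n) * tr (minors_mat n (C g))))"
    by (rule Gam_uminus[OF tr_minors_mat_congruence[OF C E(1)]])
  thus ?thesis by (rule Gam_subst) (simp add: gC gCk)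
qed

end

section \<open>Cyclotomic polynomials of prime power order\<close>

text \<open>If p divides the constant term of A, it does not divide that of B. At the first
  coefficient of A not divisible by p, the coefficient of A B is not divisible either, so this index
  is at least the degree of F; hence A has full degree and B is a unit.\<close>

lemma Eisenstein:
  fixes F :: "int poly" and p :: int
  assumes p: "Factorial_Ring.prime p" and monic: "monic F" and deg: "0 < Polynomial.degree F"
    and dvd: "\<And>i. i < Polynomial.degree F \<Longrightarrow> p dvd Polynomial.coeff F i"
    and F0: "\<not> p\<^sup>2 dvd Polynomial.coeff F 0"
  shows "Factorial_Ring.irreducible F"
proof (rule Factorial_Ring.irreducibleI)
  show "F \<noteq> 0" "\<not> is_unit F" using deg by (auto simp: is_unit_poly_iff)
next
  have key: "is_unit B" if FAB: "F = A * B" and pA: "p dvd Polynomial.coeff A 0" for A B :: "int poly"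
  proof -
    have lead: "Polynomial.lead_coeff A * Polynomial.lead_coeff B = 1"
      using monic by (simp add: FAB lead_coeff_mult)
    hence nA: "\<not> p dvd Polynomial.lead_coeff A"
      using p by (metis dvd_mult2 not_prime_unit)
    have B0: "\<not> p dvd Polynomial.coeff B 0"
    proof
      assume "p dvd Polynomial.coeff B 0"
      hence "p * p dvd Polynomial.coeff A 0 * Polynomial.coeff B 0" using pA by (intro mult_dvd_mono)
      thus False using F0 by (simp add: FAB coeff_mult_0 power2_eq_square)
    qed
    define i where "i = (LEAST i. \<not> p dvd Polynomial.coeff A i)"
    have i: "\<not> p dvd Polynomial.coeff A i" unfolding i_def by (rule LeastI[of "\<lambda>i. \<not> p dvd Polynomial.coeff A i", OF nA])
    have less: "p dvd Polynomial.coeff A k" if "k < i" for k using not_less_Least[of k] that unfolding i_def by blast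
    have "Polynomial.coeff F i = (\<Sum>k\<le>i. Polynomial.coeff A k * Polynomial.coeff B (i - k))"
      by (simp add: FAB coeff_mult)
    also have "\<dots> = (\<Sum>k<i. Polynomial.coeff A k * Polynomial.coeff B (i - k)) + Polynomial.coeff A i * Polynomial.coeff B 0"
      by (simp add: lessThan_Suc_atMost[symmetric])
    finally have "Polynomial.coeff A i * Polynomial.coeff B 0 =
        Polynomial.coeff F i - (\<Sum>k<i. Polynomial.coeff A k * Polynomial.coeff B (i - k))" by simp
    moreover have "p dvd (\<Sum>k<i. Polynomial.coeff A k * Polynomial.coeff B (i - k))"
      by (rule dvd_sum) (use less in auto)
    moreover have "\<not> p dvd Polynomial.coeff A i * Polynomial.coeff B 0"
      using i B0 p by (simp add: prime_dvd_mult_iff)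
    ultimately have "\<not> p dvd Polynomial.coeff F i" using dvd_diff[of p "Polynomial.coeff F i"] by auto
    hence "Polynomial.degree F \<le> i" using dvd by (meson not_le)
    moreover have "i \<le> Polynomial.degree A" unfolding i_def by (rule Least_le) (rule nA)
    moreover have "Polynomial.degree F = Polynomial.degree A + Polynomial.degree B"
      unfolding FAB using monic by (intro degree_mult_eq) (auto simp: FAB)
    ultimately have "Polynomial.degree B = 0" by simp
    moreover have "is_unit (Polynomial.lead_coeff B)" using lead by (metis dvd_triv_right)
    ultimately show "is_unit B" by (metis degree_eq_zeroE is_unit_const_poly_iff lead_coeff_pCons(2))
  qed
  fix A B assume FAB: "F = A * B"
  have "p dvd Polynomial.coeff A 0 * Polynomial.coeff B 0" using dvd[of 0] deg by (simp add: FAB coeff_mult_0)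
  hence "p dvd Polynomial.coeff A 0 \<or> p dvd Polynomial.coeff B 0" using p by (simp add: prime_dvd_mult_iff)
  thus "is_unit A \<or> is_unit B" using key[OF FAB] key[of B A] FAB by (auto simp: mult.commute)
qed

section \<open>Congruences modulo p that feed Eisenstein's criterion\<close>

lemma prime_dvd_freshman:
  fixes a b :: "'a::comm_ring_1"
  assumes "Factorial_Ring.prime p"
  shows "of_nat p dvd (a + b) ^ p - (a ^ p + b ^ p)"
proof -
  have p: "p > 0" using assms by (simp add: prime_gt_0_nat)
  have "(a + b) ^ p = (\<Sum>k\<le>p. of_nat (p choose k) * a ^ k * b ^ (p - k))" by (rule binomial_ring)
  also have "\<dots> = (\<Sum>k\<in>{0, p}. of_nat (p choose k) * a ^ k * b ^ (p - k)) +
      (\<Sum>k\<in>{..p} - {0, p}. of_nat (p choose k) * a ^ k * b ^ (p - k))"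
    by (subst add.commute, rule sum.subset_diff) auto
  also have "(\<Sum>k\<in>{0, p}. of_nat (p choose k) * a ^ k * b ^ (p - k)) = a ^ p + b ^ p"
    using p by (simp add: add.commute)
  finally have "(a + b) ^ p - (a ^ p + b ^ p) =
      (\<Sum>k\<in>{..p} - {0, p}. of_nat (p choose k) * a ^ k * b ^ (p - k))" by simp
  moreover have "of_nat p dvd (\<Sum>k\<in>{..p} - {0, p}. of_nat (p choose k) * a ^ k * b ^ (p - k))"
  proof (rule dvd_sum)
    fix k assume "k \<in> {..p} - {0, p}"
    hence "p dvd (p choose k)" using assms by (intro dvd_choose_prime) auto
    hence "(of_nat p :: 'a) dvd of_nat (p choose k)" by (auto elim!: dvdE)
    thus "of_nat p dvd of_nat (p choose k) * a ^ k * b ^ (p - k)" by (simp add: dvd_mult2)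
  qed
  ultimately show ?thesis by simp
qed

text \<open>Two expressions for ((1 + y)^n - 1) / y; the induction avoids the division.\<close>

lemma sum_one_plus_powers:
  fixes y :: "'a::comm_ring_1"
  shows "(\<Sum>i<n. (1 + y) ^ i) = (\<Sum>k<n. of_nat (n choose Suc k) * y ^ k)"
proof (induction n)
  case (Suc n)
  have "(1 + y) ^ n = (\<Sum>k<Suc n. of_nat (n choose k) * y ^ k)"
    using binomial_ring[of y 1 n] by (simp add: add.commute lessThan_Suc_atMost)
  moreover have "(\<Sum>k<n. of_nat (n choose Suc k) * y ^ k) = (\<Sum>k<Suc n. of_nat (n choose Suc k) * y ^ k)"
    by (simp add: binomial_eq_0)
  ultimately have "(\<Sum>i<Suc n. (1 + y) ^ i) =
      (\<Sum>k<Suc n. of_nat (n choose Suc k) * y ^ k) + (\<Sum>k<Suc n. of_nat (n choose k) * y ^ k)"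
    by (simp only: sum.lessThan_Suc[of _ n] Suc)
  thus ?case by (simp only: sum.distrib[symmetric]) (simp add: algebra_simps)
qed simp

text \<open>All binomial coefficients but the leading one are divisible by p, so the cyclotomic
  polynomial of order p, taken at 1 + y, is y^(p-1) modulo p.\<close>

lemma prime_dvd_sum_one_plus_powers:
  fixes y :: "'a::comm_ring_1"
  assumes "Factorial_Ring.prime p"
  shows "of_nat p dvd (\<Sum>i<p. (1 + y) ^ i) - y ^ (p - 1)"
proof -
  obtain m where m: "p = Suc m" using prime_gt_0_nat[OF assms] gr0_implies_Suc by blast
  have "(\<Sum>i<p. (1 + y) ^ i) - y ^ (p - 1) = (\<Sum>k<m. of_nat (p choose Suc k) * y ^ k)"
    unfolding sum_one_plus_powers m by (simp add: binomial_eq_0)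
  moreover have "of_nat p dvd (\<Sum>k<m. of_nat (p choose Suc k) * y ^ k)"
  proof (rule dvd_sum)
    fix k assume "k \<in> {..<m}"
    hence "p dvd (p choose Suc k)" using assms m by (intro dvd_choose_prime) auto
    hence "(of_nat p :: 'a) dvd of_nat (p choose Suc k)" by (auto elim!: dvdE)
    thus "of_nat p dvd of_nat (p choose Suc k) * y ^ k" by (simp add: dvd_mult2)
  qed
  ultimately show ?thesis by simp
qed

lemma dvd_power_diff:
  fixes a b :: "'a::comm_ring_1"
  assumes "d dvd a - b"
  shows "d dvd a ^ n - b ^ n"
  unfolding power_diff_sumr2 using assms by (rule dvd_mult2)

lemma prime_dvd_one_plus_prime_power:
  fixes a :: "'a::comm_ring_1"
  assumes "Factorial_Ring.prime p"
  shows "of_nat p dvd (1 + a) ^ (p ^ j) - (1 + a ^ (p ^ j))"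
proof (induction j)
  case (Suc j)
  have "of_nat p dvd ((1 + a) ^ (p ^ j)) ^ p - (1 + a ^ (p ^ j)) ^ p" by (rule dvd_power_diff[OF Suc])
  moreover have "of_nat p dvd (1 + a ^ (p ^ j)) ^ p - (1 ^ p + (a ^ (p ^ j)) ^ p)" by (rule prime_dvd_freshman[OF assms])
  ultimately have "of_nat p dvd (((1 + a) ^ (p ^ j)) ^ p - (1 + a ^ (p ^ j)) ^ p) +
      ((1 + a ^ (p ^ j)) ^ p - (1 ^ p + (a ^ (p ^ j)) ^ p))" by (rule dvd_add)
  hence "of_nat p dvd ((1 + a) ^ (p ^ j)) ^ p - (1 + (a ^ (p ^ j)) ^ p)"
    by (simp add: algebra_simps)
  thus ?case unfolding power_mult[symmetric] power_Suc2 .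
qed simp

text \<open>The cyclotomic polynomial of order \<open>p\<^bsup>j + 1\<^esup>\<close>.\<close>

definition cyclo :: "nat \<Rightarrow> nat \<Rightarrow> int poly" where
  "cyclo p j = (\<Sum>i<p. Polynomial.monom 1 (p ^ j * i))"

lemma cyclo_mult: "cyclo p j * (Polynomial.monom 1 (p ^ j) - 1) = Polynomial.monom 1 (p ^ Suc j) - 1"
proof -
  have "cyclo p j = (\<Sum>i<p. (Polynomial.monom 1 (p ^ j)) ^ i)"
    by (simp add: cyclo_def monom_power mult.commute)
  hence "cyclo p j * (Polynomial.monom 1 (p ^ j) - 1) =
      (Polynomial.monom 1 (p ^ j) - 1) * (\<Sum>i<p. (Polynomial.monom 1 (p ^ j)) ^ i)" by (simp only: mult.commute)
  also have "\<dots> = Polynomial.monom 1 (p ^ j) ^ p - 1" by (rule power_diff_1_eq[symmetric])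
  finally show ?thesis by (simp add: monom_power mult.commute)
qed

lemma
  assumes "p > 0"
  shows degree_cyclo: "Polynomial.degree (cyclo p j) = p ^ j * (p - 1)" and monic_cyclo: "monic (cyclo p j)"
proof -
  obtain m where m: "p = Suc m" using assms gr0_implies_Suc by blast
  let ?n = "p ^ j * m"
  have eq: "cyclo p j = Polynomial.monom 1 ?n + (\<Sum>i<m. Polynomial.monom 1 (p ^ j * i))"
    by (simp add: cyclo_def m)
  have z: "Polynomial.coeff (\<Sum>i<m. Polynomial.monom 1 (p ^ j * i)) k = (0::int)" if "k \<ge> ?n" for k
  proof -
    have "p ^ j * i < k" if "i < m" for i
      using that \<open>k \<ge> ?n\<close> assms by (meson less_le_trans mult_less_mono2 zero_less_power)
    thus ?thesis unfolding coeff_sum by (intro sum.neutral) auto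
  qed
  have c: "Polynomial.coeff (cyclo p j) ?n = 1" unfolding eq coeff_add z[OF order_refl] by simp
  have "Polynomial.degree (cyclo p j) \<le> ?n"
    by (rule degree_le) (auto simp: eq z)
  moreover have "?n \<le> Polynomial.degree (cyclo p j)" by (rule le_degree) (simp add: c)
  ultimately have "Polynomial.degree (cyclo p j) = ?n" by simp
  thus "Polynomial.degree (cyclo p j) = p ^ j * (p - 1)" "monic (cyclo p j)" using c m by auto
qed

text \<open>Eisenstein after substituting x + 1 for x: with y = (1 + x)^(p^j) - 1, which is x^(p^j)
  modulo p, the polynomial becomes the sum of the powers (1 + y)^i and so is a power of x modulo p.
  Its constant term is the value p of the cyclotomic polynomial at 1.\<close>

lemma irreducible_cyclo:
  assumes p: "Factorial_Ring.prime p"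
  shows "Factorial_Ring.irreducible (cyclo p j)"
proof -
  have p1: "p > 1" using p by (rule prime_gt_1_nat)
  let ?s = "[:1, 1:] :: int poly" and ?x = "[:0, 1:] :: int poly"
  let ?F = "pcompose (cyclo p j) ?s"
  let ?n = "p ^ j * (p - 1)"
  have deg: "Polynomial.degree ?F = ?n" using degree_cyclo[of p j] p1 by simp
  have "Polynomial.lead_coeff ?F = Polynomial.lead_coeff (cyclo p j) * Polynomial.lead_coeff ?s ^ Polynomial.degree (cyclo p j)"
    by (rule lead_coeff_comp) simp
  moreover have "Polynomial.lead_coeff ?s = 1" by simp
  moreover have "Polynomial.lead_coeff (cyclo p j) = 1" using monic_cyclo[of p j] p1 by simp
  ultimately have mon: "monic ?F" by (simp only: power_one mult_1)
  have Fsum: "?F = (\<Sum>i<p. (1 + ((1 + ?x) ^ (p ^ j) - 1)) ^ i)"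
  proof -
    have "[:1, 1:] = [:1:] + ?x" unfolding add_pCons by simp
    hence sx: "?s = 1 + ?x" unfolding pCons_one .
    have pow: "pcompose (q ^ k) r = pcompose q r ^ k" for q r :: "int poly" and k
      by (induction k) (simp_all add: pcompose_mult pcompose_1)
    have "pcompose ?x ?s = ?s" by (simp only: pcompose_pCons pcompose_0') simp
    hence "pcompose (Polynomial.monom 1 k) ?s = ?s ^ k" for k
      by (simp only: monom_altdef smult_1_left pow)
    hence "pcompose (Polynomial.monom 1 k) ?s = (1 + ?x) ^ k" for k
      by (simp only: sx[symmetric])
    thus ?thesis by (simp add: cyclo_def pcompose_sum power_mult)
  qed
  let ?y = "(1 + ?x) ^ (p ^ j) - 1"
  have "of_nat p dvd ?y - ?x ^ (p ^ j)"
    using prime_dvd_one_plus_prime_power[OF p, of ?x j] by (simp add: algebra_simps)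
  hence "of_nat p dvd ?y ^ (p - 1) - (?x ^ (p ^ j)) ^ (p - 1)" by (rule dvd_power_diff)
  with prime_dvd_sum_one_plus_powers[OF p, of ?y]
  have "of_nat p dvd (?F - ?y ^ (p - 1)) + (?y ^ (p - 1) - (?x ^ (p ^ j)) ^ (p - 1))"
    unfolding Fsum by (rule dvd_add)
  hence "[:int p:] dvd ?F - Polynomial.monom 1 ?n"
    by (simp add: power_mult[symmetric] monom_altdef of_nat_poly)
  hence dvd: "int p dvd Polynomial.coeff (?F - Polynomial.monom 1 ?n) i" for i
    by (simp add: const_poly_dvd_iff)
  have irr: "Factorial_Ring.irreducible ?F"
  proof (rule Eisenstein[of "int p"])
    show "Factorial_Ring.prime (int p)" using p by simp
    show "monic ?F" by (rule mon)
    show "0 < Polynomial.degree ?F" using deg p1 by simp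
    show "int p dvd Polynomial.coeff ?F i" if "i < Polynomial.degree ?F" for i
      using dvd[of i] that deg by simp
    have "Polynomial.coeff ?F 0 = poly ?F 0" by (simp add: poly_0_coeff_0)
    also have "\<dots> = poly (cyclo p j) 1" by (simp add: poly_pcompose)
    also have "\<dots> = int p" by (simp add: cyclo_def poly_sum poly_monom)
    finally show "\<not> (int p)\<^sup>2 dvd Polynomial.coeff ?F 0"
      using p1 by (metis dvd_times_left_cancel_iff int_dvd_int_iff less_irrefl_nat mult.right_neutral nat_dvd_1_iff_1
        of_nat_1 power2_eq_square not_less_zero of_nat_eq_0_iff)
  qed
  show ?thesis
  proof (rule Factorial_Ring.irreducibleI)
    show "cyclo p j \<noteq> 0" using irr by auto
    \<comment> \<open>Substituting x - 1 undoes the substitution, so that a factor becoming a unit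
      was one before.\<close>
    have unit: "is_unit A" if "is_unit (pcompose A ?s)" for A
    proof -
      from that obtain U where U: "pcompose A ?s * U = 1" by (metis dvdE)
      have "pcompose (pcompose A ?s) [:-1, 1:] * pcompose U [:-1, 1:] = 1"
        unfolding pcompose_mult[symmetric] U by simp
      moreover have "pcompose (pcompose A ?s) [:-1, 1:] = A"
      proof -
        have "[:1:] + [:-1, 1:] = ?x" unfolding add_pCons by simp
        hence "pcompose ?s [:-1, 1:] = ?x" by (simp add: pcompose_pCons)
        thus ?thesis by (simp only: pcompose_assoc[symmetric] pcompose_idR)
      qed
      ultimately show ?thesis by (metis dvd_triv_left)
    qed
    show "\<not> is_unit (cyclo p j)"
    proof
      assume "is_unit (cyclo p j)"
      hence "Polynomial.degree (cyclo p j) = 0" using poly_dvd_1 by (metis is_unit_iff_degree degree_pCons_0 dvd_refl is_unit_poly_iff)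
      thus False using degree_cyclo[of p j] p1 by simp
    qed
    fix A B assume "cyclo p j = A * B"
    hence "?F = pcompose A ?s * pcompose B ?s" by (simp add: pcompose_mult)
    hence "is_unit (pcompose A ?s) \<or> is_unit (pcompose B ?s)" using irr Factorial_Ring.irreducibleD by blast
    thus "is_unit A \<or> is_unit B" using unit by blast
  qed
qed

abbreviation complex_poly :: "int poly \<Rightarrow> complex poly" where
  "complex_poly \<equiv> map_poly of_int"

text \<open>Since \<open>cyclo p j\<close> is monic, no passage to rational coefficients (Gauss' lemma) is needed to see
  that it divides every integer polynomial vanishing at one of its roots.\<close>

lemma cyclo_dvd:
  assumes p: "Factorial_Ring.prime p" and z: "poly (complex_poly (cyclo p j)) z = 0"
    and F: "poly (complex_poly F) z = 0"
  shows "cyclo p j dvd F"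
proof -
  let ?C = "cyclo p j"
  have irr: "Factorial_Ring.irreducible ?C" by (rule irreducible_cyclo[OF p])
  hence prime: "prime_elem ?C" by (rule irreducible_imp_prime_elem)
  have hom: "poly (complex_poly (A * B)) w = poly (complex_poly A) w * poly (complex_poly B) w"
    "poly (complex_poly (A + B)) w = poly (complex_poly A) w + poly (complex_poly B) w" for A B w
    by (simp_all add: of_int_poly_hom.hom_mult of_int_poly_hom.hom_add)
  \<comment> \<open>Let H be a nonzero polynomial of least degree n vanishing at z. It will turn out
    that \<open>?C\<close> divides H, so that no nonzero polynomial of degree below that of
    \<open>?C\<close> vanishes at z.\<close>
  define P where "P = (\<lambda>n. \<exists>H. H \<noteq> 0 \<and> poly (complex_poly H) z = 0 \<and> Polynomial.degree H = n)"
  have "P (Polynomial.degree ?C)" unfolding P_def using z irr by (intro exI[of _ ?C]) auto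
  define n where "n = (LEAST n. P n)"
  have "P n" unfolding n_def by (rule LeastI) fact
  then obtain H where H: "H \<noteq> 0" "poly (complex_poly H) z = 0" "Polynomial.degree H = n" unfolding P_def by blast
  have least: "R = 0" if "poly (complex_poly R) z = 0" "Polynomial.degree R < n" for R
    using not_less_Least[of "Polynomial.degree R" P] that unfolding n_def P_def by blast
  have n0: "n > 0"
  proof (rule ccontr)
    assume "\<not> n > 0"
    then obtain c where "H = [:c:]" using H(3) by (metis degree_eq_zeroE gr0I)
    thus False using H by simp
  qed
  \<comment> \<open>Pseudo-division of \<open>?C\<close> by H leaves a remainder that vanishes at z;
    by minimality of n it is 0.\<close>
  obtain Q R where QR: "pseudo_divmod ?C H = (Q, R)" by (cases "pseudo_divmod ?C H")
  define c where "c = Polynomial.lead_coeff H ^ (Suc (Polynomial.degree ?C) - Polynomial.degree H)"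
  have "Polynomial.lead_coeff H \<noteq> 0" using H(1) by (simp only: leading_coeff_0_iff not_False_eq_True)
  hence c: "c \<noteq> 0" unfolding c_def by (rule power_not_zero)
  from pseudo_divmod[OF H(1) QR] have eq: "Polynomial.smult c ?C = H * Q + R"
    and R: "R = 0 \<or> Polynomial.degree R < n" using H(3) by (auto simp: c_def)
  have "poly (complex_poly (Polynomial.smult c ?C)) z = 0"
    using hom(1)[of "[:c:]" ?C z] z by simp
  hence "poly (complex_poly R) z = 0" unfolding eq using H(2) by (simp add: hom)
  hence "R = 0" using R least by auto
  hence eq: "Polynomial.smult c ?C = H * Q" using eq by simp
  have "?C dvd H * Q" unfolding eq[symmetric] by (metis dvd_refl dvd_smult)
  hence "?C dvd H"
  proof (rule prime_elem_dvd_multD[OF prime, THEN disjE])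
    \<comment> \<open>Cancelling \<open>?C\<close> would make H a divisor of the nonzero constant c,
      although its degree is positive.\<close>
    assume "?C dvd Q"
    then obtain Q' where "Q = ?C * Q'" by auto
    hence "?C * [:c:] = ?C * (H * Q')" using eq by (simp add: ac_simps)
    moreover have "?C \<noteq> 0" using irr by auto
    ultimately have HQ: "[:c:] = H * Q'" by (simp only: mult_cancel_left) simp
    hence "Polynomial.degree (H * Q') = 0" by (metis degree_pCons_0)
    moreover have "Q' \<noteq> 0" using HQ c by auto
    ultimately have "Polynomial.degree H = 0" using H(1) by (simp add: degree_mult_eq)
    thus ?thesis using n0 H(3) by simp
  qed auto
  hence "Polynomial.degree ?C \<le> n" using H dvd_imp_degree_le by blast
  \<comment> \<open>As \<open>?C\<close> is monic, the pseudo-division of F by it is a true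
    division.\<close>
  moreover obtain Q R where QR: "pseudo_divmod F ?C = (Q, R)" by (cases "pseudo_divmod F ?C")
  have C0: "?C \<noteq> 0" using irr by auto
  have mon: "Polynomial.lead_coeff ?C = 1" using monic_cyclo p prime_gt_0_nat by blast
  have eqF: "F = ?C * Q + R" and RF: "R = 0 \<or> Polynomial.degree R < Polynomial.degree ?C"
    using pseudo_divmod[OF C0 QR] mon by auto
  have "poly (complex_poly R) z = 0" using F z unfolding eqF by (simp add: hom)
  ultimately have "R = 0" using RF least by auto
  thus ?thesis using eqF by simp
qed

lemma cyclo_root_iff:
  assumes p: "Factorial_Ring.prime p"
  shows "poly (complex_poly (cyclo p j)) z = 0 \<longleftrightarrow> z ^ (p ^ Suc j) = 1 \<and> z ^ (p ^ j) \<noteq> 1"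
proof -
  have e: "poly (complex_poly (cyclo p j)) z = (\<Sum>i<p. (z ^ (p ^ j)) ^ i)"
    by (simp add: cyclo_def of_int_poly_hom.hom_sum poly_sum poly_monom power_mult)
  show ?thesis
  proof (cases "z ^ (p ^ j) = 1")
    case True
    thus ?thesis using prime_gt_0_nat[OF p] by (simp add: e)
  next
    case False
    have "(z ^ (p ^ j) - 1) * (\<Sum>i<p. (z ^ (p ^ j)) ^ i) = (z ^ (p ^ j)) ^ p - 1"
      by (rule power_diff_1_eq[symmetric])
    also have "(z ^ (p ^ j)) ^ p = z ^ (p ^ Suc j)" unfolding power_mult[symmetric] power_Suc2 ..
    finally have "(z ^ (p ^ j) - 1) * (\<Sum>i<p. (z ^ (p ^ j)) ^ i) = z ^ (p ^ Suc j) - 1" .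
    thus ?thesis using False by (auto simp: e)
  qed
qed

text \<open>The cyclotomic polynomial divides X^q - 1, whose derivative has no root other than 0; so
  its roots are simple.\<close>

lemma order_cyclo:
  assumes p: "Factorial_Ring.prime p" and z: "poly (complex_poly (cyclo p j)) z = 0"
  shows "Polynomial.order z (complex_poly (cyclo p j)) = 1"
proof -
  let ?q = "p ^ Suc j"
  let ?X = "Polynomial.monom 1 ?q - 1 :: complex poly"
  have q: "?q > 0" using prime_gt_0_nat[OF p] by simp
  have z1: "z ^ ?q = 1" using z cyclo_root_iff[OF p] by blast
  have "complex_poly (cyclo p j * (Polynomial.monom 1 (p ^ j) - 1)) = complex_poly (Polynomial.monom 1 ?q - 1)"
    by (simp only: cyclo_mult)
  hence dvd: "complex_poly (cyclo p j) dvd ?X"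
    by (metis dvd_triv_left of_int_poly_hom.hom_mult of_int_poly_hom.hom_minus of_int_hom.map_poly_hom_monom of_int_1 of_int_poly_hom.hom_one)
  have X0: "?X \<noteq> 0"
  proof
    assume "?X = 0"
    hence "poly ?X 0 = 0" by simp
    moreover obtain m where "?q = Suc m" using q gr0_implies_Suc by blast
    ultimately show False by (simp only: poly_diff poly_monom) simp
  qed
  have "z \<noteq> 0"
  proof
    assume "z = 0"
    moreover obtain m where "?q = Suc m" using q gr0_implies_Suc by blast
    ultimately show False using z1 by (simp only: power_Suc mult_zero_left zero_neq_one)
  qed
  hence "poly (pderiv ?X) z \<noteq> 0" using q by (simp add: pderiv_diff pderiv_monom poly_monom)
  moreover have "poly ?X z = 0" using z1 by (simp add: poly_monom)
  ultimately have "Polynomial.order z ?X = 1"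
    using X0 order_pderiv[of ?X z] order_root[of "pderiv ?X" z] order_root[of ?X z] by (metis One_nat_def order_0I pderiv_0 poly_0)
  moreover have "Polynomial.order z (complex_poly (cyclo p j)) \<le> Polynomial.order z ?X"
    by (rule dvd_imp_order_le[OF X0 dvd])
  moreover have "Polynomial.order z (complex_poly (cyclo p j)) \<noteq> 0"
    using z order_root X0 dvd by (metis dvd_0_left_iff)
  ultimately show ?thesis by simp
qed

text \<open>Galois conjugation in elementary form: as long as the cyclotomic polynomial divides F,
  both orders drop by 1 on division by it; once it does not, neither z nor w is a root.\<close>

lemma order_conjugate:
  fixes F :: "int poly"
  assumes p: "Factorial_Ring.prime p" and F: "F \<noteq> 0"
    and z: "poly (complex_poly (cyclo p j)) z = 0" and w: "poly (complex_poly (cyclo p j)) w = 0"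
  shows "Polynomial.order z (complex_poly F) = Polynomial.order w (complex_poly F)"
  using F
proof (induction "Polynomial.degree F" arbitrary: F rule: less_induct)
  case less
  have nz: "complex_poly H \<noteq> 0" if "H \<noteq> 0" for H using that by simp
  show ?case
  proof (cases "cyclo p j dvd F")
    case True
    then obtain H where H: "F = cyclo p j * H" by auto
    have C0: "cyclo p j \<noteq> 0" "H \<noteq> 0" using H less.prems by auto
    have "0 < Polynomial.degree (cyclo p j)"
      using degree_cyclo[of p j] prime_gt_1_nat[OF p] by simp
    hence "Polynomial.degree H < Polynomial.degree F" using C0 by (simp add: H degree_mult_eq)
    hence "Polynomial.order z (complex_poly H) = Polynomial.order w (complex_poly H)"
      by (rule less.hyps) (rule C0)
    moreover have "Polynomial.order v (complex_poly F) = Polynomial.order v (complex_poly (cyclo p j)) + Polynomial.order v (complex_poly H)" for v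
      unfolding H of_int_poly_hom.hom_mult using nz C0 by (intro order_mult) simp
    ultimately show ?thesis using order_cyclo[OF p z] order_cyclo[OF p w] by simp
  next
    case False
    hence "poly (complex_poly F) z \<noteq> 0" "poly (complex_poly F) w \<noteq> 0"
      using cyclo_dvd[OF p z] cyclo_dvd[OF p w] by auto
    thus ?thesis by (simp add: order_0I)
  qed
qed

section \<open>Rational matrices of prime power order\<close>

lemma order_prod_linear:
  "Polynomial.order z (\<Prod>e\<leftarrow>es. [:- e, 1:]) = count_list es (z :: 'a::idom)"
proof (induction es)
  case (Cons e es)
  have nz: "(\<Prod>e\<leftarrow>xs. [:- e, 1:]) \<noteq> 0" for xs :: "'a list"
    by (subst prod_list_zero_iff) auto
  have "Polynomial.order z [:- e, 1:] = (if e = z then 1 else 0)"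
    using order_power_n_n[of z 1] order_0I[of "[:- e, 1:]" z] by auto
  moreover have "Polynomial.order z (\<Prod>e\<leftarrow>e # es. [:- e, 1:]) =
      Polynomial.order z [:- e, 1:] + Polynomial.order z (\<Prod>e\<leftarrow>es. [:- e, 1:])"
    unfolding list.map prod_list.Cons by (rule order_mult) (use nz[of "e # es"] in simp)
  ultimately show ?case unfolding Cons by simp
qed (simp add: order_0I)

lemma sum_list_eq_sum_count:
  fixes f :: "'a \<Rightarrow> 'b::comm_semiring_1"
  assumes "finite S" "set xs \<subseteq> S"
  shows "(\<Sum>x\<leftarrow>xs. f x) = (\<Sum>z\<in>S. of_nat (count_list xs z) * f z)"
  using assms(2)
proof (induction xs)
  case (Cons x xs)
  have "(\<Sum>z\<in>S. of_nat (count_list (x # xs) z) * f z) =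
      (\<Sum>z\<in>S. of_nat (count_list xs z) * f z + (if x = z then f z else 0))"
    by (rule sum.cong) (auto simp: algebra_simps)
  also have "\<dots> = (\<Sum>z\<in>S. of_nat (count_list xs z) * f z) + f x"
    using Cons.prems assms(1) by (simp add: sum.distrib)
  finally show ?case using Cons by (simp add: add.commute)
qed simp

text \<open>Makes characteristic polynomials of rational matrices accessible to divisibility over
  the integers.\<close>

lemma clear_denominators:
  fixes f :: "rat poly"
  shows "\<exists>c F. c \<noteq> 0 \<and> map_poly of_int F = Polynomial.smult (of_int c) f"
proof (induction f)
  case 0
  show ?case by (intro exI[of _ 1] exI[of _ 0]) simp
next
  case (pCons a f)
  then obtain c F where cF: "c \<noteq> 0" "map_poly of_int F = Polynomial.smult (of_int c) f" by blast
  obtain n d where nd: "quotient_of a = (n, d)" by (cases "quotient_of a")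
  have d: "d > 0" and a: "a = of_int n / of_int d"
    using quotient_of_denom_pos[OF nd] quotient_of_div[OF nd] by auto
  have "map_poly of_int (pCons (n * c) (Polynomial.smult d F)) = Polynomial.smult (of_int (c * d)) (pCons a f)"
    using d a cF(2) by (simp add: of_int_hom.map_poly_pCons_hom of_int_hom.map_poly_hom_smult algebra_simps)
  thus ?case using cF(1) d by (intro exI[of _ "c * d"] exI[of _ "pCons (n * c) (Polynomial.smult d F)"]) auto
qed

context
  fixes A :: "rat mat" and n :: nat and es :: "complex list" and p e :: nat
  assumes A: "A \<in> carrier_mat n n" and p: "Factorial_Ring.prime p" and Aq: "A ^\<^sub>m (p ^ e) = 1\<^sub>m n"
    and es: "char_poly (complex_mat A) = (\<Prod>e\<leftarrow>es. [:- e, 1:])"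
begin

text \<open>The multiplicity of an eigenvalue is its order as a root of the characteristic
  polynomial, and z and w are roots of the same cyclotomic polynomial.\<close>

lemma count_eigenvalues_conjugate:
  assumes "z ^ (p ^ Suc j) = 1" "z ^ (p ^ j) \<noteq> 1" "w ^ (p ^ Suc j) = 1" "w ^ (p ^ j) \<noteq> 1"
  shows "count_list es z = count_list es w"
proof -
  obtain c F where cF: "c \<noteq> 0" "map_poly of_int F = Polynomial.smult (of_int c) (char_poly A)"
    using clear_denominators by blast
  have "F \<noteq> 0"
  proof
    assume "F = 0"
    hence "char_poly A = 0" using cF by simp
    thus False using degree_monic_char_poly[OF A] by simp
  qed
  have "complex_poly F = map_poly of_rat (map_poly of_int F)" by (simp add: map_poly_map_poly o_def)
  also have "\<dots> = Polynomial.smult (of_int c) (\<Prod>e\<leftarrow>es. [:- e, 1:])"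
    unfolding cF(2) es[symmetric] char_poly_complex_mat[OF A] by (simp add: of_rat_hom.map_poly_hom_smult)
  finally have "Polynomial.order v (complex_poly F) = count_list es v" for v
    using cF(1) order_prod_linear[of v es] by (simp add: order_smult)
  thus ?thesis using order_conjugate[OF p \<open>F \<noteq> 0\<close>, of j z w] assms by (simp add: cyclo_root_iff[OF p])
qed

lemma eigenvalues_roots_of_unity:
  assumes "x \<in> set es"
  shows "x ^ (p ^ e) = 1"
proof -
  have cA: "complex_mat A \<in> carrier_mat n n" using A by simp
  obtain T P Q where T: "similar_mat_wit (complex_mat A) T P Q" "upper_triangular T" "diag_mat T = es" "length es = n"
    using Schur_triangularization[OF cA es] by metis
  note s = similar_mat_witD2[OF cA T(1)]
  have "complex_mat A ^\<^sub>m (p ^ e) = complex_mat (1\<^sub>m n)"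
    using Aq complex_mat_pow[OF A, of "p ^ e"] by simp
  also have "\<dots> = 1\<^sub>m n" by (auto intro!: eq_matI)
  finally have "complex_mat A ^\<^sub>m (p ^ e) = 1\<^sub>m n" .
  hence "similar_mat_wit (1\<^sub>m n) (T ^\<^sub>m (p ^ e)) P Q" using similar_mat_wit_pow[OF T(1), of "p ^ e"] by simp
  hence "similar_mat_wit (T ^\<^sub>m (p ^ e)) (1\<^sub>m n) Q P" by (rule similar_mat_wit_sym)
  hence "T ^\<^sub>m (p ^ e) = Q * 1\<^sub>m n * P" by (simp add: similar_mat_wit_def Let_def)
  hence "T ^\<^sub>m (p ^ e) = 1\<^sub>m n" using s by simp
  moreover obtain i where "i < n" "x = T $$ (i, i)"
    using assms T(3) s by (auto simp: diag_mat_def)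
  ultimately show ?thesis using upper_triangular_pow[of T n "p ^ e"] s T(2) by auto
qed

lemma sum_eigenvalues:
  fixes f :: "complex \<Rightarrow> complex"
  shows "(\<Sum>x\<leftarrow>es. f x) = (\<Sum>z\<in>{z. z ^ (p ^ e) = 1}. of_nat (count_list es z) * f z)"
proof -
  have "finite {z :: complex. z ^ (p ^ e) = 1}"
    using finite_roots_unity[of "p ^ e"] prime_gt_0_nat[OF p] by simp
  thus ?thesis by (rule sum_list_eq_sum_count) (use eigenvalues_roots_of_unity in auto)
qed

end

text \<open>Raising to the k-th power permutes the p^e-th roots of unity and keeps their exact
  orders, so it preserves multiplicities and merely reorders the sum of the eigenvalues.\<close>

theorem tr_pow_coprime:
  fixes A :: "rat mat"
  assumes A: "A \<in> carrier_mat n n" and p: "Factorial_Ring.prime p" and Aq: "A ^\<^sub>m (p ^ e) = 1\<^sub>m n"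
    and k: "coprime k p"
  shows "tr (A ^\<^sub>m k) = tr A"
proof -
  obtain es where es: "char_poly (complex_mat A) = (\<Prod>e\<leftarrow>es. [:- e, 1:])" using ex_eigenvalues[OF A] .
  have cA: "complex_mat A \<in> carrier_mat n n" using A by simp
  let ?R = "{z :: complex. z ^ (p ^ e) = 1}"
  have p1: "p > 1" using p by (rule prime_gt_1_nat)
  \<comment> \<open>The exponent k' is an inverse of k modulo p^j.\<close>
  have ex_inv: "\<exists>k'. \<forall>z::complex. z ^ (p ^ j) = 1 \<longrightarrow> (z ^ k) ^ k' = z" for j
  proof (cases "p ^ j = 1")
    case True
    thus ?thesis by (intro exI[of _ 0]) auto
  next
    case False
    have "coprime k (p ^ j)" using k by simp
    then obtain k' where k': "[k * k' = Suc 0] (mod p ^ j)" using cong_solve_coprime_nat by blast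
    have "(z ^ k) ^ k' = z" if "z ^ (p ^ j) = 1" for z :: complex
    proof -
      have m: "z ^ i = z ^ (i mod p ^ j)" for i
      proof -
        have "z ^ i = z ^ (p ^ j * (i div p ^ j) + i mod p ^ j)" by simp
        thus ?thesis using that by (simp only: power_add power_mult power_one) simp
      qed
      have "(z ^ k) ^ k' = z ^ ((k * k') mod p ^ j)" using m[of "k * k'"] by (simp add: power_mult)
      also have "\<dots> = z ^ (Suc 0 mod p ^ j)" using k' by (simp add: Cong.cong_def)
      also have "\<dots> = z" using m[of "Suc 0"] by simp
      finally show ?thesis .
    qed
    thus ?thesis by blast
  qed
  have inj: "inj_on (\<lambda>z. z ^ k) ?R"
  proof -
    obtain k' where k': "\<forall>z::complex. z ^ (p ^ e) = 1 \<longrightarrow> (z ^ k) ^ k' = z" using ex_inv by blast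
    show ?thesis by (rule inj_on_inverseI[of _ "\<lambda>z. z ^ k'"]) (use k' in auto)
  qed
  have fin: "finite ?R" using finite_roots_unity[of "p ^ e"] p1 by simp
  have pk: "(z ^ k) ^ m = 1" if "z ^ m = 1" for z :: complex and m
    using that by (metis mult.commute power_mult power_one)
  have "(\<lambda>z. z ^ k) ` ?R \<subseteq> ?R" using pk by auto
  hence bij: "bij_betw (\<lambda>z. z ^ k) ?R ?R" using endo_inj_surj[OF fin _ inj] inj by (simp add: bij_betw_def)
  have cnt: "count_list es (z ^ k) = count_list es z" if z: "z \<in> ?R" for z
  proof (cases "z = 1")
    case False
    \<comment> \<open>z is a primitive root of unity of order p^m; since z is a power of z^k, the
      same holds for z^k.\<close>
    define m where "m = (LEAST m. z ^ (p ^ m) = 1)"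
    have m: "z ^ (p ^ m) = 1" unfolding m_def by (rule LeastI[of _ e]) (use z in auto)
    have "m \<noteq> 0" using m False by (intro notI) simp
    then obtain j where j: "m = Suc j" by (cases m) auto
    have mj: "z ^ (p ^ j) \<noteq> 1" using not_less_Least[of j "\<lambda>m. z ^ (p ^ m) = 1"] j unfolding m_def by simp
    have "(z ^ k) ^ (p ^ j) \<noteq> 1"
    proof
      assume 1: "(z ^ k) ^ (p ^ j) = 1"
      obtain k' where k': "\<forall>z::complex. z ^ (p ^ m) = 1 \<longrightarrow> (z ^ k) ^ k' = z" using ex_inv by blast
      have "z ^ (p ^ j) = ((z ^ k) ^ k') ^ (p ^ j)" using k' m by simp
      also have "\<dots> = ((z ^ k) ^ (p ^ j)) ^ k'" by (metis mult.commute power_mult)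
      finally show False using 1 mj by simp
    qed
    thus ?thesis using count_eigenvalues_conjugate[OF A p Aq es, of "z ^ k" j z] m mj pk j by simp
  qed simp
  have "of_rat (tr (A ^\<^sub>m k)) = (\<Sum>x\<leftarrow>es. x ^ k)"
    using tr_pow_eigenvalues[OF cA es, of k] A by (simp add: tr_complex_mat[symmetric, of _ n] complex_mat_pow)
  also have "\<dots> = (\<Sum>z\<in>?R. of_nat (count_list es z) * z ^ k)" by (rule sum_eigenvalues[OF A p Aq es])
  also have "\<dots> = (\<Sum>z\<in>?R. of_nat (count_list es (z ^ k)) * z ^ k)" by (rule sum.cong) (use cnt in auto)
  also have "\<dots> = (\<Sum>z\<in>?R. of_nat (count_list es z) * z)"
    by (rule sum.reindex_bij_betw[OF bij, of "\<lambda>z. of_nat (count_list es z) * z"])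
  also have "\<dots> = (\<Sum>x\<leftarrow>es. x)" by (rule sum_eigenvalues[OF A p Aq es, symmetric])
  also have "\<dots> = of_rat (tr A)"
    using tr_pow_eigenvalues[OF cA es, of 1] A by (simp add: tr_complex_mat[symmetric, of _ n])
  finally show ?thesis by simp
qed

text \<open>Here a is the multiplicity of the eigenvalue 1 and b the common multiplicity of the p -
  1 other p-th roots of unity, which add up to - 1.\<close>

theorem tr_prime_order:
  fixes A :: "rat mat"
  assumes A: "A \<in> carrier_mat n n" and p: "Factorial_Ring.prime p" and Ap: "A ^\<^sub>m p = 1\<^sub>m n"
  shows "\<exists>a b. n = a + (p - 1) * b \<and> tr A = of_nat a - of_nat b"
proof -
  obtain es where es: "char_poly (complex_mat A) = (\<Prod>e\<leftarrow>es. [:- e, 1:])" using ex_eigenvalues[OF A] .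
  have cA: "complex_mat A \<in> carrier_mat n n" using A by simp
  have Aq: "A ^\<^sub>m (p ^ 1) = 1\<^sub>m n" using Ap by simp
  let ?R = "{z :: complex. z ^ p = 1}"
  have p1: "p > 1" using p by (rule prime_gt_1_nat)
  have fin: "finite ?R" using finite_roots_unity[of p] p1 by simp
  have card: "card ?R = p" using card_roots_unity_eq[of p] p1 by simp
  have "card (?R - {1}) = p - 1" using card fin by (simp add: card_Diff_singleton)
  then obtain w where w: "w \<in> ?R - {1}" using p1 by (metis all_not_in_conv card.empty diff_is_0_eq not_less)
  define b where "b = count_list es w"
  have cnt: "count_list es z = b" if "z \<in> ?R - {1}" for z
    unfolding b_def using count_eigenvalues_conjugate[OF A p Aq es, of z 0 w] that w by simp
  define a where "a = count_list es 1"
  have split: "(\<Sum>x\<leftarrow>es. f x) = of_nat a * f 1 + of_nat b * (\<Sum>z\<in>?R - {1}. f z)" for f :: "complex \<Rightarrow> complex"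
  proof -
    have "(\<Sum>x\<leftarrow>es. f x) = of_nat a * f 1 + (\<Sum>z\<in>?R - {1}. of_nat (count_list es z) * f z)"
      using sum_eigenvalues[OF A p Aq es, of f] sum.remove[OF fin, of 1 "\<lambda>z. of_nat (count_list es z) * f z"]
      by (simp add: a_def)
    thus ?thesis using cnt by (simp add: sum_distrib_left)
  qed
  have "of_nat n = (\<Sum>x\<leftarrow>es. (1::complex))" using length_eigenvalues[OF cA es] by (simp add: sum_list_triv)
  also have "\<dots> = of_nat (a + (p - 1) * b)" unfolding split using \<open>card (?R - {1}) = p - 1\<close> by simp
  finally have n: "n = a + (p - 1) * b" by (simp only: of_nat_eq_iff)
  have "of_rat (tr A) = (\<Sum>x\<leftarrow>es. x)"
    using tr_pow_eigenvalues[OF cA es, of 1] A by (simp add: tr_complex_mat[symmetric, of _ n])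
  hence "of_rat (tr A) = of_nat a + of_nat b * (\<Sum>z\<in>?R - {1}. z)" using split[of "\<lambda>x. x"] by simp
  also have "(\<Sum>z\<in>?R - {1}. z) = - 1"
    using sum_roots_unity[OF p1] sum.remove[OF fin, of 1 "\<lambda>z. z"] by (simp add: eq_neg_iff_add_eq_0 add.commute)
  finally have "of_rat (tr A) = (of_rat (of_nat a - of_nat b) :: complex)" by (simp add: of_rat_diff)
  hence "tr A = of_nat a - of_nat b" by (simp only: of_rat_eq_iff)
  with n show ?thesis by blast
qed

section \<open>The graded pieces\<close>

context group
begin

text \<open>For x in \<Gamma>^n, its class in degree n of the graded ring.\<close>

definition cls :: "nat \<Rightarrow> ('a \<Rightarrow> rat) \<Rightarrow> ('a \<Rightarrow> rat) set" where
  "cls n x = gamma_filtration G (n + 1) +>\<^bsub>char_ring G\<^esub> x"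

lemma gamma_filtration_antimono: "m \<le> n \<Longrightarrow> gamma_filtration G n \<subseteq> gamma_filtration G m"
  using Gam_mono by (auto simp: gamma_filtration_iff)

lemma abelian_subgroup_gamma_filtration:
  "abelian_subgroup (gamma_filtration G (n + 1)) ((char_ring G)\<lparr>carrier := gamma_filtration G n\<rparr>)"
proof -
  interpret R: cring "char_ring G" by (rule cring_char_ring)
  let ?A = "add_monoid (char_ring G)" and ?R = "(char_ring G)\<lparr>carrier := gamma_filtration G n\<rparr>"
  have eq: "add_monoid ?R = ?A\<lparr>carrier := gamma_filtration G n\<rparr>" by simp
  have g: "group (?A\<lparr>carrier := gamma_filtration G n\<rparr>)"
    by (rule subgroup.subgroup_is_group[OF gamma_filtration_subgroup R.a_group])
  have "comm_group (?A\<lparr>carrier := gamma_filtration G n\<rparr>)"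
    by (rule group.group_comm_groupI[OF g]) (auto intro!: R.a_comm gamma_filtration_carrier)
  hence ab: "abelian_group ?R" by (intro comm_group_abelian_groupI) (simp only: eq)
  have "subgroup (gamma_filtration G (n + 1)) (?A\<lparr>carrier := gamma_filtration G n\<rparr>)"
    by (rule group.subgroup_incl[OF R.a_group gamma_filtration_subgroup gamma_filtration_subgroup
          gamma_filtration_antimono]) simp
  hence "additive_subgroup (gamma_filtration G (n + 1)) ?R"
    by (intro additive_subgroup.intro) (simp only: eq)
  thus ?thesis using ab by (rule abelian_subgroupI3)
qed

lemma comm_group_graded_piece: "comm_group (graded_piece G n)"
  unfolding graded_piece_def
  by (rule abelian_subgroup.a_factorgroup_is_comm_group[OF abelian_subgroup_gamma_filtration])

lemma group_graded_piece: "group (graded_piece G n)"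
  using comm_group_graded_piece by (rule comm_group.axioms(2))

lemma a_r_coset_update: "H +>\<^bsub>(char_ring G)\<lparr>carrier := K\<rparr>\<^esub> x = H +>\<^bsub>char_ring G\<^esub> x"
  by (simp add: a_r_coset_def r_coset_def)

lemma carrier_graded_piece: "carrier (graded_piece G n) = cls n ` gamma_filtration G n"
  by (auto simp: graded_piece_def A_FactGroup_def' A_RCOSETS_def' a_r_coset_update cls_def)

lemma one_graded_piece: "\<one>\<^bsub>graded_piece G n\<^esub> = gamma_filtration G (n + 1)"
  by (simp add: graded_piece_def A_FactGroup_def')

lemma cls_mult:
  assumes "x \<in> gamma_filtration G n" "y \<in> gamma_filtration G n"
  shows "cls n x \<otimes>\<^bsub>graded_piece G n\<^esub> cls n y = cls n (x \<oplus>\<^bsub>char_ring G\<^esub> y)"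
  using abelian_subgroup.a_rcos_sum[OF abelian_subgroup_gamma_filtration, of x n y] assms
  by (simp add: graded_piece_def cls_def a_r_coset_update)

lemma cls_eq_iff:
  assumes "x \<in> gamma_filtration G n" "y \<in> gamma_filtration G n"
  shows "cls n x = cls n y \<longleftrightarrow> Gam (n + 1) (\<lambda>g. x g - y g)"
proof -
  interpret R: cring "char_ring G" by (rule cring_char_ring)
  interpret S: additive_subgroup "gamma_filtration G (n + 1)" "char_ring G"
    by (intro additive_subgroup.intro gamma_filtration_subgroup)
  have c: "x \<in> carrier (char_ring G)" "y \<in> carrier (char_ring G)" using assms gamma_filtration_carrier by auto
  interpret A: abelian_subgroup "gamma_filtration G (n + 1)" "char_ring G"
    by (rule abelian_subgroupI3) (rule S.additive_subgroup_axioms, rule R.abelian_group_axioms)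
  have "cls n x = cls n y \<longleftrightarrow> x \<in> cls n y"
    using A.a_rcos_self[OF c(1)] A.a_repr_independence'[OF _ c(2), of x] unfolding cls_def by auto
  also have "\<dots> \<longleftrightarrow> x \<ominus>\<^bsub>char_ring G\<^esub> y \<in> gamma_filtration G (n + 1)"
    unfolding cls_def by (rule A.a_rcos_module_minus[OF R.ring_axioms c(2) c(1)])
  also have "x \<ominus>\<^bsub>char_ring G\<^esub> y = (\<lambda>g\<in>carrier G. x g - y g)"
    unfolding a_minus_def char_ring_a_inv[OF c(2)] by (auto simp: char_ring_sel)
  finally show ?thesis unfolding Gam_def .
qed

lemma zero_in_gamma_filtration: "\<zero>\<^bsub>char_ring G\<^esub> \<in> gamma_filtration G n"
  using Gam_zero by (simp add: char_ring_sel Gam_def)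

lemma cls_zero: "cls n \<zero>\<^bsub>char_ring G\<^esub> = \<one>\<^bsub>graded_piece G n\<^esub>"
proof -
  interpret R: cring "char_ring G" by (rule cring_char_ring)
  show ?thesis unfolding one_graded_piece cls_def
    by (rule R.a_coset_add_zero) (use gamma_filtration_carrier in auto)
qed

lemma cls_eq_one_iff:
  assumes "x \<in> gamma_filtration G n"
  shows "cls n x = \<one>\<^bsub>graded_piece G n\<^esub> \<longleftrightarrow> Gam (n + 1) x"
proof -
  have "cls n x = \<one>\<^bsub>graded_piece G n\<^esub> \<longleftrightarrow> Gam (n + 1) (\<lambda>g. x g - \<zero>\<^bsub>char_ring G\<^esub> g)"
    unfolding cls_zero[symmetric] by (rule cls_eq_iff[OF assms zero_in_gamma_filtration])
  also have "\<dots> \<longleftrightarrow> Gam (n + 1) x" by (rule Gam_cong) (simp add: char_ring_sel)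
  finally show ?thesis .
qed

lemma trivial_graded_piece:
  assumes "\<And>f. Gam n f \<Longrightarrow> Gam (n + 1) f"
  shows "trivial_group (graded_piece G n)"
proof -
  have "cls n x = \<one>\<^bsub>graded_piece G n\<^esub>" if "x \<in> gamma_filtration G n" for x
    using cls_eq_one_iff[OF that] assms[OF gamma_filtration_Gam[OF that]] by simp
  hence "carrier (graded_piece G n) \<subseteq> {\<one>\<^bsub>graded_piece G n\<^esub>}"
    unfolding carrier_graded_piece by blast
  thus ?thesis using group.trivial_group_subset[OF group_graded_piece] by blast
qed

section \<open>Torsion in the graded ring\<close>

text \<open>Left multiplication permutes the group elements, enumerated by e; the trace of the
  permutation matrix counts fixed points, which exist for the identity only.\<close>

lemma vchar_regular:
  assumes fin: "finite (carrier G)"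
  shows "vchar (\<lambda>g. if g = \<one> then of_nat (card (carrier G)) else 0)"
proof -
  let ?N = "card (carrier G)"
  obtain e where e: "bij_betw e {0..<?N} (carrier G)" using ex_bij_betw_nat_finite[OF fin] by blast
  have ec: "e i \<in> carrier G" if "i < ?N" for i using e that by (auto simp: bij_betw_def)
  have ee: "e i = e j \<longleftrightarrow> i = j" if "i < ?N" "j < ?N" for i j
    using e that by (auto simp: bij_betw_def inj_on_def)
  define \<rho> where "\<rho> = (\<lambda>g. mat ?N ?N (\<lambda>(i, j). if g \<otimes> e j = e i then 1 else 0 :: rat))"
  have "rat_rep G ?N \<rho>" unfolding rat_rep_iff
  proof (intro conjI ballI)
    fix g h assume gh: "g \<in> carrier G" "h \<in> carrier G"
    show "\<rho> (g \<otimes> h) = \<rho> g * \<rho> h"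
    proof (rule eq_matI)
      fix i j assume "i < dim_row (\<rho> g * \<rho> h)" "j < dim_col (\<rho> g * \<rho> h)"
      hence ij: "i < ?N" "j < ?N" by (auto simp: \<rho>_def)
      have "h \<otimes> e j \<in> e ` {0..<?N}" using e gh ec[OF ij(2)] by (simp add: bij_betw_def)
      then obtain k where k: "k < ?N" "e k = h \<otimes> e j" by auto
      have "(\<rho> g * \<rho> h) $$ (i, j) = (\<Sum>l\<in>{0..<?N}. (if g \<otimes> e l = e i then 1 else 0) * (if h \<otimes> e j = e l then 1 else 0))"
        using ij by (simp add: \<rho>_def scalar_prod_def)
      also have "\<dots> = (\<Sum>l\<in>{0..<?N}. if k = l then (if g \<otimes> e k = e i then 1 else 0) else 0)"
        by (rule sum.cong) (use k ee in \<open>auto simp: k(2)[symmetric]\<close>)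
      also have "\<dots> = (if g \<otimes> e k = e i then 1 else 0)" using k(1) by simp
      also have "g \<otimes> e k = g \<otimes> h \<otimes> e j" using k(2) gh ec[OF ij(2)] by (simp add: m_assoc)
      finally show "\<rho> (g \<otimes> h) $$ (i, j) = (\<rho> g * \<rho> h) $$ (i, j)" using ij by (simp add: \<rho>_def)
    qed (auto simp: \<rho>_def)
  next
    show "\<rho> \<one> = 1\<^sub>m ?N" by (rule eq_matI) (auto simp: \<rho>_def ec ee)
  qed (simp add: \<rho>_def)
  hence "vchar (\<lambda>g. tr (\<rho> g))" by (rule vchar_rat_rep)
  moreover have "tr (\<rho> g) = (if g = \<one> then of_nat ?N else 0)" if g: "g \<in> carrier G" for g
  proof -
    have "g \<otimes> e i = e i \<longleftrightarrow> g = \<one>" if "i < ?N" for i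
      using g ec[OF that] by (metis l_one one_closed right_cancel)
    thus ?thesis by (simp add: tr_def \<rho>_def)
  qed
  ultimately show ?thesis
    using vchar_cong[of "\<lambda>g. tr (\<rho> g)" "\<lambda>g. if g = \<one> then of_nat ?N else 0"] by simp
qed

text \<open>The reason is that the regular character annihilates the augmentation ideal.\<close>

lemma Gam_card_mult:
  assumes fin: "finite (carrier G)" and f: "Gam n f" and n: "n > 0"
  shows "Gam (Suc n) (\<lambda>g. of_nat (card (carrier G)) * f g)"
proof -
  let ?N = "of_nat (card (carrier G)) :: rat"
  let ?u = "\<lambda>g. (if g = \<one> then ?N else 0) - ?N"
  have "Gam 1 ?u" by (rule Gam_1) (auto intro!: vchar_diff vchar_regular[OF fin] vchar_of_nat)
  from Gam_uminus[OF Gam_mult[OF this f]] have "Gam (Suc n) (\<lambda>g. - (?u g * f g))" by simp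
  thus ?thesis by (rule Gam_subst) (use Gam_at_one[OF f n] in auto)
qed

end

text \<open>A primitive root modulo p has multiplicative order p - 1.\<close>

lemma ex_coprime_power_not_cong:
  assumes p: "Factorial_Ring.prime p" and n: "\<not> (p - 1) dvd n"
  shows "\<exists>k::nat. coprime k p \<and> \<not> [k ^ n = 1] (mod p)"
proof -
  obtain k where "residue_primroot p k" using prime_primitive_root_exists[of p] p prime_gt_1_nat by blast
  hence k: "coprime p k" "Pocklington.ord p k = p - 1"
    using totient_prime[OF p] by (auto simp: residue_primroot_def)
  hence "\<not> [k ^ n = 1] (mod p)" using n ord_divides[of k n p] by simp
  thus ?thesis using k(1) by (auto simp: coprime_commute)
qed

section \<open>Adams operations on the graded ring of a p-group\<close>

locale p_group = group G for G :: "('a, 'b) monoid_scheme" (structure) +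
  fixes p e :: nat
  assumes prime: "Factorial_Ring.prime p" and order: "Coset.order G = p ^ e"
begin

lemma finite_carrier: "finite (carrier G)"
  using order prime_gt_0_nat[OF prime] by (intro card_ge_0_finite) (simp add: Coset.order_def)

text \<open>On rational characters of a \<open>p\<close>-group the Adams operation \<open>x \<mapsto> (g \<mapsto> x (g\<^sup>k))\<close> is the
  identity for \<open>k\<close> prime to \<open>p\<close>. It also acts as \<open>k\<^sup>n\<close> in degree \<open>n\<close> of the graded ring, so
  \<open>k\<^sup>n - 1\<close> annihilates that degree.\<close>

definition adams_eigen :: "nat \<Rightarrow> nat \<Rightarrow> ('a \<Rightarrow> rat) \<Rightarrow> bool" where
  "adams_eigen k n f \<longleftrightarrow> Gam n f \<and> Gam (Suc n) (\<lambda>g. of_nat (k ^ n) * f g - f g)"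

lemma adams_eigen_subst:
  assumes "adams_eigen k n h" "\<And>g. g \<in> carrier G \<Longrightarrow> f g = h g"
  shows "adams_eigen k n f"
  using assms(1) unfolding adams_eigen_def by (auto elim!: Gam_subst simp: assms(2))

text \<open>The error of the product is k^n (k^m f - f) h + f (k^n h - h), and each summand has one
  factor of higher filtration.\<close>

lemma adams_eigen_mult:
  assumes "adams_eigen k m f" "adams_eigen k n h"
  shows "adams_eigen k (m + n) (\<lambda>g. f g * h g)"
  unfolding adams_eigen_def
proof
  have f: "Gam m f" "Gam (Suc m) (\<lambda>g. of_nat (k ^ m) * f g - f g)"
    and h: "Gam n h" "Gam (Suc n) (\<lambda>g. of_nat (k ^ n) * h g - h g)" using assms by (auto simp: adams_eigen_def)
  show "Gam (m + n) (\<lambda>g. f g * h g)" by (rule Gam_mult[OF f(1) h(1)])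
  have "Gam (Suc (m + n)) (\<lambda>g. of_nat (k ^ n) * ((of_nat (k ^ m) * f g - f g) * h g))"
    using Gam_mult[OF f(2) h(1)] by (intro Gam_of_nat_mult) simp
  moreover have "Gam (Suc (m + n)) (\<lambda>g. f g * (of_nat (k ^ n) * h g - h g))"
    using Gam_mult[OF f(1) h(2)] by simp
  ultimately have "Gam (Suc (m + n)) (\<lambda>g. of_nat (k ^ n) * ((of_nat (k ^ m) * f g - f g) * h g) +
      f g * (of_nat (k ^ n) * h g - h g))" by (rule Gam_add)
  thus "Gam (Suc (m + n)) (\<lambda>g. of_nat (k ^ (m + n)) * (f g * h g) - f g * h g)"
    by (rule Gam_subst) (simp add: power_add algebra_simps)
qed

lemma adams_eigen_zero: "adams_eigen k n (\<lambda>_. 0)"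
  by (simp add: adams_eigen_def Gam_zero)

lemma adams_eigen_one: "adams_eigen k 0 (\<lambda>_. 1)"
  by (simp add: adams_eigen_def Gam_zero Gam_one)

lemma adams_eigen_add:
  assumes "adams_eigen k n f" "adams_eigen k n h"
  shows "adams_eigen k n (\<lambda>g. f g + h g)"
proof -
  have f: "Gam n f" "Gam (Suc n) (\<lambda>g. of_nat (k ^ n) * f g - f g)"
    and h: "Gam n h" "Gam (Suc n) (\<lambda>g. of_nat (k ^ n) * h g - h g)" using assms by (auto simp: adams_eigen_def)
  have "Gam (Suc n) (\<lambda>g. of_nat (k ^ n) * (f g + h g) - (f g + h g))"
    by (rule Gam_subst[OF Gam_add[OF f(2) h(2)]]) (simp add: algebra_simps)
  thus ?thesis using Gam_add[OF f(1) h(1)] by (simp add: adams_eigen_def)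
qed

lemma adams_eigen_uminus:
  assumes "adams_eigen k n f"
  shows "adams_eigen k n (\<lambda>g. - f g)"
proof -
  have f: "Gam n f" "Gam (Suc n) (\<lambda>g. of_nat (k ^ n) * f g - f g)" using assms by (auto simp: adams_eigen_def)
  have "Gam (Suc n) (\<lambda>g. of_nat (k ^ n) * (- f g) - (- f g))"
    by (rule Gam_subst[OF Gam_uminus[OF f(2)]]) simp
  thus ?thesis using Gam_uminus[OF f(1)] by (simp add: adams_eigen_def)
qed

lemma adams_eigen_sum: "(\<And>i. i \<in> A \<Longrightarrow> adams_eigen k n (f i)) \<Longrightarrow> adams_eigen k n (\<lambda>g. \<Sum>i\<in>A. f i g)"
  by (induction A rule: infinite_finite_induct) (auto intro: adams_eigen_zero adams_eigen_add)

lemma tr_rat_rep_pow: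
  assumes \<rho>: "rat_rep G d \<rho>" and k: "coprime k p" and g: "g \<in> carrier G"
  shows "tr (\<rho> (g [^] k)) = tr (\<rho> g)"
proof -
  have "\<rho> g ^\<^sub>m (p ^ e) = \<rho> (g [^] (p ^ e))" by (rule rat_rep_pow[OF \<rho> g, symmetric])
  also have "g [^] (p ^ e) = \<one>" using pow_order_eq_1[OF g] order by simp
  finally have "\<rho> g ^\<^sub>m (p ^ e) = 1\<^sub>m d" using rat_repD(3)[OF \<rho>] by simp
  from tr_pow_coprime[OF rat_repD(1)[OF \<rho> g] prime this k] show ?thesis by (simp add: rat_rep_pow[OF \<rho> g])
qed

lemma adams_eigen_rat_rep:
  assumes \<rho>: "rat_rep G d \<rho>" and k: "coprime k p"
  shows "adams_eigen k n (\<lambda>g. fps_nth (gam_ps (\<lambda>g. tr (\<rho> g) - of_nat d) g) n)"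
proof -
  have "vchar (\<lambda>g. tr (\<rho> g) - of_nat d)" by (intro vchar_diff vchar_rat_rep[OF \<rho>] vchar_of_nat)
  moreover have "tr (\<rho> \<one>) - of_nat d = 0" using rat_repD(3)[OF \<rho>] by (simp add: tr_def)
  ultimately show ?thesis unfolding adams_eigen_def
    using gam_ps_rat_rep_congruence[OF \<rho>, of k n] tr_rat_rep_pow[OF \<rho> k] by (simp add: Gam_gam_ps)
qed

text \<open>The recursion for the inverse series expresses coefficient n through products of total
  index n, so the eigenvalue k^n persists.\<close>

lemma adams_eigen_gam_ps_uminus:
  assumes "\<And>n. adams_eigen k n (\<lambda>g. fps_nth (gam_ps y g) n)"
  shows "adams_eigen k n (\<lambda>g. fps_nth (gam_ps (\<lambda>g. - y g) g) n)"
proof (induction n rule: less_induct)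
  case (less n)
  show ?case
  proof (cases n)
    case 0
    thus ?thesis using adams_eigen_one by simp
  next
    case (Suc m)
    have "adams_eigen k n (\<lambda>g. fps_nth (gam_ps y g) (Suc i) * fps_nth (gam_ps (\<lambda>g. - y g) g) (m - i))"
      if "i \<in> {0..m}" for i
      using adams_eigen_mult[OF assms[of "Suc i"] less[of "m - i"]] that Suc by auto
    hence "adams_eigen k n (\<lambda>g. - (\<Sum>i=0..m. fps_nth (gam_ps y g) (Suc i) * fps_nth (gam_ps (\<lambda>g. - y g) g) (m - i)))"
      by (intro adams_eigen_uminus adams_eigen_sum)
    thus ?thesis unfolding Suc fps_inverse_nth_Suc[OF gam_ps_uminus gam_ps_nth_0] .
  qed
qed

lemma adams_eigen_gam_ps:
  assumes x: "vchar x" "x \<one> = 0" and k: "coprime k p"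
  shows "adams_eigen k n (\<lambda>g. fps_nth (gam_ps x g) n)"
proof -
  obtain d \<rho> d' \<sigma> where 1: "rat_rep G d \<rho>" "rat_rep G d' \<sigma>"
    "\<forall>g\<in>carrier G. x g = tr (\<rho> g) - tr (\<sigma> g)" by (rule vcharE[OF x(1)])
  have "x \<one> = of_nat d - of_nat d'" using 1(3) rat_repD(3)[OF 1(1)] rat_repD(3)[OF 1(2)] by (simp add: tr_def)
  \<comment> \<open>Augmentation 0 forces equal degrees, so x is the difference of the two elements
    \<rho> - d and \<sigma> - d of augmentation 0.\<close>
  hence d: "d' = d" using x(2) by simp
  let ?x = "\<lambda>g. tr (\<rho> g) - of_nat d" and ?y = "\<lambda>g. tr (\<sigma> g) - of_nat d'"
  have "gam_ps x g = gam_ps ?x g * gam_ps (\<lambda>g. - ?y g) g" if "g \<in> carrier G" for g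
    unfolding gam_ps_add[symmetric] by (rule gam_ps_cong) (use 1(3) d that in auto)
  hence eq: "fps_nth (gam_ps x g) n = (\<Sum>i=0..n. fps_nth (gam_ps ?x g) i * fps_nth (gam_ps (\<lambda>g. - ?y g) g) (n - i))"
    if "g \<in> carrier G" for g using that by (simp add: fps_mult_nth)
  have "adams_eigen k n (\<lambda>g. fps_nth (gam_ps ?x g) i * fps_nth (gam_ps (\<lambda>g. - ?y g) g) (n - i))"
    if "i \<in> {0..n}" for i
    using adams_eigen_mult[OF adams_eigen_rat_rep[OF 1(1) k, of i]
        adams_eigen_gam_ps_uminus[OF adams_eigen_rat_rep[OF 1(2) k], of "n - i"]] that by auto
  hence "adams_eigen k n (\<lambda>g. \<Sum>i=0..n. fps_nth (gam_ps ?x g) i * fps_nth (gam_ps (\<lambda>g. - ?y g) g) (n - i))"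
    by (rule adams_eigen_sum)
  thus ?thesis by (rule adams_eigen_subst) (rule eq)
qed

lemma adams_eigen_gamma_product:
  assumes k: "coprime k p"
  shows "snd ` set ps \<subseteq> augmentation_ideal G \<Longrightarrow> adams_eigen k (sum_list (map fst ps)) (gamma_product G ps)"
proof (induction ps)
  case Nil
  show ?case unfolding gamma_product_Nil by (rule adams_eigen_subst[OF _ restrict_apply']) (simp add: adams_eigen_one)
next
  case (Cons q ps)
  obtain i x where q: "q = (i, x)" by (cases q)
  hence x: "x \<in> augmentation_ideal G" using Cons.prems by auto
  hence "adams_eigen k i (\<lambda>g. fps_nth (gam_ps x g) i)"
    by (intro adams_eigen_gam_ps k vchar_carrier) (auto simp: augmentation_ideal_iff)
  from adams_eigen_mult[OF this Cons.IH] Cons.prems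
  have "adams_eigen k (i + sum_list (map fst ps)) (\<lambda>g. fps_nth (gam_ps x g) i * gamma_product G ps g)" by simp
  moreover have "sum_list (map fst (q # ps)) = i + sum_list (map fst ps)" by (simp add: q)
  ultimately show ?case
    by (simp only:) (erule adams_eigen_subst, simp add: q gamma_product_Cons[OF x])
qed

text \<open>A generator of weight exactly n is an eigenvector for k^n; one of larger weight lies in
  \<Gamma>^(n+1) already.\<close>

lemma Gam_adams:
  assumes k: "coprime k p" and f: "Gam n f"
  shows "Gam (Suc n) (\<lambda>g. of_nat (k ^ n) * f g - f g)"
  using f
proof (induction rule: Gam_induct)
  case (product ps)
  note a = adams_eigen_gamma_product[OF k product(1), unfolded adams_eigen_def]
  show ?case
  proof (cases "sum_list (map fst ps) = n")
    case False
    hence "Suc n \<le> sum_list (map fst ps)" using product(2) by simp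
    hence "Gam (Suc n) (gamma_product G ps)" by (rule Gam_mono[OF conjunct1[OF a]])
    thus ?thesis by (intro Gam_diff Gam_of_nat_mult)
  next
    case True
    show ?thesis using conjunct2[OF a] unfolding True .
  qed
next
  case (add f h)
  show ?case by (rule Gam_subst[OF Gam_add[OF add]]) (simp add: algebra_simps)
next
  case (uminus f)
  show ?case by (rule Gam_subst[OF Gam_uminus[OF uminus]]) simp
next
  case (cong f h)
  show ?case by (rule Gam_subst[OF cong(1)]) (simp add: cong(2))
qed (simp add: Gam_zero)

theorem trivial_graded_piece_p_group:
  assumes n: "\<not> (p - 1) dvd n"
  shows "trivial_group (graded_piece G n)"
proof (rule trivial_graded_piece)
  fix f assume f: "Gam n f"
  have n0: "n > 0" using n by (cases n) auto
  obtain k where k: "coprime k p" "\<not> [k ^ n = 1] (mod p)"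
    using ex_coprime_power_not_cong[OF prime n] by blast
  have "\<not> int p dvd int (k ^ n) - 1"
    using k(2) cong_int_iff[of "k ^ n" 1 p] by (simp add: cong_iff_dvd_diff)
  hence "coprime (int (k ^ n) - 1) (int p)"
    using prime Factorial_Ring.prime_imp_coprime[of "int p" "int (k ^ n) - 1"]
    by (subst coprime_commute) simp
  hence "coprime (int (k ^ n) - 1) (int (p ^ e))" by simp
  \<comment> \<open>Both k^n - 1 and the order p^e move f into \<Gamma>^(n+1); being coprime, they
    combine to 1.\<close>
  then obtain a b where ab: "a * (int (k ^ n) - 1) + b * int (p ^ e) = 1"
    using bezout_int[of "int (k ^ n) - 1" "int (p ^ e)"] by (metis coprime_imp_gcd_eq_1)
  have "Gam (Suc n) (\<lambda>g. of_int a * (of_nat (k ^ n) * f g - f g))"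
    using Gam_adams[of k n f] k(1) f by (intro Gam_of_int_mult) simp
  moreover have "Gam (Suc n) (\<lambda>g. of_int b * (of_nat (p ^ e) * f g))"
    using Gam_card_mult[OF finite_carrier f n0] order by (intro Gam_of_int_mult) (simp add: Coset.order_def)
  ultimately have "Gam (Suc n) (\<lambda>g. of_int a * (of_nat (k ^ n) * f g - f g) + of_int b * (of_nat (p ^ e) * f g))"
    by (rule Gam_add)
  thus "Gam (n + 1) f" unfolding Suc_eq_plus1
  proof (rule Gam_subst)
    fix g
    have "of_int a * (of_nat (k ^ n) * f g - f g) + of_int b * (of_nat (p ^ e) * f g) =
      of_int (a * (int (k ^ n) - 1) + b * int (p ^ e)) * f g" by (simp add: algebra_simps)
    thus "f g = of_int a * (of_nat (k ^ n) * f g - f g) + of_int b * (of_nat (p ^ e) * f g)" unfolding ab by simp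
  qed
qed

end

section \<open>Groups of prime order\<close>

text \<open>For q > 0 this is i / q rounded up.\<close>

definition cdiv :: "nat \<Rightarrow> nat \<Rightarrow> nat" where
  "cdiv q i = (i + q - 1) div q"

text \<open>The adjunction that characterizes rounding up; the other properties are
  consequences.\<close>

lemma cdiv_le_iff: "q > 0 \<Longrightarrow> cdiv q i \<le> k \<longleftrightarrow> i \<le> k * q"
proof -
  assume q: "q > 0"
  have "cdiv q i \<le> k \<longleftrightarrow> (i + q - 1) div q < Suc k" by (auto simp: cdiv_def)
  also have "\<dots> \<longleftrightarrow> i + q - 1 < Suc k * q" using q by (rule div_less_iff_less_mult)
  also have "\<dots> \<longleftrightarrow> i \<le> k * q" using q by auto
  finally show ?thesis .
qed

lemma cdiv_add: "q > 0 \<Longrightarrow> cdiv q (i + j) \<le> cdiv q i + cdiv q j"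
  using cdiv_le_iff[of q i "cdiv q i"] cdiv_le_iff[of q j "cdiv q j"] by (simp add: cdiv_le_iff distrib_right add_mono)

lemma cdiv_0 [simp]: "q > 0 \<Longrightarrow> cdiv q 0 = 0"
  using cdiv_le_iff[of q 0 0] by simp

lemma cdiv_mono: "q > 0 \<Longrightarrow> i \<le> j \<Longrightarrow> cdiv q i \<le> cdiv q j"
  using cdiv_le_iff[of q j "cdiv q j"] by (simp add: cdiv_le_iff)

lemma cdiv_mult [simp]: "q > 0 \<Longrightarrow> cdiv q (k * q) = k"
  using cdiv_le_iff[of q "k * q"] by (intro antisym) auto

lemma cdiv_mult_Suc: "q > 0 \<Longrightarrow> cdiv q (Suc (k * q)) = Suc k"
proof -
  assume q: "q > 0"
  have "cdiv q (Suc (k * q)) \<le> Suc k" "\<not> cdiv q (Suc (k * q)) \<le> k" using q by (auto simp: cdiv_le_iff)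
  thus ?thesis by simp
qed

lemma cdiv_pos: "q > 0 \<Longrightarrow> i > 0 \<Longrightarrow> cdiv q i > 0"
  using cdiv_le_iff[of q i 0] by (metis gr0I le_zero_eq mult_zero_left not_less_zero)

text \<open>The condition is closed under products because rounding up is subadditive, and under
  inverses of series with constant term 1 by the recursion; it therefore passes from u to all its
  integer multiples.\<close>

definition padic_fps :: "nat \<Rightarrow> rat fps \<Rightarrow> bool" where
  "padic_fps p F \<longleftrightarrow> (\<forall>i. \<exists>c::int. fps_nth F i = of_int c * of_nat p ^ cdiv (p - 1) i)"

lemma padic_fps_nth_mult:
  assumes p: "p > 1" and "\<exists>c::int. a = of_int c * of_nat p ^ cdiv (p - 1) i" "\<exists>c::int. b = of_int c * of_nat p ^ cdiv (p - 1) j"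
  shows "\<exists>c::int. a * b = of_int c * (of_nat p :: rat) ^ cdiv (p - 1) (i + j)"
proof -
  obtain c d :: int where cd: "a = of_int c * of_nat p ^ cdiv (p - 1) i" "b = of_int d * of_nat p ^ cdiv (p - 1) j"
    using assms by blast
  obtain k where k: "cdiv (p - 1) i + cdiv (p - 1) j = cdiv (p - 1) (i + j) + k"
    using cdiv_add[of "p - 1" i j] p le_Suc_ex by auto
  have "a * b = of_int (c * d) * (of_nat p ^ (cdiv (p - 1) i + cdiv (p - 1) j))"
    by (simp add: cd power_add)
  also have "\<dots> = of_int (c * d * int p ^ k) * of_nat p ^ cdiv (p - 1) (i + j)"
    unfolding k power_add by simp
  finally show ?thesis by blast
qed

lemma padic_nth_sum:
  assumes "\<And>i. i \<in> A \<Longrightarrow> \<exists>c::int. f i = of_int c * (b :: rat)"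
  shows "\<exists>c::int. sum f A = of_int c * b"
  using assms
proof (induction A rule: infinite_finite_induct)
  case (insert x A)
  obtain c :: int where "f x = of_int c * b" using insert.prems by blast
  moreover obtain d :: int where "sum f A = of_int d * b" using insert.IH insert.prems by blast
  ultimately show ?case by (intro exI[of _ "c + d"]) (use insert.hyps in \<open>simp add: distrib_right\<close>)
qed (auto intro: exI[of _ 0])

lemma padic_fps_mult:
  assumes p: "p > 1" and "padic_fps p F" "padic_fps p H"
  shows "padic_fps p (F * H)"
  unfolding padic_fps_def fps_mult_nth
proof (intro allI padic_nth_sum)
  fix n i :: nat assume "i \<in> {0..n}"
  thus "\<exists>c::int. fps_nth F i * fps_nth H (n - i) = of_int c * of_nat p ^ cdiv (p - 1) n"
    using padic_fps_nth_mult[OF p, of "fps_nth F i" i "fps_nth H (n - i)" "n - i"] assms by (auto simp: padic_fps_def)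
qed

lemma padic_fps_one: "p > 1 \<Longrightarrow> padic_fps p 1"
  unfolding padic_fps_def
proof
  fix i assume "p > 1"
  thus "\<exists>c::int. fps_nth 1 i = of_int c * of_nat p ^ cdiv (p - 1) i"
    by (cases i) (auto intro: exI[of _ 1] exI[of _ 0])
qed

lemma padic_fps_power: "p > 1 \<Longrightarrow> padic_fps p F \<Longrightarrow> padic_fps p (F ^ n)"
  by (induction n) (auto intro: padic_fps_one padic_fps_mult)

lemma padic_fps_inverse:
  assumes p: "p > 1" and F: "padic_fps p F" and FH: "F * H = 1" "fps_nth F 0 = 1"
  shows "padic_fps p H"
proof -
  have "\<exists>c::int. fps_nth H n = of_int c * of_nat p ^ cdiv (p - 1) n" for n
  proof (induction n rule: less_induct)
    case (less n)
    show ?case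
    proof (cases n)
      case 0
      have "fps_nth (F * H) 0 = 1" unfolding FH(1) by simp
      hence "fps_nth H 0 = 1" using FH(2) by (simp only: fps_mult_nth_0 mult_1)
      thus ?thesis using 0 p by (intro exI[of _ 1]) simp
    next
      case (Suc m)
      have "\<exists>c::int. (\<Sum>i=0..m. fps_nth F (Suc i) * fps_nth H (m - i)) = of_int c * of_nat p ^ cdiv (p - 1) n"
      proof (rule padic_nth_sum)
        fix i assume i: "i \<in> {0..m}"
        hence "Suc i + (m - i) = n" using Suc by simp
        thus "\<exists>c::int. fps_nth F (Suc i) * fps_nth H (m - i) = of_int c * of_nat p ^ cdiv (p - 1) n"
          using padic_fps_nth_mult[OF p, of "fps_nth F (Suc i)" "Suc i" "fps_nth H (m - i)" "m - i"]
            F less[of "m - i"] Suc by (auto simp: padic_fps_def)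
      qed
      then obtain c :: int where "(\<Sum>i=0..m. fps_nth F (Suc i) * fps_nth H (m - i)) = of_int c * of_nat p ^ cdiv (p - 1) n" by blast
      hence "fps_nth H n = of_int (- c) * of_nat p ^ cdiv (p - 1) n"
        unfolding Suc fps_inverse_nth_Suc[OF FH] by simp
      thus ?thesis by blast
    qed
  qed
  thus ?thesis by (simp add: padic_fps_def)
qed

locale prime_order_group = p_group G p 1 for G :: "('a, 'b) monoid_scheme" (structure) and p
begin

lemma p_gt_1: "p > 1"
  using prime by (rule prime_gt_1_nat)

lemma card_carrier: "card (carrier G) = p"
  using order by (simp add: Coset.order_def)

section \<open>Characters of a group of prime order\<close>

lemma pow_eq_one_iff:
  assumes g: "g \<in> carrier G" "g \<noteq> \<one>"
  shows "g [^] (m::nat) = \<one> \<longleftrightarrow> p dvd m"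
proof -
  have "ord g dvd p" using ord_dvd_group_order[OF g(1)] order by simp
  moreover have "ord g \<noteq> 1" using ord_eq_1[OF g(1)] g(2) by simp
  ultimately have "ord g = p" using prime by (auto simp: prime_nat_iff)
  thus ?thesis using pow_eq_id[OF g(1), of m] by simp
qed

text \<open>A nontrivial element has order p, so its powers exhaust the group; the exponent is prime
  to p since h is not the identity.\<close>

lemma ex_pow:
  assumes g: "g \<in> carrier G" "g \<noteq> \<one>" and h: "h \<in> carrier G" "h \<noteq> \<one>"
  shows "\<exists>k::nat. coprime k p \<and> h = g [^] k"
proof -
  have inj: "inj_on (\<lambda>k::nat. g [^] k) {..<p}"
  proof (rule linorder_inj_onI)
    fix k l :: nat assume kl: "k < l" "k \<in> {..<p}" "l \<in> {..<p}"
    show "g [^] k \<noteq> g [^] l"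
    proof
      assume "g [^] k = g [^] l"
      moreover have "g [^] l = g [^] k \<otimes> g [^] (l - k)" using kl g by (simp add: nat_pow_mult)
      ultimately have "g [^] k \<otimes> g [^] (l - k) = g [^] k \<otimes> \<one>" using g by simp
      hence "g [^] (l - k) = \<one>" using g by simp
      hence "p dvd l - k" using pow_eq_one_iff[OF g] by simp
      thus False using kl by (auto dest: dvd_imp_le)
    qed
  qed auto
  have "(\<lambda>k::nat. g [^] k) ` {..<p} = carrier G"
    by (rule card_subset_eq[OF finite_carrier]) (use g inj card_carrier in \<open>auto simp: card_image\<close>)
  then obtain k where k: "k < p" "h = g [^] k" using h(1) by auto
  have "\<not> p dvd k" using pow_eq_one_iff[OF g, of k] k(2) h(2) by simp
  hence "coprime k p" using prime Factorial_Ring.prime_imp_coprime[of p k] by (simp add: coprime_commute)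
  thus ?thesis using k by blast
qed

definition u :: "'a \<Rightarrow> rat" where
  "u g = (if g = \<one> then 0 else - of_nat p)"

lemma ex_nontrivial: "\<exists>g\<in>carrier G. g \<noteq> \<one>"
proof (rule ccontr)
  assume "\<not> (\<exists>g\<in>carrier G. g \<noteq> \<one>)"
  hence "carrier G \<subseteq> {\<one>}" by auto
  hence "card (carrier G) \<le> 1" using card_mono[of "{\<one>}" "carrier G"] by simp
  thus False using card_carrier p_gt_1 by simp
qed

lemma vchar_u: "vchar u"
proof -
  have "vchar (\<lambda>g. (if g = \<one> then of_nat (card (carrier G)) else 0) - of_nat p)"
    by (intro vchar_diff vchar_regular[OF finite_carrier] vchar_of_nat)
  thus ?thesis by (subst vchar_cong[of u "\<lambda>g. (if g = \<one> then of_nat (card (carrier G)) else 0) - of_nat p"])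
     (auto simp: u_def card_carrier)
qed

text \<open>Off the identity the trace is a - b with d = a + (p - 1) b, hence d - p b; all
  nontrivial elements give the same value because they are powers of h with exponents prime to
  p.\<close>

lemma tr_rat_rep:
  assumes \<rho>: "rat_rep G d \<rho>"
  shows "\<exists>b::int. \<forall>g\<in>carrier G. tr (\<rho> g) = of_nat d + of_int b * u g"
proof -
  obtain h where h: "h \<in> carrier G" "h \<noteq> \<one>" using ex_nontrivial by blast
  have "\<rho> h ^\<^sub>m p = \<rho> (h [^] p)" by (rule rat_rep_pow[OF \<rho> h(1), symmetric])
  also have "\<dots> = 1\<^sub>m d" using pow_eq_one_iff[OF h, of p] rat_repD(3)[OF \<rho>] by simp
  finally obtain a b where ab: "d = a + (p - 1) * b" "tr (\<rho> h) = of_nat a - of_nat b"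
    using tr_prime_order[OF rat_repD(1)[OF \<rho> h(1)] prime] by blast
  have "tr (\<rho> g) = of_nat d + of_int (int b) * u g" if g: "g \<in> carrier G" for g
  proof (cases "g = \<one>")
    case True
    thus ?thesis using rat_repD(3)[OF \<rho>] by (simp add: u_def tr_def)
  next
    case False
    obtain k where k: "coprime k p" "g = h [^] k" using ex_pow[OF h g False] by blast
    have "tr (\<rho> g) = of_nat a - of_nat b" using tr_rat_rep_pow[OF \<rho> k(1) h(1)] k(2) ab(2) by simp
    moreover have "rat_of_nat d = of_nat a + (of_nat p - 1) * of_nat b" using ab(1) p_gt_1 by (simp add: of_nat_diff)
    ultimately show ?thesis using False by (simp add: u_def algebra_simps)
  qed
  thus ?thesis by blast
qed

lemma vchar_eq:
  assumes "vchar f"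
  shows "\<exists>a b::int. \<forall>g\<in>carrier G. f g = of_int a + of_int b * u g"
proof -
  obtain d \<rho> d' \<sigma> where 1: "rat_rep G d \<rho>" "rat_rep G d' \<sigma>"
    "\<forall>g\<in>carrier G. f g = tr (\<rho> g) - tr (\<sigma> g)" by (rule vcharE[OF assms])
  obtain b b' :: int where b: "\<forall>g\<in>carrier G. tr (\<rho> g) = of_nat d + of_int b * u g"
    "\<forall>g\<in>carrier G. tr (\<sigma> g) = of_nat d' + of_int b' * u g"
    using tr_rat_rep[OF 1(1)] tr_rat_rep[OF 1(2)] by blast
  have "\<forall>g\<in>carrier G. f g = of_int (int d - int d') + of_int (b - b') * u g"
    using 1(3) b by (simp add: algebra_simps)
  thus ?thesis by blast
qed

lemma vchar_augmentation_eq: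
  assumes "vchar f" "f \<one> = 0"
  shows "\<exists>b::int. \<forall>g\<in>carrier G. f g = of_int b * u g"
proof -
  obtain a b :: int where ab: "\<forall>g\<in>carrier G. f g = of_int a + of_int b * u g" using vchar_eq[OF assms(1)] by blast
  hence "f \<one> = of_int a" by (simp add: u_def)
  hence "a = 0" using assms(2) by simp
  thus ?thesis using ab by auto
qed

text \<open>Off the identity the regular representation has all p-th roots of unity \<zeta> as
  eigenvalues, and the product of the 1 + \<zeta> t is 1 - (- t)^p. The proof checks the
  differential equation for the power sums, which are p or 0.\<close>

lemma lam_ps_regular:
  assumes g: "g \<in> carrier G" "g \<noteq> \<one>"
  shows "lam_ps (\<lambda>g. if g = \<one> then of_nat p else 0) g = 1 - (- fps_X) ^ p"
proof -
  define s where "s = (\<lambda>m. if p dvd m then of_nat p else 0 :: rat)"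
  have "lam_ps (\<lambda>g. if g = \<one> then of_nat p else 0) g = exp_fps (psum_fps s)"
    unfolding lam_ps_def s_def using pow_eq_one_iff[OF g] by simp
  also have "\<dots> = 1 - (- fps_X) ^ p"
  proof (rule exp_fps_eqI)
    have X: "(- fps_X :: rat fps) ^ n = fps_const ((- 1) ^ n) * fps_X ^ n" for n
      by (simp add: power_minus[of fps_X] fps_const_power[symmetric] flip: fps_const_neg)
    have d: "fps_deriv (1 - (- fps_X) ^ p) = of_nat p * (- fps_X :: rat fps) ^ (p - 1)"
      by (simp add: fps_deriv_power fps_const_neg[symmetric] fps_of_nat del: fps_const_neg)
    show "fps_deriv (1 - (- fps_X) ^ p) = (1 - (- fps_X) ^ p) * psum_fps s"
    proof (rule fps_ext)
      fix m
      have R: "fps_nth ((1 - (- fps_X) ^ p) * psum_fps s) m =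
        (- 1) ^ m * s (Suc m) - (if m < p then 0 else (- 1) ^ p * ((- 1) ^ (m - p) * s (Suc (m - p))))"
        unfolding X by (simp add: left_diff_distrib mult.assoc psum_fps_def fps_X_power_mult_nth)
      have L: "fps_nth (of_nat p * (- fps_X :: rat fps) ^ (p - 1)) m = (if m = p - 1 then of_nat p * (- 1) ^ m else 0)"
        unfolding X by (simp add: fps_of_nat[symmetric] fps_X_power_nth del: fps_of_nat)
      show "fps_nth (fps_deriv (1 - (- fps_X) ^ p)) m = fps_nth ((1 - (- fps_X) ^ p) * psum_fps s) m"
      proof (cases "m < p")
        case True
        have "p dvd Suc m \<longleftrightarrow> m = p - 1" using True p_gt_1 by (auto dest: dvd_imp_le)
        thus ?thesis unfolding d L R using True by (simp add: s_def)
      next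
        case False
        have "s (Suc m) = s (Suc (m - p))" using False dvd_diff_nat[of p "Suc m" p] dvd_add[of p "Suc (m - p)" p]
          by (auto simp: s_def Suc_diff_le)
        moreover have "(- 1 :: rat) ^ p * (- 1) ^ (m - p) = (- 1) ^ m" using False by (simp flip: power_add)
        ultimately show ?thesis unfolding d L R using False p_gt_1 by (simp add: mult.assoc[symmetric])
      qed
    qed
  qed (use p_gt_1 in \<open>simp add: fps_nth_power_0\<close>)
  finally show ?thesis .
qed

lemma gam_ps_u:
  assumes g: "g \<in> carrier G" "g \<noteq> \<one>"
  shows "gam_ps u g = (1 - fps_X) ^ p - (- fps_X) ^ p"
proof -
  let ?r = "\<lambda>g. if g = \<one> then of_nat p else 0 :: rat"
  have "gam_ps ?r g = gam_ps u g * gam_ps (\<lambda>_. of_nat p) g"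
    unfolding gam_ps_add[symmetric] by (rule gam_ps_cong) (use g in \<open>auto simp: u_def\<close>)
  moreover have "gam_ps (\<lambda>_. of_nat p) g * (1 - fps_X) ^ p = 1"
  proof -
    have "gam_ps (\<lambda>_. of_nat p) g = fps_compose (1 + fps_X) shift_fps ^ p"
      by (simp add: gam_ps_def lam_ps_def exp_fps_const fps_compose_power)
    thus ?thesis by (simp only: power_mult_distrib[symmetric] shift_compose_one_plus_X power_one)
  qed
  ultimately have "gam_ps u g = gam_ps ?r g * (1 - fps_X) ^ p" by (simp add: mult.assoc)
  have "fps_compose ((- fps_X) ^ p) shift_fps = fps_compose (- fps_X :: rat fps) shift_fps ^ p"
    by (simp add: fps_compose_power)
  moreover have "fps_compose (- fps_X) shift_fps = (- shift_fps :: rat fps)"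
    unfolding fps_compose_uminus by simp
  ultimately have comp: "fps_compose ((- fps_X) ^ p) shift_fps = (- shift_fps :: rat fps) ^ p" by (simp only:)
  note \<open>gam_ps u g = gam_ps ?r g * (1 - fps_X) ^ p\<close>
  also have "gam_ps ?r g = 1 - (- shift_fps) ^ p"
    unfolding gam_ps_def lam_ps_regular[OF g]
    by (simp add: fps_compose_sub_distrib comp)
  also have "(1 - (- shift_fps) ^ p) * (1 - fps_X) ^ p = (1 - fps_X) ^ p - (- (shift_fps * (1 - fps_X :: rat fps))) ^ p"
    unfolding left_diff_distrib mult_1 power_mult_distrib[symmetric] by simp
  finally show ?thesis by (simp only: shift_fps_mult)
qed

text \<open>The two terms in t^p cancel, so the series stops at degree p - 1.\<close>

lemma gam_ps_u_nth:
  assumes g: "g \<in> carrier G" "g \<noteq> \<one>"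
  shows "fps_nth (gam_ps u g) i = (if i < p then (- 1) ^ i * of_nat (p choose i) else 0)"
proof -
  have X: "(- fps_X :: rat fps) ^ n = fps_const ((- 1) ^ n) * fps_X ^ n" for n
    by (simp add: power_minus[of fps_X] fps_const_power[symmetric] flip: fps_const_neg)
  have "(1 - fps_X :: rat fps) ^ p = (\<Sum>k\<le>p. of_nat (p choose k) * (- fps_X) ^ k)"
    using binomial_ring[of "- fps_X :: rat fps" 1 p] by simp
  hence "fps_nth ((1 - fps_X :: rat fps) ^ p) i =
      (\<Sum>k\<le>p. of_nat (p choose k) * ((- 1) ^ k * (if i = k then 1 else 0)))"
    unfolding X by (simp only: fps_sum_nth) (simp add: fps_of_nat[symmetric] fps_X_power_nth del: fps_of_nat)
  also have "\<dots> = (\<Sum>k\<le>p. if k = i then (- 1) ^ i * of_nat (p choose i) else 0)"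
    by (rule sum.cong) auto
  finally have "fps_nth ((1 - fps_X :: rat fps) ^ p) i = (if i \<le> p then (- 1) ^ i * of_nat (p choose i) else 0)"
    by simp
  thus ?thesis unfolding gam_ps_u[OF g] X by (auto simp: fps_X_power_nth)
qed

lemma padic_gam_ps_u:
  assumes g: "g \<in> carrier G"
  shows "padic_fps p (gam_ps u g)"
proof (cases "g = \<one>")
  case True
  thus ?thesis using gam_ps_one_eq_1[of u] padic_fps_one[OF p_gt_1] by (simp add: u_def)
next
  case False
  show ?thesis unfolding padic_fps_def
  proof
    fix i
    show "\<exists>c::int. fps_nth (gam_ps u g) i = of_int c * of_nat p ^ cdiv (p - 1) i"
    proof (cases "i = 0 \<or> i \<ge> p")
      case True
      thus ?thesis using p_gt_1 by (auto simp: gam_ps_u_nth[OF g False] intro: exI[of _ 1] exI[of _ 0])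
    next
      case i: False
      hence "p dvd (p choose i)" using prime by (intro dvd_choose_prime) auto
      then obtain m where m: "p choose i = p * m" by auto
      \<comment> \<open>For 0 < i < p the required power of p is the first, and p divides the
        binomial coefficient.\<close>
      have "cdiv (p - 1) i \<le> 1" "cdiv (p - 1) i > 0" using i p_gt_1 cdiv_pos[of "p - 1" i] by (auto simp: cdiv_le_iff)
      hence "cdiv (p - 1) i = 1" by simp
      thus ?thesis using i m by (intro exI[of _ "(- 1) ^ i * int m"]) (simp add: gam_ps_u_nth[OF g False])
    qed
  qed
qed

text \<open>x is an integer multiple of u, so its series is a power of that of u or the inverse of
  such a power.\<close>

lemma padic_gam_ps:
  assumes x: "vchar x" "x \<one> = 0" and g: "g \<in> carrier G"
  shows "padic_fps p (gam_ps x g)"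
proof -
  obtain b :: int where b: "\<forall>g\<in>carrier G. x g = of_int b * u g" using vchar_augmentation_eq[OF x] by blast
  have pow: "gam_ps (\<lambda>g. of_nat n * u g) g = gam_ps u g ^ n" for n
  proof (induction n)
    case (Suc n)
    have "(\<lambda>g. of_nat (Suc n) * u g) = (\<lambda>g. u g + of_nat n * u g)" by (simp add: fun_eq_iff distrib_right)
    thus ?case using Suc by (simp add: gam_ps_add)
  qed simp
  have nonneg: "padic_fps p (gam_ps (\<lambda>g. of_nat n * u g) g)" for n
    unfolding pow by (rule padic_fps_power[OF p_gt_1 padic_gam_ps_u[OF g]])
  show ?thesis
  proof (cases "b \<ge> 0")
    case True
    have "gam_ps x g = gam_ps (\<lambda>g. of_nat (nat b) * u g) g" by (rule gam_ps_cong) (use b g True in auto)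
    thus ?thesis using nonneg by simp
  next
    case False
    have "gam_ps x g = gam_ps (\<lambda>g. - (of_nat (nat (- b)) * u g)) g" by (rule gam_ps_cong) (use b g False in auto)
    thus ?thesis using padic_fps_inverse[OF p_gt_1 nonneg gam_ps_uminus gam_ps_nth_0] by simp
  qed
qed

lemma gamma_product_padic:
  assumes "snd ` set ps \<subseteq> augmentation_ideal G" "g \<in> carrier G"
  shows "\<exists>c::int. gamma_product G ps g = of_int c * of_nat p ^ cdiv (p - 1) (sum_list (map fst ps))"
  using assms(1)
proof (induction ps)
  case Nil
  show ?case using assms(2) p_gt_1 by (intro exI[of _ 1]) (simp add: gamma_product_Nil)
next
  case (Cons q ps)
  obtain i x where q: "q = (i, x)" by (cases q)
  hence x: "x \<in> augmentation_ideal G" using Cons.prems by auto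
  hence "padic_fps p (gam_ps x g)"
    by (intro padic_gam_ps assms(2) vchar_carrier) (auto simp: augmentation_ideal_iff)
  hence "\<exists>c::int. fps_nth (gam_ps x g) i = of_int c * of_nat p ^ cdiv (p - 1) i" by (simp add: padic_fps_def)
  from padic_fps_nth_mult[OF p_gt_1 this Cons.IH] Cons.prems assms(2) show ?case
    by (simp add: q gamma_product_Cons[OF x])
qed

section \<open>The gamma filtration of a group of prime order\<close>

lemma u_power_Suc: "u g ^ Suc k = (- of_nat p) ^ k * u g"
  by (cases k) (simp_all add: u_def)

text \<open>Off the identity \<gamma>^(p-1)(u) is (- 1)^(p-1) p, so u is its own image under this
  operation, up to the sign (- 1)^p.\<close>

lemma Gam_u: "Gam (p - 1) u"
proof -
  have G: "Gam (p - 1) (\<lambda>g. of_int ((- 1) ^ p) * fps_nth (gam_ps u g) (p - 1))"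
    by (intro Gam_of_int_mult Gam_gam_ps vchar_u) (simp add: u_def)
  have "u g = of_int ((- 1) ^ p) * fps_nth (gam_ps u g) (p - 1)" if g: "g \<in> carrier G" for g
  proof (cases "g = \<one>")
    case True
    thus ?thesis using gam_ps_one_eq_1[of u] p_gt_1 by (simp add: u_def)
  next
    case False
    obtain m where m: "p = Suc m" using p_gt_1 by (cases p) auto
    have c: "p choose (p - Suc 0) = p" unfolding m by simp
    have "(- 1 :: rat) ^ p * (- 1) ^ (p - 1) = - 1" unfolding m by (simp flip: power_add power_mult_distrib)
    hence "of_int ((- 1) ^ p) * ((- 1) ^ (p - 1) * rat_of_nat p) = - of_nat p" by (simp add: mult.assoc[symmetric])
    thus ?thesis using p_gt_1 by (simp add: gam_ps_u_nth[OF g False] c u_def False)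
  qed
  with G show ?thesis by (rule Gam_subst)
qed

lemma Gam_u_power: "Gam (k * (p - 1)) (\<lambda>g. u g ^ k)"
proof (induction k)
  case 0
  show ?case using Gam_one by simp
next
  case (Suc k)
  from Gam_mult[OF Gam_u this] show ?case by simp
qed

text \<open>With m + 1 = n / (p - 1) rounded up, u^(m+1) = (- p)^m u lies in \<Gamma>^n. Conversely
  a generator is b u for an integer b, and its value - b p at a nontrivial element is divisible by
  p^(m+1), so p^m divides b.\<close>

lemma Gam_iff:
  assumes n: "n > 0"
  shows "Gam n f \<longleftrightarrow> (\<exists>c::int. \<forall>g\<in>carrier G. f g = of_int c * of_nat p ^ (cdiv (p - 1) n - 1) * u g)"
proof
  define m where "m = cdiv (p - 1) n - 1"
  have m: "cdiv (p - 1) n = Suc m" using cdiv_pos[of "p - 1" n] n p_gt_1 by (simp add: m_def)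
  assume "\<exists>c::int. \<forall>g\<in>carrier G. f g = of_int c * of_nat p ^ (cdiv (p - 1) n - 1) * u g"
  then obtain c :: int where c: "\<forall>g\<in>carrier G. f g = of_int c * of_nat p ^ m * u g" by (auto simp: m_def)
  have "n \<le> Suc m * (p - 1)" using cdiv_le_iff[of "p - 1" n "Suc m"] m p_gt_1 by simp
  with Gam_u_power[of "Suc m"] have "Gam n (\<lambda>g. u g ^ Suc m)" by (rule Gam_mono)
  hence "Gam n (\<lambda>g. of_int (c * (- 1) ^ m) * u g ^ Suc m)" by (rule Gam_of_int_mult)
  thus "Gam n f"
  proof (rule Gam_subst)
    fix g assume "g \<in> carrier G"
    have "(- of_nat p :: rat) ^ m = (- 1) ^ m * of_nat p ^ m" by (rule power_minus)
    moreover have "(- 1 :: rat) ^ m * (- 1) ^ m = 1" by (simp flip: power_mult_distrib)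
    ultimately show "f g = of_int (c * (- 1) ^ m) * u g ^ Suc m"
      using c \<open>g \<in> carrier G\<close> by (simp only: u_power_Suc of_int_mult of_int_power of_int_minus of_int_1) (simp add: mult.assoc mult.left_commute)
  qed
next
  define m where "m = cdiv (p - 1) n - 1"
  have m: "cdiv (p - 1) n = Suc m" using cdiv_pos[of "p - 1" n] n p_gt_1 by (simp add: m_def)
  assume "Gam n f"
  hence "\<exists>c::int. \<forall>g\<in>carrier G. f g = of_int c * of_nat p ^ m * u g"
  proof (induction rule: Gam_induct)
    case (product ps)
    have G: "Gam n (gamma_product G ps)" by (rule Gam_product[OF product])
    obtain b :: int where b: "\<forall>g\<in>carrier G. gamma_product G ps g = of_int b * u g"
      using vchar_augmentation_eq[OF Gam_vchar[OF G] Gam_at_one[OF G n]] by blast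
    obtain h where h: "h \<in> carrier G" "h \<noteq> \<one>" using ex_nontrivial by blast
    obtain c :: int where c: "gamma_product G ps h = of_int c * of_nat p ^ cdiv (p - 1) (sum_list (map fst ps))"
      using gamma_product_padic[OF product(1) h(1)] by blast
    have "cdiv (p - 1) n \<le> cdiv (p - 1) (sum_list (map fst ps))" using p_gt_1 product(2) by (intro cdiv_mono) auto
    then obtain k where k: "cdiv (p - 1) (sum_list (map fst ps)) = Suc m + k" using m le_Suc_ex by metis
    have "of_int b * (- of_nat p) = of_int c * (of_nat p :: rat) ^ (Suc m + k)"
      using b h c k by (simp add: u_def)
    hence "of_int b * of_nat p = of_int (- c * int p ^ k) * (of_nat p :: rat) ^ m * of_nat p"
      by (simp add: power_add algebra_simps eq_neg_iff_add_eq_0 neg_eq_iff_add_eq_0)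
    hence "of_int b = of_int (- c * int p ^ k) * (of_nat p :: rat) ^ m"
      by (rule mult_right_cancel[THEN iffD1, rotated]) (use p_gt_1 in simp)
    thus ?case using b by (intro exI[of _ "- c * int p ^ k"]) simp
  next
    case zero
    show ?case by (intro exI[of _ 0]) simp
  next
    case (add f h)
    then obtain c d :: int where "\<forall>g\<in>carrier G. f g = of_int c * of_nat p ^ m * u g"
      "\<forall>g\<in>carrier G. h g = of_int d * of_nat p ^ m * u g" by blast
    thus ?case by (intro exI[of _ "c + d"]) (simp add: distrib_right)
  next
    case (uminus f)
    then obtain c :: int where "\<forall>g\<in>carrier G. f g = of_int c * of_nat p ^ m * u g" by blast
    thus ?case by (intro exI[of _ "- c"]) simp
  next
    case (cong f h)
    thus ?case by auto
  qed
  thus "\<exists>c::int. \<forall>g\<in>carrier G. f g = of_int c * of_nat p ^ (cdiv (p - 1) n - 1) * u g" by (simp add: m_def)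
qed

text \<open>For k > 0, c u^k is up to sign c p^(k-1) u, while \<Gamma> in degree k (p - 1) + 1
  consists of the multiples of p^k u, as rounding up jumps just after k (p - 1). For k = 0 elements
  of \<Gamma>^1 vanish at the identity.\<close>

lemma Gam_multiple_iff:
  "Gam (k * (p - 1) + 1) (\<lambda>g. of_int c * u g ^ k) \<longleftrightarrow> (if k = 0 then c = 0 else int p dvd c)"
proof (cases k)
  case 0
  have "Gam 1 (\<lambda>_. of_int c) \<longleftrightarrow> c = 0"
    using Gam_at_one[of 1 "\<lambda>_. of_int c"] Gam_zero[of 1] by auto
  thus ?thesis using 0 by simp
next
  case (Suc m)
  obtain h where h: "h \<in> carrier G" "h \<noteq> \<one>" using ex_nontrivial by blast
  have w: "cdiv (p - 1) (k * (p - 1) + 1) - 1 = k" using cdiv_mult_Suc[of "p - 1" k] p_gt_1 by simp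
  have sgn: "(- 1 :: rat) ^ m * (- 1) ^ m = 1" by (simp flip: power_mult_distrib)
  have pm: "(- of_nat p :: rat) ^ m = (- 1) ^ m * of_nat p ^ m" by (rule power_minus)
  have pos: "k * (p - 1) + 1 > 0" by simp
  have "Gam (k * (p - 1) + 1) (\<lambda>g. of_int c * u g ^ k) \<longleftrightarrow>
    (\<exists>d::int. \<forall>g\<in>carrier G. of_int c * u g ^ k = of_int d * of_nat p ^ k * u g)"
    by (simp only: Gam_iff[OF pos] w)
  also have "\<dots> \<longleftrightarrow> int p dvd c"
  proof
    assume "\<exists>d::int. \<forall>g\<in>carrier G. of_int c * u g ^ k = of_int d * of_nat p ^ k * u g"
    then obtain d :: int where "of_int c * u h ^ k = of_int d * of_nat p ^ k * u h" using h by blast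
    hence "of_int c * ((- 1) ^ m * of_nat p ^ m) * u h = of_int d * (of_nat p * of_nat p ^ m) * u h"
      unfolding Suc u_power_Suc pm by (simp only: mult.assoc power_Suc)
    moreover have "u h \<noteq> 0" "(of_nat p :: rat) ^ m \<noteq> 0" using h p_gt_1 by (auto simp: u_def)
    ultimately have "of_int c * (- 1) ^ m = (of_int d * of_nat p :: rat)" using p_gt_1 by simp
    hence "of_int c * ((- 1) ^ m * (- 1) ^ m) = (of_int d * of_nat p * (- 1) ^ m :: rat)" by (simp only: mult.assoc[symmetric])
    hence "of_int c = (of_int (d * int p * (- 1) ^ m) :: rat)" unfolding sgn by simp
    hence "c = d * int p * (- 1) ^ m" by (simp only: of_int_eq_iff)
    thus "int p dvd c" by simp
  next
    assume "int p dvd c"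
    then obtain d where d: "c = int p * d" by auto
    have "of_int c * u g ^ k = of_int (d * (- 1) ^ m) * of_nat p ^ k * u g" for g
      unfolding Suc u_power_Suc pm by (simp add: d mult.assoc mult.left_commute)
    thus "\<exists>d::int. \<forall>g\<in>carrier G. of_int c * u g ^ k = of_int d * of_nat p ^ k * u g" by blast
  qed
  finally show ?thesis using Suc by simp
qed

text \<open>In degree k (p - 1) with k > 0 the filtration consists of the multiples of p^(k-1) u,
  that is of u^k; for k = 0 the constant part of f is taken.\<close>

lemma Gam_representative:
  assumes "Gam (k * (p - 1)) f"
  shows "\<exists>c::int. Gam (k * (p - 1) + 1) (\<lambda>g. f g - of_int c * u g ^ k)"
proof (cases k)
  case 0
  obtain a b :: int where ab: "\<forall>g\<in>carrier G. f g = of_int a + of_int b * u g" using vchar_eq[OF Gam_vchar[OF assms]] by blast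
  have "Gam 1 (\<lambda>g. of_int b * u g)" by (intro Gam_of_int_mult Gam_1 vchar_u) (simp add: u_def)
  hence "Gam 1 (\<lambda>g. f g - of_int a)" by (rule Gam_subst) (use ab in simp)
  thus ?thesis using 0 by auto
next
  case (Suc m)
  have "k * (p - 1) > 0" using Suc p_gt_1 by simp
  from Gam_iff[OF this] assms obtain c :: int where
    c: "\<forall>g\<in>carrier G. f g = of_int c * of_nat p ^ (cdiv (p - 1) (k * (p - 1)) - 1) * u g" by blast
  have w: "cdiv (p - 1) (k * (p - 1)) - 1 = m" using Suc p_gt_1 by (subst cdiv_mult) auto
  have "f g - of_int (c * (- 1) ^ m) * u g ^ k = 0" if "g \<in> carrier G" for g
  proof -
    have "(- of_nat p :: rat) ^ m = (- 1) ^ m * of_nat p ^ m" by (rule power_minus)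
    moreover have "(- 1 :: rat) ^ m * (- 1) ^ m = 1" by (simp flip: power_mult_distrib)
    ultimately have "of_int (c * (- 1) ^ m) * u g ^ k = of_int c * of_nat p ^ m * u g"
      unfolding Suc u_power_Suc by (simp add: mult.assoc mult.left_commute)
    thus ?thesis using c[rule_format, OF that, unfolded w] by (simp only: diff_self)
  qed
  hence "Gam (k * (p - 1) + 1) (\<lambda>g. f g - of_int (c * (- 1) ^ m) * u g ^ k)"
    by (rule Gam_subst[OF Gam_zero])
  thus ?thesis by blast
qed

end

section \<open>The graded ring of a group of prime order\<close>

lemma up_int_iff: "f \<in> carrier (UP \<Z>) \<longleftrightarrow> (\<exists>n. \<forall>k>n. f k = 0)"
  by (auto simp: UP_def up_def bound_def int_zero_eq int_carrier_eq)

lemma UP_int_sel: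
  assumes "f \<in> carrier (UP \<Z>)"
  shows "up_ring.coeff (UP \<Z>) f k = f k"
    and "h \<in> carrier (UP \<Z>) \<Longrightarrow> (f \<oplus>\<^bsub>UP \<Z>\<^esub> h) k = f k + h k"
    and "h \<in> carrier (UP \<Z>) \<Longrightarrow> (f \<otimes>\<^bsub>UP \<Z>\<^esub> h) k = (\<Sum>i\<le>k. f i * h (k - i))"
  using assms int_finsum_eq by (simp_all add: UP_def int_add_eq)

lemma UP_int_one: "\<one>\<^bsub>UP \<Z>\<^esub> = (\<lambda>i. if i = 0 then 1 else 0)"
  and UP_int_zero: "\<zero>\<^bsub>UP \<Z>\<^esub> = (\<lambda>i. 0)"
  and UP_int_monom: "up_ring.monom (UP \<Z>) c n = (\<lambda>i. if i = n then c else 0)"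
  by (simp_all add: UP_def fun_eq_iff)

lemma cring_UP_int: "cring (UP \<Z>)"
  by (rule UP_cring.UP_cring, rule UP_cring.intro, rule int_is_cring)

text \<open>Multiplication by p x shifts the coefficients up by one and scales them by p.\<close>

lemma ideal_px_iff:
  "f \<in> ideal_px p \<longleftrightarrow> f \<in> carrier (UP \<Z>) \<and> f 0 = 0 \<and> (\<forall>k>0. int p dvd f k)"
proof -
  let ?m = "up_ring.monom (UP \<Z>) (int p) 1"
  have m: "?m \<in> carrier (UP \<Z>)" by (auto simp: up_int_iff UP_int_monom intro: exI[of _ 1])
  have mult: "(h \<otimes>\<^bsub>UP \<Z>\<^esub> ?m) k = (case k of 0 \<Rightarrow> 0 | Suc j \<Rightarrow> h j * int p)" if h: "h \<in> carrier (UP \<Z>)" for h k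
  proof -
    have "(h \<otimes>\<^bsub>UP \<Z>\<^esub> ?m) k = (\<Sum>i\<le>k. if Suc i = k then h i * int p else 0)"
      unfolding UP_int_sel(3)[OF h m] by (rule sum.cong) (auto simp: UP_int_monom)
    also have "\<dots> = (case k of 0 \<Rightarrow> 0 | Suc j \<Rightarrow> h j * int p)"
      by (cases k) (auto intro: sum.neutral)
    finally show ?thesis .
  qed
  interpret U: cring "UP \<Z>" by (rule cring_UP_int)
  show ?thesis
  proof
    assume "f \<in> ideal_px p"
    then obtain h where h: "h \<in> carrier (UP \<Z>)" "f = h \<otimes>\<^bsub>UP \<Z>\<^esub> ?m" by (auto simp: ideal_px_def cgenideal_def)
    show "f \<in> carrier (UP \<Z>) \<and> f 0 = 0 \<and> (\<forall>k>0. int p dvd f k)"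
    proof (intro conjI allI impI)
      show "f \<in> carrier (UP \<Z>)" using h m by simp
      show "f 0 = 0" using mult[OF h(1), of 0] h(2) by simp
      show "int p dvd f k" if "k > 0" for k using mult[OF h(1), of k] h(2) that by (cases k) auto
    qed
  next
    assume f: "f \<in> carrier (UP \<Z>) \<and> f 0 = 0 \<and> (\<forall>k>0. int p dvd f k)"
    define h where "h = (\<lambda>k. f (Suc k) div int p)"
    obtain n where "\<forall>k>n. f k = 0" using f unfolding up_int_iff by blast
    hence "\<forall>k>n. h k = 0" by (simp add: h_def)
    hence h: "h \<in> carrier (UP \<Z>)" unfolding up_int_iff by blast
    have "f = h \<otimes>\<^bsub>UP \<Z>\<^esub> ?m"
    proof
      fix k show "f k = (h \<otimes>\<^bsub>UP \<Z>\<^esub> ?m) k"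
        unfolding mult[OF h] using f by (cases k) (auto simp: h_def)
    qed
    thus "f \<in> ideal_px p" using h by (auto simp: ideal_px_def cgenideal_def)
  qed
qed

section \<open>Sums and products of classes\<close>

context group
begin

text \<open>The union in \<open>rcoset_mult\<close> runs over all representatives h + x and k + y;
  since (h + x) (k + y) - x y = h (k + y) + x k lies in \<Gamma>^(n+1), all of them give one
  coset.\<close>

lemma rcoset_mult_cls:
  assumes x: "x \<in> gamma_filtration G i" and y: "y \<in> gamma_filtration G (n - i)" and i: "i \<le> n"
  shows "rcoset_mult (char_ring G) (gamma_filtration G (n + 1)) (cls i x) (cls (n - i) y) =
    cls n (x \<otimes>\<^bsub>char_ring G\<^esub> y)"
proof -
  let ?R = "char_ring G"
  have mem: "a \<in> cls j z \<longleftrightarrow> (\<exists>h\<in>gamma_filtration G (j + 1). a = h \<oplus>\<^bsub>?R\<^esub> z)" for a j z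
    by (auto simp: cls_def a_r_coset_def r_coset_def)
  have mult: "Gam n (x \<otimes>\<^bsub>?R\<^esub> y)" if "Gam i x" "Gam (n - i) y" for x y
    using Gam_mult[OF that] i unfolding char_ring_sel Gam_restrict by simp
  have xy: "x \<otimes>\<^bsub>?R\<^esub> y \<in> gamma_filtration G n"
    using mult[OF gamma_filtration_Gam[OF x] gamma_filtration_Gam[OF y]] by (simp add: gamma_filtration_iff char_ring_sel)
  have eq: "gamma_filtration G (n + 1) +>\<^bsub>?R\<^esub> (a \<otimes>\<^bsub>?R\<^esub> b) = cls n (x \<otimes>\<^bsub>?R\<^esub> y)" if a: "a \<in> cls i x" and b: "b \<in> cls (n - i) y" for a b
  proof -
    obtain h where h: "h \<in> gamma_filtration G (i + 1)" "a = h \<oplus>\<^bsub>?R\<^esub> x" using a mem by blast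
    obtain k where k: "k \<in> gamma_filtration G (n - i + 1)" "b = k \<oplus>\<^bsub>?R\<^esub> y" using b mem by blast
    note Gs = gamma_filtration_Gam[OF x] gamma_filtration_Gam[OF y] gamma_filtration_Gam[OF h(1)] gamma_filtration_Gam[OF k(1)]
    have b': "Gam (n - i) (\<lambda>g. k g + y g)" by (intro Gam_add Gs(2) Gam_mono[OF Gs(4)]) simp
    have 1: "Gam (n + 1) (\<lambda>g. h g * (k g + y g))" using Gam_mult[OF Gs(3) b'] i by simp
    have 2: "Gam (n + 1) (\<lambda>g. x g * k g)" using Gam_mult[OF Gs(1,4)] i by simp
    have "Gam (n + 1) (\<lambda>g. (a \<otimes>\<^bsub>?R\<^esub> b) g - (x \<otimes>\<^bsub>?R\<^esub> y) g)"
      by (rule Gam_subst[OF Gam_add[OF 1 2]]) (simp add: h(2) k(2) char_ring_sel algebra_simps)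
    moreover have "a \<otimes>\<^bsub>?R\<^esub> b \<in> gamma_filtration G n"
    proof -
      have "Gam i (\<lambda>g. h g + x g)" by (intro Gam_add Gs(1) Gam_mono[OF Gs(3)]) simp
      from Gam_mult[OF this b'] i have "Gam n (\<lambda>g. (h g + x g) * (k g + y g))" by simp
      hence "Gam n (a \<otimes>\<^bsub>?R\<^esub> b)" by (rule Gam_subst) (simp add: h(2) k(2) char_ring_sel)
      thus ?thesis by (simp add: gamma_filtration_iff char_ring_sel)
    qed
    ultimately show ?thesis using cls_eq_iff[OF _ xy] by (simp add: cls_def)
  qed
  have self: "z \<in> cls j z" if "z \<in> gamma_filtration G j" for j z
  proof -
    have "z = \<zero>\<^bsub>?R\<^esub> \<oplus>\<^bsub>?R\<^esub> z" using that by (auto simp: char_ring_sel gamma_filtration_iff fun_eq_iff extensional_def)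
    thus ?thesis using mem zero_in_gamma_filtration by blast
  qed
  show ?thesis unfolding rcoset_mult_def using eq self[OF x] self[OF y] by blast
qed

lemma finprod_graded_piece_cls:
  assumes "finite A" "\<And>i. i \<in> A \<Longrightarrow> x i \<in> gamma_filtration G n"
  shows "finprod (graded_piece G n) (\<lambda>i. cls n (x i)) A = cls n (\<lambda>g\<in>carrier G. \<Sum>i\<in>A. x i g)"
proof -
  interpret P: comm_group "graded_piece G n" by (rule comm_group_graded_piece)
  show ?thesis using assms
  proof (induction A)
    case empty
    show ?case unfolding P.finprod_empty sum.empty using cls_zero[of n] unfolding char_ring_sel by (rule sym)
  next
    case (insert a A)
    have s: "(\<lambda>g\<in>carrier G. \<Sum>i\<in>A. x i g) \<in> gamma_filtration G n"
      using insert.prems by (simp add: gamma_filtration_iff Gam_sum gamma_filtration_Gam)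
    have "finprod (graded_piece G n) (\<lambda>i. cls n (x i)) (insert a A) =
        cls n (x a) \<otimes>\<^bsub>graded_piece G n\<^esub> cls n (\<lambda>g\<in>carrier G. \<Sum>i\<in>A. x i g)"
    proof -
      have "finprod (graded_piece G n) (\<lambda>i. cls n (x i)) A = cls n (\<lambda>g\<in>carrier G. \<Sum>i\<in>A. x i g)"
        by (rule insert.IH) (rule insert.prems, rule insertI2)
      moreover have "finprod (graded_piece G n) (\<lambda>i. cls n (x i)) (insert a A) =
          cls n (x a) \<otimes>\<^bsub>graded_piece G n\<^esub> finprod (graded_piece G n) (\<lambda>i. cls n (x i)) A"
        by (rule P.finprod_insert[OF insert.hyps]) (use insert.prems in \<open>auto simp: carrier_graded_piece\<close>)
      ultimately show ?thesis by (rule subst)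
    qed
    also have "\<dots> = cls n (x a \<oplus>\<^bsub>char_ring G\<^esub> (\<lambda>g\<in>carrier G. \<Sum>i\<in>A. x i g))"
      by (rule cls_mult) (use insert.prems s in auto)
    also have "x a \<oplus>\<^bsub>char_ring G\<^esub> (\<lambda>g\<in>carrier G. \<Sum>i\<in>A. x i g) = (\<lambda>g\<in>carrier G. \<Sum>i\<in>insert a A. x i g)"
      using insert.hyps by (auto simp: char_ring_sel)
    finally show ?case .
  qed
qed

lemma graded_char_ring_sel:
  "carrier (graded_char_ring G) =
     {a. (\<forall>n. a n \<in> carrier (graded_piece G n)) \<and> finite {n. a n \<noteq> \<one>\<^bsub>graded_piece G n\<^esub>}}"
  "(a \<oplus>\<^bsub>graded_char_ring G\<^esub> b) n = a n \<otimes>\<^bsub>graded_piece G n\<^esub> b n"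
  "\<zero>\<^bsub>graded_char_ring G\<^esub> n = \<one>\<^bsub>graded_piece G n\<^esub>"
  using carrier_sum_group[of UNIV "graded_piece G", OF group_graded_piece]
  by (auto simp: graded_char_ring_def PiE_def Pi_def extensional_def)

end

context prime_order_group
begin

declare One_nat_def [simp del]

text \<open>The representative of degree \<open>n\<close> of the image of the polynomial \<open>f\<close>: since \<open>u\<close> lies in degree
  \<open>p - 1\<close>, the coefficient of \<open>x\<^sup>k\<close> goes to degree \<open>k (p - 1)\<close>.\<close>

definition rep_elt :: "nat \<Rightarrow> (nat \<Rightarrow> int) \<Rightarrow> 'a \<Rightarrow> rat" where
  "rep_elt n f = (\<lambda>g\<in>carrier G. if (p - 1) dvd n then of_int (f (n div (p - 1))) * u g ^ (n div (p - 1)) else 0)"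

definition to_graded :: "(nat \<Rightarrow> int) \<Rightarrow> nat \<Rightarrow> ('a \<Rightarrow> rat) set" where
  "to_graded f n = cls n (rep_elt n f)"

lemma rep_elt_in: "rep_elt n f \<in> gamma_filtration G n"
proof -
  have "Gam n (\<lambda>g. if (p - 1) dvd n then of_int (f (n div (p - 1))) * u g ^ (n div (p - 1)) else 0)"
  proof (cases "(p - 1) dvd n")
    case True
    hence "n div (p - 1) * (p - 1) = n" by simp
    thus ?thesis using Gam_of_int_mult[OF Gam_u_power[of "n div (p - 1)"]] True by simp
  qed (simp add: Gam_zero)
  thus ?thesis by (simp add: gamma_filtration_iff rep_elt_def del: Gam_restrict) (simp only: Gam_restrict)
qed

text \<open>The kernel, degree by degree: only the coefficient k with n = k (p - 1) contributes in
  degree n, and there \<open>Gam_multiple_iff\<close> decides.\<close>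

lemma to_graded_eq_one_iff:
  "to_graded f n = \<one>\<^bsub>graded_piece G n\<^esub> \<longleftrightarrow>
     (\<forall>k. n = k * (p - 1) \<longrightarrow> (if k = 0 then f k = 0 else int p dvd f k))"
proof -
  have "to_graded f n = \<one>\<^bsub>graded_piece G n\<^esub> \<longleftrightarrow> Gam (n + 1) (rep_elt n f)"
    unfolding to_graded_def by (rule cls_eq_one_iff[OF rep_elt_in])
  also have "\<dots> \<longleftrightarrow> (\<forall>k. n = k * (p - 1) \<longrightarrow> (if k = 0 then f k = 0 else int p dvd f k))"
  proof (cases "(p - 1) dvd n")
    case True
    then obtain k where k: "n = k * (p - 1)" by (metis dvdE mult.commute)
    have q: "n div (p - 1) = k" "k' * (p - 1) = n \<longleftrightarrow> k' = k" for k' using k p_gt_1 by auto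
    have "Gam (n + 1) (rep_elt n f) \<longleftrightarrow> Gam (k * (p - 1) + 1) (\<lambda>g. of_int (f k) * u g ^ k)"
      unfolding k[symmetric] by (rule Gam_cong) (simp only: rep_elt_def restrict_apply if_P True q(1))
    thus ?thesis unfolding Gam_multiple_iff using q(2) by (metis k)
  next
    case False
    have "Gam (n + 1) (rep_elt n f)" by (rule Gam_subst[OF Gam_zero]) (simp add: rep_elt_def False)
    thus ?thesis using False by auto
  qed
  finally show ?thesis .
qed

lemma to_graded_carrier:
  assumes "f \<in> carrier (UP \<Z>)"
  shows "to_graded f \<in> carrier (graded_char_ring G)"
proof -
  obtain N where N: "\<And>k. k > N \<Longrightarrow> f k = 0" using assms by (auto simp: up_int_iff)
  have "{n. to_graded f n \<noteq> \<one>\<^bsub>graded_piece G n\<^esub>} \<subseteq> (\<lambda>k. k * (p - 1)) ` {..N}"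
  proof
    fix n assume "n \<in> {n. to_graded f n \<noteq> \<one>\<^bsub>graded_piece G n\<^esub>}"
    then obtain k where k: "n = k * (p - 1)" "\<not> (if k = 0 then f k = 0 else int p dvd f k)"
      unfolding to_graded_eq_one_iff by blast
    hence "k \<le> N" using N[of k] by (cases "k \<le> N") (auto split: if_splits)
    thus "n \<in> (\<lambda>k. k * (p - 1)) ` {..N}" using k(1) by blast
  qed
  hence "finite {n. to_graded f n \<noteq> \<one>\<^bsub>graded_piece G n\<^esub>}" by (rule finite_subset) simp
  thus ?thesis using rep_elt_in by (auto simp: graded_char_ring_sel carrier_graded_piece to_graded_def)
qed

lemma to_graded_add:
  assumes "f \<in> carrier (UP \<Z>)" "h \<in> carrier (UP \<Z>)"
  shows "to_graded (f \<oplus>\<^bsub>UP \<Z>\<^esub> h) = to_graded f \<oplus>\<^bsub>graded_char_ring G\<^esub> to_graded h"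
proof
  fix n
  have "rep_elt n f \<oplus>\<^bsub>char_ring G\<^esub> rep_elt n h = rep_elt n (f \<oplus>\<^bsub>UP \<Z>\<^esub> h)"
    by (auto simp: rep_elt_def char_ring_sel fun_eq_iff UP_int_sel(2)[OF assms(1,2)] distrib_right)
  thus "to_graded (f \<oplus>\<^bsub>UP \<Z>\<^esub> h) n = (to_graded f \<oplus>\<^bsub>graded_char_ring G\<^esub> to_graded h) n"
    unfolding graded_char_ring_sel(2) to_graded_def cls_mult[OF rep_elt_in rep_elt_in] by simp
qed

text \<open>Only indices i divisible by p - 1 contribute, and for n = k (p - 1) the powers of u then
  combine to u^k, so the convolution over i becomes that of the coefficients of f and h.\<close>

lemma sum_rep_elt:
  assumes f: "f \<in> carrier (UP \<Z>)" and h: "h \<in> carrier (UP \<Z>)" and g: "g \<in> carrier G"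
  shows "(\<Sum>i\<le>n. rep_elt i f g * rep_elt (n - i) h g) = rep_elt n (f \<otimes>\<^bsub>UP \<Z>\<^esub> h) g"
proof (cases "(p - 1) dvd n")
  case False
  have "rep_elt i f g * rep_elt (n - i) h g = 0" if "i \<le> n" for i
  proof (cases "(p - 1) dvd i \<and> (p - 1) dvd (n - i)")
    case True
    hence "(p - 1) dvd i + (n - i)" by (intro dvd_add) auto
    thus ?thesis using False that by simp
  qed (use g in \<open>auto simp: rep_elt_def\<close>)
  hence "(\<Sum>i\<le>n. rep_elt i f g * rep_elt (n - i) h g) = 0" by (intro sum.neutral) simp
  also have "0 = rep_elt n (f \<otimes>\<^bsub>UP \<Z>\<^esub> h) g" using False g by (simp add: rep_elt_def)
  finally show ?thesis .
next
  case True
  have q: "p - 1 > 0" using p_gt_1 by simp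
  obtain k where k: "n = k * (p - 1)" using True by (metis dvdE mult.commute)
  have rep: "rep_elt (j * (p - 1)) F g = of_int (F j) * u g ^ j" for j F
    using g q by (simp add: rep_elt_def)
  have "(\<Sum>i\<le>n. rep_elt i f g * rep_elt (n - i) h g) =
      (\<Sum>i\<in>(\<lambda>j. j * (p - 1)) ` {..k}. rep_elt i f g * rep_elt (n - i) h g)"
  proof (rule sum.mono_neutral_right)
    show "(\<lambda>j. j * (p - 1)) ` {..k} \<subseteq> {..n}" using k by auto
    show "\<forall>i\<in>{..n} - (\<lambda>j. j * (p - 1)) ` {..k}. rep_elt i f g * rep_elt (n - i) h g = 0"
    proof
      fix i assume i: "i \<in> {..n} - (\<lambda>j. j * (p - 1)) ` {..k}"
      have "\<not> (p - 1) dvd i"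
      proof
        assume "(p - 1) dvd i"
        then obtain j where j: "i = j * (p - 1)" by (metis dvdE mult.commute)
        hence "j \<le> k" using i k q by simp
        thus False using i j by blast
      qed
      thus "rep_elt i f g * rep_elt (n - i) h g = 0" using g by (simp add: rep_elt_def)
    qed
  qed simp
  also have "\<dots> = (\<Sum>j\<le>k. rep_elt (j * (p - 1)) f g * rep_elt (n - j * (p - 1)) h g)"
    by (subst sum.reindex) (use q in \<open>auto simp: inj_on_def\<close>)
  also have "\<dots> = (\<Sum>j\<le>k. of_int (f j * h (k - j)) * u g ^ k)"
  proof (rule sum.cong[OF refl])
    fix j assume j: "j \<in> {..k}"
    have "n - j * (p - 1) = (k - j) * (p - 1)" by (simp add: k diff_mult_distrib)
    hence "rep_elt (j * (p - 1)) f g * rep_elt (n - j * (p - 1)) h g =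
      of_int (f j * h (k - j)) * (u g ^ j * u g ^ (k - j))" by (simp add: rep)
    also have "u g ^ j * u g ^ (k - j) = u g ^ k" using j by (simp flip: power_add)
    finally show "rep_elt (j * (p - 1)) f g * rep_elt (n - j * (p - 1)) h g = of_int (f j * h (k - j)) * u g ^ k" .
  qed
  also have "\<dots> = of_int ((f \<otimes>\<^bsub>UP \<Z>\<^esub> h) k) * u g ^ k"
    by (simp add: UP_int_sel(3)[OF f h] sum_distrib_right)
  also have "\<dots> = rep_elt n (f \<otimes>\<^bsub>UP \<Z>\<^esub> h) g" by (simp only: rep k)
  finally show ?thesis .
qed

lemma to_graded_mult:
  assumes f: "f \<in> carrier (UP \<Z>)" and h: "h \<in> carrier (UP \<Z>)"
  shows "to_graded (f \<otimes>\<^bsub>UP \<Z>\<^esub> h) = to_graded f \<otimes>\<^bsub>graded_char_ring G\<^esub> to_graded h"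
proof
  fix n
  let ?x = "\<lambda>i. rep_elt i f \<otimes>\<^bsub>char_ring G\<^esub> rep_elt (n - i) h"
  have x: "?x i \<in> gamma_filtration G n" if "i \<le> n" for i
  proof -
    have "Gam (i + (n - i)) (\<lambda>g. rep_elt i f g * rep_elt (n - i) h g)"
      by (intro Gam_mult gamma_filtration_Gam rep_elt_in)
    hence "Gam n (?x i)" using that unfolding char_ring_sel Gam_restrict by simp
    thus ?thesis by (simp add: gamma_filtration_iff char_ring_sel)
  qed
  interpret P: comm_group "graded_piece G n" by (rule comm_group_graded_piece)
  have "(to_graded f \<otimes>\<^bsub>graded_char_ring G\<^esub> to_graded h) n =
    finprod (graded_piece G n) (\<lambda>i. rcoset_mult (char_ring G) (gamma_filtration G (n + 1))
        (cls i (rep_elt i f)) (cls (n - i) (rep_elt (n - i) h))) {..n}"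
    by (simp add: graded_char_ring_def to_graded_def)
  also have "\<dots> = finprod (graded_piece G n) (\<lambda>i. cls n (?x i)) {..n}"
    by (rule P.finprod_cong') (auto simp: rcoset_mult_cls[OF rep_elt_in rep_elt_in] carrier_graded_piece x)
  also have "\<dots> = cls n (\<lambda>g\<in>carrier G. \<Sum>i\<le>n. ?x i g)"
    by (rule finprod_graded_piece_cls) (auto intro: x)
  also have "(\<lambda>g\<in>carrier G. \<Sum>i\<le>n. ?x i g) = rep_elt n (f \<otimes>\<^bsub>UP \<Z>\<^esub> h)"
  proof
    fix g
    show "(\<lambda>g\<in>carrier G. \<Sum>i\<le>n. ?x i g) g = rep_elt n (f \<otimes>\<^bsub>UP \<Z>\<^esub> h) g"
      using sum_rep_elt[OF f h, of g n] by (cases "g \<in> carrier G") (simp_all add: char_ring_sel, simp add: rep_elt_def)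
  qed
  finally show "to_graded (f \<otimes>\<^bsub>UP \<Z>\<^esub> h) n = (to_graded f \<otimes>\<^bsub>graded_char_ring G\<^esub> to_graded h) n"
    unfolding to_graded_def[of "f \<otimes>\<^bsub>UP \<Z>\<^esub> h"] by (rule sym)
qed

lemma to_graded_one: "to_graded \<one>\<^bsub>UP \<Z>\<^esub> = \<one>\<^bsub>graded_char_ring G\<^esub>"
proof
  fix n
  show "to_graded \<one>\<^bsub>UP \<Z>\<^esub> n = \<one>\<^bsub>graded_char_ring G\<^esub> n"
  proof (cases "n = 0")
    case True
    have "rep_elt 0 \<one>\<^bsub>UP \<Z>\<^esub> = \<one>\<^bsub>char_ring G\<^esub>"
      by (auto simp: rep_elt_def UP_int_one char_ring_sel)
    thus ?thesis using True by (simp add: to_graded_def cls_def graded_char_ring_def)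
  next
    case False
    have "to_graded \<one>\<^bsub>UP \<Z>\<^esub> n = \<one>\<^bsub>graded_piece G n\<^esub>"
      unfolding to_graded_eq_one_iff using False by (auto simp: UP_int_one)
    thus ?thesis using False by (simp add: graded_char_ring_def)
  qed
qed

lemma to_graded_ring_hom: "to_graded \<in> Ring.ring_hom (UP \<Z>) (graded_char_ring G)"
  by (rule ring_hom_memI) (auto simp: to_graded_carrier to_graded_add to_graded_mult to_graded_one)

text \<open>The last clause picks the coefficient 0 for trivial classes. It makes f a polynomial,
  since almost all classes are trivial, and gives homogeneous elements homogeneous
  preimages.\<close>

lemma to_graded_preimage:
  assumes a: "a \<in> carrier (graded_char_ring G)"
  shows "\<exists>f\<in>carrier (UP \<Z>). to_graded f = a \<and> (\<forall>k. a (k * (p - 1)) = \<one>\<^bsub>graded_piece G (k * (p - 1))\<^esub> \<longrightarrow> f k = 0)"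
proof -
  have ex: "\<exists>c::int. a (k * (p - 1)) = cls (k * (p - 1)) (\<lambda>g\<in>carrier G. of_int c * u g ^ k) \<and>
     (a (k * (p - 1)) = \<one>\<^bsub>graded_piece G (k * (p - 1))\<^esub> \<longrightarrow> c = 0)" for k
  proof -
    let ?n = "k * (p - 1)"
    have mem: "(\<lambda>g\<in>carrier G. of_int c * u g ^ k) \<in> gamma_filtration G ?n" for c
      using Gam_of_int_mult[OF Gam_u_power[of k]] unfolding Gam_def .
    show ?thesis
    proof (cases "a ?n = \<one>\<^bsub>graded_piece G ?n\<^esub>")
      case True
      have "(\<lambda>g\<in>carrier G. of_int 0 * u g ^ k) = \<zero>\<^bsub>char_ring G\<^esub>" by (simp add: char_ring_sel)
      hence "cls ?n (\<lambda>g\<in>carrier G. of_int 0 * u g ^ k) = \<one>\<^bsub>graded_piece G ?n\<^esub>" using cls_zero by simp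
      thus ?thesis using True by (intro exI[of _ 0]) simp
    next
      case False
      obtain x where x: "x \<in> gamma_filtration G ?n" "a ?n = cls ?n x"
        using a by (auto simp: graded_char_ring_sel carrier_graded_piece)
      obtain c :: int where c: "Gam (?n + 1) (\<lambda>g. x g - of_int c * u g ^ k)"
        using Gam_representative[OF gamma_filtration_Gam[OF x(1)]] by blast
      have "cls ?n x = cls ?n (\<lambda>g\<in>carrier G. of_int c * u g ^ k)"
        unfolding cls_eq_iff[OF x(1) mem] by (rule Gam_subst[OF c]) simp
      thus ?thesis using x(2) False by blast
    qed
  qed
  then obtain f :: "nat \<Rightarrow> int" where f: "\<And>k. a (k * (p - 1)) = cls (k * (p - 1)) (\<lambda>g\<in>carrier G. of_int (f k) * u g ^ k)"
    "\<And>k. a (k * (p - 1)) = \<one>\<^bsub>graded_piece G (k * (p - 1))\<^esub> \<Longrightarrow> f k = 0" by metis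
  have q: "p - 1 > 0" using p_gt_1 by simp
  have "finite {n. a n \<noteq> \<one>\<^bsub>graded_piece G n\<^esub>}" using a by (simp add: graded_char_ring_sel)
  then obtain N where N: "\<And>n. a n \<noteq> \<one>\<^bsub>graded_piece G n\<^esub> \<Longrightarrow> n \<le> N"
    using finite_nat_set_iff_bounded_le by (metis (mono_tags, lifting) mem_Collect_eq)
  have "f k = 0" if "k > N" for k
  proof (rule f(2), rule ccontr)
    assume "a (k * (p - 1)) \<noteq> \<one>\<^bsub>graded_piece G (k * (p - 1))\<^esub>"
    hence "k * (p - 1) \<le> N" by (rule N)
    moreover have "k * 1 \<le> k * (p - 1)" using q by (intro mult_le_mono2) simp
    ultimately show False using that by simp
  qed
  hence fc: "f \<in> carrier (UP \<Z>)" by (auto simp: up_int_iff)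
  have "to_graded f = a"
  proof
    fix n show "to_graded f n = a n"
    proof (cases "(p - 1) dvd n")
      case True
      then obtain k where k: "n = k * (p - 1)" by (metis dvdE mult.commute)
      have "rep_elt n f = (\<lambda>g\<in>carrier G. of_int (f k) * u g ^ k)" using q by (simp add: rep_elt_def k)
      thus ?thesis using f(1)[of k] k by (simp add: to_graded_def)
    next
      case False
      \<comment> \<open>Here the vanishing result for p-groups enters: there is nothing in degrees
        not divisible by p - 1.\<close>
      have "trivial_group (graded_piece G n)" by (rule trivial_graded_piece_p_group[OF False])
      moreover have "a n \<in> carrier (graded_piece G n)" using a by (simp add: graded_char_ring_sel)
      moreover have "to_graded f n \<in> carrier (graded_piece G n)" using to_graded_carrier[OF fc] by (simp add: graded_char_ring_sel)
      ultimately show ?thesis by (auto simp: trivial_group_def)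
    qed
  qed
  thus ?thesis using fc f(2) by blast
qed

lemma to_graded_surj: "to_graded ` carrier (UP \<Z>) = carrier (graded_char_ring G)"
  using to_graded_carrier to_graded_preimage by blast

lemma to_graded_homogeneous:
  "to_graded ` {f \<in> carrier (UP \<Z>). \<forall>k. up_ring.coeff (UP \<Z>) f k \<noteq> 0 \<longrightarrow> k * (p - 1) = n} =
     graded_char_ring_component G n"
proof (intro equalityI subsetI)
  fix a assume "a \<in> to_graded ` {f \<in> carrier (UP \<Z>). \<forall>k. up_ring.coeff (UP \<Z>) f k \<noteq> 0 \<longrightarrow> k * (p - 1) = n}"
  then obtain f where f: "f \<in> carrier (UP \<Z>)" "\<And>k. f k \<noteq> 0 \<Longrightarrow> k * (p - 1) = n" "a = to_graded f"
    by (auto simp: UP_int_sel(1))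
  have "a m = \<one>\<^bsub>graded_piece G m\<^esub>" if "m \<noteq> n" for m
    unfolding f(3) to_graded_eq_one_iff
  proof (intro allI impI)
    fix k assume "m = k * (p - 1)"
    hence "f k = 0" using f(2)[of k] that by auto
    thus "if k = 0 then f k = 0 else int p dvd f k" by auto
  qed
  thus "a \<in> graded_char_ring_component G n"
    using to_graded_carrier[OF f(1)] f(3) by (simp add: graded_char_ring_component_def)
next
  fix a assume "a \<in> graded_char_ring_component G n"
  hence a: "a \<in> carrier (graded_char_ring G)" "\<And>m. m \<noteq> n \<Longrightarrow> a m = \<one>\<^bsub>graded_piece G m\<^esub>"
    by (auto simp: graded_char_ring_component_def)
  obtain f where f: "f \<in> carrier (UP \<Z>)" "to_graded f = a"
    "\<And>k. a (k * (p - 1)) = \<one>\<^bsub>graded_piece G (k * (p - 1))\<^esub> \<Longrightarrow> f k = 0"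
    using to_graded_preimage[OF a(1)] by blast
  have "k * (p - 1) = n" if "up_ring.coeff (UP \<Z>) f k \<noteq> 0" for k
    using f(3)[of k] a(2)[of "k * (p - 1)"] that unfolding UP_int_sel(1)[OF f(1)] by blast
  thus "a \<in> to_graded ` {f \<in> carrier (UP \<Z>). \<forall>k. up_ring.coeff (UP \<Z>) f k \<noteq> 0 \<longrightarrow> k * (p - 1) = n}"
    unfolding f(2)[symmetric] using f(1) by (intro imageI CollectI conjI allI impI)
qed

theorem graded_char_ring_iso:
  "\<exists>h. h \<in> graded_ring_iso (graded_char_ring G) (graded_char_ring_component G)
       (poly_quot_px p) (poly_quot_px_component p (p - 1))"
proof -
  let ?U = "UP \<Z>" and ?S = "graded_char_ring G"
  interpret U: cring ?U by (rule cring_UP_int)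
  have zero: "to_graded \<zero>\<^bsub>?U\<^esub> = \<zero>\<^bsub>?S\<^esub>"
  proof
    fix n show "to_graded \<zero>\<^bsub>?U\<^esub> n = \<zero>\<^bsub>?S\<^esub> n"
      unfolding graded_char_ring_sel to_graded_eq_one_iff by (simp add: UP_int_zero)
  qed
  \<comment> \<open>The ring axioms for the graded ring are inherited from the polynomials, as it is
    the full image of a homomorphism.\<close>
  have "?S\<lparr>carrier := to_graded ` carrier ?U, zero := to_graded \<zero>\<^bsub>?U\<^esub>\<rparr> = ?S"
    by (simp add: to_graded_surj zero)
  hence "ring ?S" using U.ring_hom_imp_img_ring[OF to_graded_ring_hom] by simp
  then interpret H: ring_hom_ring ?U ?S to_graded
    by (intro ring_hom_ringI2 U.ring_axioms to_graded_ring_hom)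
  have ker: "a_kernel ?U ?S to_graded = ideal_px p"
  proof -
    have "to_graded f = \<zero>\<^bsub>?S\<^esub> \<longleftrightarrow> f 0 = 0 \<and> (\<forall>k>0. int p dvd f k)" for f
    proof -
      have "to_graded f = \<zero>\<^bsub>?S\<^esub> \<longleftrightarrow> (\<forall>n k. n = k * (p - 1) \<longrightarrow> (if k = 0 then f k = 0 else int p dvd f k))"
        by (simp only: fun_eq_iff graded_char_ring_sel to_graded_eq_one_iff)
      also have "\<dots> \<longleftrightarrow> f 0 = 0 \<and> (\<forall>k>0. int p dvd f k)" by (auto split: if_splits)
      finally show ?thesis .
    qed
    hence mem: "x \<in> a_kernel ?U ?S to_graded \<longleftrightarrow> x \<in> ideal_px p" for x
      unfolding a_kernel_def' ideal_px_iff mem_Collect_eq by simp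
    show ?thesis by (rule Set.set_eqI) (rule mem)
  qed
  define h where "h = (\<lambda>Y. the_elem (to_graded ` Y))"
  have iso: "h \<in> ring_iso (poly_quot_px p) ?S"
    using H.FactRing_iso_set[OF to_graded_surj] unfolding ker poly_quot_px_def h_def .
  have comp: "h ` poly_quot_px_component p (p - 1) n = graded_char_ring_component G n" for n
  proof -
    have "h (ideal_px p +>\<^bsub>?U\<^esub> f) = to_graded f" if "f \<in> carrier ?U" for f
      unfolding h_def ker[symmetric] by (rule H.the_elem_simp[OF that])
    hence "h ` poly_quot_px_component p (p - 1) n =
      to_graded ` {f \<in> carrier ?U. \<forall>k. up_ring.coeff ?U f k \<noteq> 0 \<longrightarrow> k * (p - 1) = n}"
      by (auto simp: poly_quot_px_component_def image_image intro!: image_cong)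
    thus ?thesis using to_graded_homogeneous by simp
  qed
  have sub: "poly_quot_px_component p (p - 1) n \<subseteq> carrier (poly_quot_px p)" for n
    by (auto simp: poly_quot_px_component_def poly_quot_px_def FactRing_def A_RCOSETS_def')
  \<comment> \<open>The isomorphism theorem yields a map out of the quotient; inverting it as a ring
    isomorphism uses that the quotient is a ring.\<close>
  have "ring (poly_quot_px p)"
    unfolding poly_quot_px_def ker[symmetric] by (rule ideal.quotient_is_ring[OF H.kernel_is_ideal])
  hence inv: "inv_into (carrier (poly_quot_px p)) h \<in> ring_iso ?S (poly_quot_px p)"
    by (rule ring_iso_set_sym[OF _ iso])
  have inj: "inj_on h (carrier (poly_quot_px p))" using iso by (simp add: ring_iso_def bij_betw_def)
  have "inv_into (carrier (poly_quot_px p)) h ` graded_char_ring_component G n = poly_quot_px_component p (p - 1) n" for n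
    unfolding comp[symmetric] by (rule inv_into_image_cancel[OF inj sub])
  with inv show ?thesis by (auto simp: graded_ring_iso_def)
qed

end

theorem theorem1p4:
  fixes p :: nat
    and G :: "('g, 'm) monoid_scheme"
    and C :: "'c monoid"
  assumes "Factorial_Ring.prime p"
  shows "(group G \<and> (\<exists>k. Coset.order G = p ^ k) \<longrightarrow>
            (\<forall>n. \<not> (p - 1) dvd n \<longrightarrow> trivial_group (graded_piece G n))) \<and>
         (group C \<and> cyclic_group C \<and> Coset.order C = p \<longrightarrow>
            (\<exists>h. h \<in> graded_ring_iso
                   (graded_char_ring C) (graded_char_ring_component C)
                   (poly_quot_px p) (poly_quot_px_component p (p - 1))))"
proof (intro conjI impI allI)
  fix n
  assume "group G \<and> (\<exists>k. Coset.order G = p ^ k)" and n: "\<not> (p - 1) dvd n"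
  then obtain k where "group G" "Coset.order G = p ^ k" by blast
  hence "p_group G p k" using assms by (intro p_group.intro p_group_axioms.intro)
  thus "trivial_group (graded_piece G n)" using n by (rule p_group.trivial_graded_piece_p_group)
next
  assume "group C \<and> cyclic_group C \<and> Coset.order C = p"
  hence "prime_order_group C p" using assms
    by (intro prime_order_group.intro p_group.intro p_group_axioms.intro) auto
  thus "\<exists>h. h \<in> graded_ring_iso (graded_char_ring C) (graded_char_ring_component C)
      (poly_quot_px p) (poly_quot_px_component p (p - 1))"
    by (rule prime_order_group.graded_char_ring_iso)
qed

end
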